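(* Let $z,z'\in\mathbb{C}$ be a principal or complementary pair, $\xi\in(0,1)$, $\mathbb{Z}':=\mathbb{Z}+1/2$, let $D_{z,z',\xi}$ be the hypergeometric difference operator on $\ell^2(\mathbb{Z}')$ with orthonormal eigenbasis $(\psi_a)_{a\in\mathbb{Z}'}$, $D_{z,z',\xi}\psi_a=(1-\xi)a\psi_a$, and let $K$ be the orthogonal projection onto $\overline{\mathrm{span}}\{\psi_a\mid a\in\mathbb{Z}',a\ge1/2\}$. Let $$\mathcal{A}_{z,z',\xi}:=\sum_{a\in\mathbb{Z}',\,a\le-1/2}(1-\xi)a\,\rho_K(a^*(\psi_a)a(\psi_a))-\sum_{a\in\mathbb{Z}',\,a\ge1/2}(1-\xi)a\,\rho_K(a(\psi_a)a^*(\psi_a))$$ be defined on the linear span of the vectors $$\psi_{\alpha_1,\dots,\alpha_n;\beta_1,\dots,\beta_n}:=\rho_K(a^*(\psi_{-\alpha_1})\cdots a^*(\psi_{-\alpha_n})a(\psi_{\beta_1})\cdots a(\psi_{\beta_n}))\Omega_K,$$ $n\ge0$, $\alpha_1>\cdots>\alpha_n\ge1/2$, $\beta_1>\cdots>\beta_n\ge1/2$ in $\mathbb{Z}'$. Then the closure of $\mathcal{A}_{z,z',\xi}$ coincides with $d\Gamma_K(D_{z,z',\xi})$.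
   Context: **CAR notions.** Inner products are linear in the first argument. The CAR algebra $\mathfrak{A}(\mathcal{H})$ is the universal unital $C^*$-algebra generated by $a(h)$ ($h\in\mathcal{H}$) with $h\mapsto a^*(h):=a(h)^*$ linear and $a(h)a(k)+a(k)a(h)=0$, $a^*(h)a(k)+a(k)a^*(h)=\langle h,k\rangle1$. For unitary $U$, $\gamma_U$ is the automorphism with $\gamma_U(a(h))=a(Uh)$. $\mathfrak{I}(\mathcal{H})$ (GICAR algebra) is the fixed-point algebra of $\{\gamma_{\lambda1}\}_{\lambda\in\mathbb{T}}$. For $0\le K\le1$, $\varphi_K$ is the state with $\varphi_K(a^*(h_n)\cdots a^*(h_1)a(k_1)\cdots a(k_m))=\delta_{n,m}\det[\langle Kh_i,k_j\rangle]$, and $(\rho_K,\mathcal{H}_K,\Omega_K)$ is the GNS triple of $\varphi_K|_{\mathfrak{I}(\mathcal{H})}$; here $\mathcal{H}=\ell^2(\mathbb{Z}')$. If $A$ is self-adjoint and $U_t=e^{\mathrm{i}tA}$ commutes with $K$, $\Gamma_K(U_t)$ is the strongly continuous unitary group on $\mathcal{H}_K$ with $\Gamma_K(U_t)\rho_K(x)\Omega_K=\rho_K(\gamma_{U_t}(x))\Omega_K$, and $d\Gamma_K(A)$ is the self-adjoint operator with $\Gamma_K(U_t)=e^{\mathrm{i}t\,d\Gamma_K(A)}$. **Hypergeometric difference operator.** A pair $z,z'\in\mathbb{C}$ is principal if $z\in\mathbb{C}\setminus\mathbb{R}$ and $z'=\bar z$; complementary if $z,z'\in\mathbb{R}$ and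 $k<z,z'<k+1$ for some $k\in\mathbb{Z}$. On finitely supported functions on $\mathbb{Z}'$, $[D_{z,z',\xi}f](x)=\sqrt{\xi(z+x+\frac12)(z'+x+\frac12)}f(x+1)-(x+\xi(z+z'+x))f(x)+\sqrt{\xi(z+x-\frac12)(z'+x-\frac12)}f(x-1)$. It is a known fact (Olshanski) that this operator is essentially self-adjoint; its closure is again denoted $D_{z,z',\xi}$, and there is an orthonormal basis $(\psi_a)_{a\in\mathbb{Z}'}$ of $\ell^2(\mathbb{Z}')$ with $D_{z,z',\xi}\psi_a=(1-\xi)a\psi_a$. On each vector $\psi_{\alpha_1,\dots;\beta_1,\dots}$ only finitely many terms of $\mathcal{A}_{z,z',\xi}$ are nonzero; the $n=0$ vector is $\Omega_K$. *)

theory Defs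
  imports "HOL-Analysis.Analysis" "HOL-Algebra.Module" "Jordan_Normal_Form.Determinant"
begin

section \<open>Complex Hilbert spaces\<close>

class complex_vector = real_vector +
  fixes scaleC :: "complex \<Rightarrow> 'a \<Rightarrow> 'a"  (infixr \<open>*\<^sub>C\<close> 75)
  assumes scaleC_add_right: "c *\<^sub>C (x + y) = c *\<^sub>C x + c *\<^sub>C y"
    and scaleC_add_left: "(c + d) *\<^sub>C x = c *\<^sub>C x + d *\<^sub>C x"
    and scaleC_scaleC: "c *\<^sub>C d *\<^sub>C x = (c * d) *\<^sub>C x"
    and scaleR_scaleC: "r *\<^sub>R x = complex_of_real r *\<^sub>C x"

class chilbert_space = banach + complex_vector +
  fixes cinner :: "'a \<Rightarrow> 'a \<Rightarrow> complex"
  assumes cinner_add_left: "cinner (x + y) w = cinner x w + cinner y w"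
    and cinner_scaleC_left: "cinner (c *\<^sub>C x) y = c * cinner x y"
    and cinner_commute: "cinner x y = cnj (cinner y x)"
    and cinner_same: "cinner x x = complex_of_real ((norm x)\<^sup>2)"

definition clinear :: "('a::complex_vector \<Rightarrow> 'b::complex_vector) \<Rightarrow> bool" where
  "clinear T \<longleftrightarrow> (\<forall>x y. T (x + y) = T x + T y) \<and> (\<forall>c x. T (c *\<^sub>C x) = c *\<^sub>C T x)"

definition bounded_clinear :: "('a::chilbert_space \<Rightarrow> 'b::chilbert_space) \<Rightarrow> bool" where
  "bounded_clinear T \<longleftrightarrow> clinear T \<and> (\<exists>C. \<forall>x. norm (T x) \<le> C * norm x)"

abbreviation cspan :: "'a::complex_vector set \<Rightarrow> 'a set" where
  "cspan \<equiv> Modules.module.span (*\<^sub>C)"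

definition ortho_proj :: "'a::chilbert_space set \<Rightarrow> 'a \<Rightarrow> 'a" where
  "ortho_proj S x = (THE p. p \<in> S \<and> (\<forall>y\<in>S. cinner (x - p) y = 0))"

definition orthonormal_basis :: "'i set \<Rightarrow> ('i \<Rightarrow> 'a::chilbert_space) \<Rightarrow> bool" where
  "orthonormal_basis I e \<longleftrightarrow>
     (\<forall>i\<in>I. \<forall>j\<in>I. cinner (e i) (e j) = (if i = j then 1 else 0)) \<and>
     closure (cspan (e ` I)) = UNIV"


section \<open>Unbounded operators and one-parameter unitary groups\<close>

text \<open>An operator with domain is its graph, a set of pairs \<open>(h, A h)\<close>; the closure of an operator
  is then the topological closure of its graph in the product space.\<close>

type_synonym 'a operator = "('a \<times> 'a) set"

definition adjoint_op :: "'a::chilbert_space operator \<Rightarrow> 'a operator" where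
  "adjoint_op A = {(u, v). \<forall>(x, y)\<in>A. cinner y u = cinner x v}"

text \<open>If the domain of \<open>A\<close> is dense, then \<open>adjoint_op A\<close> is the graph of a linear operator, so that
  \<open>adjoint_op A = A\<close> makes \<open>A\<close> one, too.\<close>

definition self_adjoint_op :: "'a::chilbert_space operator \<Rightarrow> bool" where
  "self_adjoint_op A \<longleftrightarrow> closure (Domain A) = UNIV \<and> adjoint_op A = A"

definition unitary_op :: "('a::chilbert_space \<Rightarrow> 'a) \<Rightarrow> bool" where
  "unitary_op U \<longleftrightarrow> clinear U \<and> surj U \<and> (\<forall>x y. cinner (U x) (U y) = cinner x y)"

definition unitary_group :: "(real \<Rightarrow> 'a::chilbert_space \<Rightarrow> 'a) \<Rightarrow> bool" where
  "unitary_group U \<longleftrightarrow>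
     (\<forall>t. unitary_op (U t)) \<and>
     U 0 = id \<and> (\<forall>s t. U (s + t) = U s \<circ> U t) \<and>
     (\<forall>h. continuous_on UNIV (\<lambda>t. U t h))"

definition group_generator :: "(real \<Rightarrow> 'a::chilbert_space \<Rightarrow> 'a) \<Rightarrow> 'a operator" where
  "group_generator U =
     {(h, g). ((\<lambda>t. (1 / (\<i> * complex_of_real t)) *\<^sub>C (U t h - h)) \<longlongrightarrow> g) (at 0)}"

text \<open>\<open>U\<^sub>t = e\<^sup>i\<^sup>t\<^sup>A\<close> is read through Stone's theorem: for self-adjoint \<open>A\<close> it is the unique strongly
  continuous one-parameter unitary group with infinitesimal generator \<open>A\<close>.\<close>

definition is_exp_group :: "'a::chilbert_space operator \<Rightarrow> (real \<Rightarrow> 'a \<Rightarrow> 'a) \<Rightarrow> bool" where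
  "is_exp_group A U \<longleftrightarrow> unitary_group U \<and> group_generator U = A"

definition exp_group :: "'a::chilbert_space operator \<Rightarrow> real \<Rightarrow> 'a \<Rightarrow> 'a" where
  "exp_group A = (THE U. is_exp_group A U)"


section \<open>Unital C*-algebras\<close>

class cstar_algebra = real_normed_algebra_1 + banach + complex_vector +
  fixes star :: "'a \<Rightarrow> 'a"
  assumes scaleC_mult_left: "(c *\<^sub>C x) * y = c *\<^sub>C (x * y)"
    and scaleC_mult_right: "x * (c *\<^sub>C y) = c *\<^sub>C (x * y)"
    and norm_scaleC: "norm (c *\<^sub>C x) = cmod c * norm x"
    and star_add: "star (x + y) = star x + star y"
    and star_scaleC: "star (c *\<^sub>C x) = cnj c *\<^sub>C star x"
    and star_mult: "star (x * y) = star y * star x"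
    and star_star: "star (star x) = x"
    and cstar_identity: "norm (star x * x) = (norm x)\<^sup>2"

definition star_subalgebra :: "'a::cstar_algebra set \<Rightarrow> bool" where
  "star_subalgebra S \<longleftrightarrow> 1 \<in> S \<and>
     (\<forall>x\<in>S. \<forall>y\<in>S. x + y \<in> S \<and> x * y \<in> S) \<and>
     (\<forall>c. \<forall>x\<in>S. c *\<^sub>C x \<in> S) \<and> (\<forall>x\<in>S. star x \<in> S)"

definition generated_cstar :: "'a::cstar_algebra set \<Rightarrow> 'a set" where
  "generated_cstar G = \<Inter>{S. star_subalgebra S \<and> closed S \<and> G \<subseteq> S}"

definition star_automorphism :: "('a::cstar_algebra \<Rightarrow> 'a) \<Rightarrow> bool" where
  "star_automorphism g \<longleftrightarrow> clinear g \<and> bij g \<and>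
     (\<forall>x y. g (x * y) = g x * g y) \<and> (\<forall>x. g (star x) = star (g x))"

definition cstar_state :: "('a::cstar_algebra \<Rightarrow> complex) \<Rightarrow> bool" where
  "cstar_state \<phi> \<longleftrightarrow>
     (\<forall>x y. \<phi> (x + y) = \<phi> x + \<phi> y) \<and> (\<forall>c x. \<phi> (c *\<^sub>C x) = c * \<phi> x) \<and>
     (\<forall>x. \<phi> (star x * x) \<in> \<real> \<and> 0 \<le> Re (\<phi> (star x * x))) \<and> \<phi> 1 = 1"

text \<open>The universal property below quantifies over all unital C*-algebras, so these are also needed
  as objects of the logic rather than as types of a class.\<close>

definition complex_ring :: "complex ring" where
  "complex_ring = \<lparr>carrier = UNIV, mult = (*), one = 1, zero = 0, add = (+)\<rparr>"

record 'b cstar_struct = "(complex, 'b) module" +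
  adj :: "'b \<Rightarrow> 'b"
  nrm :: "'b \<Rightarrow> real"

definition unital_cstar_struct :: "'b cstar_struct \<Rightarrow> bool" where
  "unital_cstar_struct B \<longleftrightarrow>
     ring B \<and> Module.module complex_ring B \<and>
     (\<forall>c. \<forall>x\<in>carrier B. \<forall>y\<in>carrier B.
        (c \<odot>\<^bsub>B\<^esub> x) \<otimes>\<^bsub>B\<^esub> y = c \<odot>\<^bsub>B\<^esub> (x \<otimes>\<^bsub>B\<^esub> y) \<and>
        x \<otimes>\<^bsub>B\<^esub> (c \<odot>\<^bsub>B\<^esub> y) = c \<odot>\<^bsub>B\<^esub> (x \<otimes>\<^bsub>B\<^esub> y)) \<and>
     (\<forall>x\<in>carrier B. adj B x \<in> carrier B \<and> adj B (adj B x) = x) \<and>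
     (\<forall>x\<in>carrier B. \<forall>y\<in>carrier B.
        adj B (x \<oplus>\<^bsub>B\<^esub> y) = adj B x \<oplus>\<^bsub>B\<^esub> adj B y \<and>
        adj B (x \<otimes>\<^bsub>B\<^esub> y) = adj B y \<otimes>\<^bsub>B\<^esub> adj B x) \<and>
     (\<forall>c. \<forall>x\<in>carrier B. adj B (c \<odot>\<^bsub>B\<^esub> x) = cnj c \<odot>\<^bsub>B\<^esub> adj B x) \<and>
     (\<forall>x\<in>carrier B. 0 \<le> nrm B x \<and> (nrm B x = 0 \<longleftrightarrow> x = \<zero>\<^bsub>B\<^esub>)) \<and>
     (\<forall>c. \<forall>x\<in>carrier B. nrm B (c \<odot>\<^bsub>B\<^esub> x) = cmod c * nrm B x) \<and>
     (\<forall>x\<in>carrier B. \<forall>y\<in>carrier B.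
        nrm B (x \<oplus>\<^bsub>B\<^esub> y) \<le> nrm B x + nrm B y \<and>
        nrm B (x \<otimes>\<^bsub>B\<^esub> y) \<le> nrm B x * nrm B y) \<and>
     (\<forall>x\<in>carrier B. nrm B (adj B x \<otimes>\<^bsub>B\<^esub> x) = (nrm B x)\<^sup>2) \<and>
     Metric_space.mcomplete (carrier B) (\<lambda>x y. nrm B (x \<ominus>\<^bsub>B\<^esub> y))"

definition star_hom_to :: "'b cstar_struct \<Rightarrow> ('a::cstar_algebra \<Rightarrow> 'b) \<Rightarrow> bool" where
  "star_hom_to B g \<longleftrightarrow>
     range g \<subseteq> carrier B \<and> g 1 = \<one>\<^bsub>B\<^esub> \<and>
     (\<forall>x y. g (x + y) = g x \<oplus>\<^bsub>B\<^esub> g y \<and> g (x * y) = g x \<otimes>\<^bsub>B\<^esub> g y) \<and>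
     (\<forall>c x. g (c *\<^sub>C x) = c \<odot>\<^bsub>B\<^esub> g x) \<and> (\<forall>x. g (star x) = adj B (g x))"


section \<open>The CAR algebra\<close>

definition CAR_map :: "('h::chilbert_space \<Rightarrow> 'a::cstar_algebra) \<Rightarrow> bool" where
  "CAR_map a \<longleftrightarrow>
     clinear (\<lambda>h. star (a h)) \<and>
     (\<forall>h k. a h * a k + a k * a h = 0) \<and>
     (\<forall>h k. star (a h) * a k + a k * star (a h) = cinner h k *\<^sub>C 1)"

definition CAR_map_to :: "'b cstar_struct \<Rightarrow> ('h::chilbert_space \<Rightarrow> 'b) \<Rightarrow> bool" where
  "CAR_map_to B b \<longleftrightarrow>
     range b \<subseteq> carrier B \<and>
     (\<forall>h k. adj B (b (h + k)) = adj B (b h) \<oplus>\<^bsub>B\<^esub> adj B (b k)) \<and>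
     (\<forall>c h. adj B (b (c *\<^sub>C h)) = c \<odot>\<^bsub>B\<^esub> adj B (b h)) \<and>
     (\<forall>h k. b h \<otimes>\<^bsub>B\<^esub> b k \<oplus>\<^bsub>B\<^esub> b k \<otimes>\<^bsub>B\<^esub> b h = \<zero>\<^bsub>B\<^esub>) \<and>
     (\<forall>h k. adj B (b h) \<otimes>\<^bsub>B\<^esub> b k \<oplus>\<^bsub>B\<^esub> b k \<otimes>\<^bsub>B\<^esub> adj B (b h) = cinner h k \<odot>\<^bsub>B\<^esub> \<one>\<^bsub>B\<^esub>)"

text \<open>The whole type \<open>'a\<close>, with the map \<open>a\<close>, is the universal unital C*-algebra generated by the
  \<open>a h\<close>. Uniqueness of \<open>g\<close> is automatic, as *-homomorphisms are continuous. The targets \<open>B\<close> range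
  over the C*-algebras whose carrier is a subset of \<open>'a\<close>; this is no restriction, since up to
  isomorphism these include every C*-algebra generated by the image of a CAR map \<open>b\<close>: such an
  algebra has at most the cardinality of \<open>'a\<close>.\<close>

definition CAR_algebra :: "('h::chilbert_space \<Rightarrow> 'a::cstar_algebra) \<Rightarrow> bool" where
  "CAR_algebra a \<longleftrightarrow>
     CAR_map a \<and> generated_cstar (range a) = UNIV \<and>
     (\<forall>(B :: 'a cstar_struct) b. unital_cstar_struct B \<and> CAR_map_to B b \<longrightarrow>
        (\<exists>g. star_hom_to B g \<and> (\<forall>h. g (a h) = b h)))"

definition gauge_aut :: "('h::chilbert_space \<Rightarrow> 'a::cstar_algebra) \<Rightarrow> ('h \<Rightarrow> 'h) \<Rightarrow> 'a \<Rightarrow> 'a" where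
  "gauge_aut a U = (THE g. star_automorphism g \<and> (\<forall>h. g (a h) = a (U h)))"

definition GICAR :: "('h::chilbert_space \<Rightarrow> 'a::cstar_algebra) \<Rightarrow> 'a set" where
  "GICAR a = {x. \<forall>l. cmod l = 1 \<longrightarrow> gauge_aut a (\<lambda>h. l *\<^sub>C h) x = x}"

text \<open>\<open>hs = [h\<^sub>1, \<dots>, h\<^sub>n]\<close> and \<open>ks = [k\<^sub>1, \<dots>, k\<^sub>m]\<close>; the creators occur in reverse order.\<close>

definition quasi_free_state ::
  "('h::chilbert_space \<Rightarrow> 'a::cstar_algebra) \<Rightarrow> ('h \<Rightarrow> 'h) \<Rightarrow> ('a \<Rightarrow> complex) \<Rightarrow> bool" where
  "quasi_free_state a K \<phi> \<longleftrightarrow> cstar_state \<phi> \<and>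
     (\<forall>hs ks. \<phi> (prod_list (map (\<lambda>h. star (a h)) (rev hs)) * prod_list (map a ks)) =
        (if length hs = length ks
         then Determinant.det (Matrix.mat (length hs) (length hs)
                (\<lambda>(i, j). cinner (K (hs ! i)) (ks ! j)))
         else 0))"


section \<open>GNS representation and second quantization\<close>

definition star_representation ::
  "'a::cstar_algebra set \<Rightarrow> ('a \<Rightarrow> 'k::chilbert_space \<Rightarrow> 'k) \<Rightarrow> bool" where
  "star_representation S \<rho> \<longleftrightarrow>
     (\<forall>x\<in>S. bounded_clinear (\<rho> x)) \<and> \<rho> 1 = id \<and>
     (\<forall>x\<in>S. \<forall>y\<in>S. \<forall>v. \<rho> (x + y) v = \<rho> x v + \<rho> y v \<and> \<rho> (x * y) v = \<rho> x (\<rho> y v)) \<and>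
     (\<forall>c. \<forall>x\<in>S. \<forall>v. \<rho> (c *\<^sub>C x) v = c *\<^sub>C \<rho> x v) \<and>
     (\<forall>x\<in>S. \<forall>v w. cinner (\<rho> (star x) v) w = cinner v (\<rho> x w))"

text \<open>The GNS triple of the restriction of \<open>\<phi>\<close> to the subalgebra \<open>S\<close>; the GNS space is the whole
  type \<open>'k\<close>.\<close>

definition GNS_triple :: "'a::cstar_algebra set \<Rightarrow> ('a \<Rightarrow> complex) \<Rightarrow>
    ('a \<Rightarrow> 'k::chilbert_space \<Rightarrow> 'k) \<Rightarrow> 'k \<Rightarrow> bool" where
  "GNS_triple S \<phi> \<rho> \<Omega> \<longleftrightarrow> star_representation S \<rho> \<and>
     closure ((\<lambda>x. \<rho> x \<Omega>) ` S) = UNIV \<and>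
     (\<forall>x\<in>S. cinner (\<rho> x \<Omega>) \<Omega> = \<phi> x)"

definition second_quant_group :: "('h::chilbert_space \<Rightarrow> 'a::cstar_algebra) \<Rightarrow>
    ('a \<Rightarrow> 'k::chilbert_space \<Rightarrow> 'k) \<Rightarrow> 'k \<Rightarrow> (real \<Rightarrow> 'h \<Rightarrow> 'h) \<Rightarrow> real \<Rightarrow> 'k \<Rightarrow> 'k" where
  "second_quant_group a \<rho> \<Omega> U = (THE V. unitary_group V \<and>
     (\<forall>t. \<forall>x\<in>GICAR a. V t (\<rho> x \<Omega>) = \<rho> (gauge_aut a (U t) x) \<Omega>))"

definition dGamma :: "('h::chilbert_space \<Rightarrow> 'a::cstar_algebra) \<Rightarrow>
    ('a \<Rightarrow> 'k::chilbert_space \<Rightarrow> 'k) \<Rightarrow> 'k \<Rightarrow> 'h operator \<Rightarrow> 'k operator" where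
  "dGamma a \<rho> \<Omega> A = (THE B. self_adjoint_op B \<and>
     is_exp_group B (second_quant_group a \<rho> \<Omega> (exp_group A)))"


section \<open>The Hilbert space of square-summable functions on the half-integers\<close>

definition half_integers :: "real set" where
  "half_integers = {of_int k + 1/2 | k. True}"

text \<open>Functions on the half-integers are functions on the reals that vanish off the half-integers.\<close>

typedef ell2 = "{f :: real \<Rightarrow> complex. (\<forall>x. x \<notin> half_integers \<longrightarrow> f x = 0) \<and>
    (\<lambda>x. (cmod (f x))\<^sup>2) summable_on half_integers}"
  morphisms ell2_fun Abs_ell2
  by (rule exI[of _ "\<lambda>_. 0"]) auto

setup_lifting type_definition_ell2

lemma ell2_eqI: "(\<And>x. ell2_fun f x = ell2_fun g x) \<Longrightarrow> f = g"
  by (metis ell2_fun_inject ext)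

lemma ell2_fun_off: "x \<notin> half_integers \<Longrightarrow> ell2_fun f x = 0"
  using ell2_fun[of f] by auto

lemma ell2_fun_summable: "(\<lambda>x. (cmod (ell2_fun f x))\<^sup>2) summable_on half_integers"
  using ell2_fun[of f] by auto

lemma L2_bound_summable:
  fixes f :: "real \<Rightarrow> complex"
  assumes "\<And>F. finite F \<Longrightarrow> F \<subseteq> A \<Longrightarrow> (\<Sum>x\<in>F. (cmod (f x))\<^sup>2) \<le> C"
  shows "(\<lambda>x. (cmod (f x))\<^sup>2) summable_on A"
proof (rule nonneg_bdd_above_summable_on)
  show "bdd_above (sum (\<lambda>x. (cmod (f x))\<^sup>2) ` {F. F \<subseteq> A \<and> finite F})"
    using assms by (intro bdd_aboveI[of _ C]) auto
qed auto

lemma L2_finite_le: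
  assumes "finite F" "F \<subseteq> half_integers"
  shows "L2_set (\<lambda>x. cmod (ell2_fun f x)) F
           \<le> sqrt (\<Sum>\<^sub>\<infinity>x\<in>half_integers. (cmod (ell2_fun f x))\<^sup>2)"
  unfolding L2_set_def
  by (rule real_sqrt_le_mono, rule finite_sum_le_infsum)
     (use assms ell2_fun_summable in auto)

lemma L2_add_finite_le:
  assumes "finite F" "F \<subseteq> half_integers"
  shows "(\<Sum>x\<in>F. (cmod (ell2_fun f x + ell2_fun g x))\<^sup>2)
           \<le> (sqrt (\<Sum>\<^sub>\<infinity>x\<in>half_integers. (cmod (ell2_fun f x))\<^sup>2) +
              sqrt (\<Sum>\<^sub>\<infinity>x\<in>half_integers. (cmod (ell2_fun g x))\<^sup>2))\<^sup>2"
    (is "_ \<le> (?a + ?b)\<^sup>2")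
proof -
  have "L2_set (\<lambda>x. cmod (ell2_fun f x + ell2_fun g x)) F
          \<le> L2_set (\<lambda>x. cmod (ell2_fun f x) + cmod (ell2_fun g x)) F"
    by (rule L2_set_mono) (auto intro: norm_triangle_ineq)
  also have "\<dots> \<le> L2_set (\<lambda>x. cmod (ell2_fun f x)) F + L2_set (\<lambda>x. cmod (ell2_fun g x)) F"
    by (rule L2_set_triangle_ineq)
  also have "\<dots> \<le> ?a + ?b"
    using L2_finite_le[OF assms] by (intro add_mono) auto
  finally have "(L2_set (\<lambda>x. cmod (ell2_fun f x + ell2_fun g x)) F)\<^sup>2 \<le> (?a + ?b)\<^sup>2"
    by (intro power_mono) auto
  then show ?thesis
    by (simp add: L2_set_def sum_nonneg)
qed

lemma ell2_mult_summable:
  "(\<lambda>x. ell2_fun f x * cnj (ell2_fun g x)) summable_on half_integers"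
proof -
  have "(\<lambda>x. (cmod (ell2_fun f x))\<^sup>2 + (cmod (ell2_fun g x))\<^sup>2) summable_on half_integers"
    by (intro summable_on_add ell2_fun_summable)
  then have "(\<lambda>x. norm (ell2_fun f x * cnj (ell2_fun g x))) summable_on half_integers"
  proof (rule Infinite_Sum.abs_summable_on_comparison_test')
    fix x
    have "2 * (cmod (ell2_fun f x) * cmod (ell2_fun g x))
            \<le> (cmod (ell2_fun f x))\<^sup>2 + (cmod (ell2_fun g x))\<^sup>2"
      using sum_squares_bound[of "cmod (ell2_fun f x)" "cmod (ell2_fun g x)"] by simp
    moreover have "0 \<le> cmod (ell2_fun f x) * cmod (ell2_fun g x)" by simp
    ultimately show "norm (ell2_fun f x * cnj (ell2_fun g x))
            \<le> (cmod (ell2_fun f x))\<^sup>2 + (cmod (ell2_fun g x))\<^sup>2"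
      unfolding norm_mult complex_mod_cnj by linarith
  qed
  then show ?thesis by (rule abs_summable_summable)
qed

instantiation ell2 :: "{real_normed_vector, complex_vector}"
begin

lift_definition zero_ell2 :: ell2 is "\<lambda>_. 0" by auto

lift_definition plus_ell2 :: "ell2 \<Rightarrow> ell2 \<Rightarrow> ell2" is "\<lambda>f g x. f x + g x"
proof -
  fix f g :: "real \<Rightarrow> complex"
  let ?P = "\<lambda>f. (\<forall>x. x \<notin> half_integers \<longrightarrow> f x = 0) \<and>
    (\<lambda>x. (cmod (f x))\<^sup>2) summable_on half_integers"
  assume f: "?P f" and g: "?P g"
  have "ell2_fun (Abs_ell2 f) = f" "ell2_fun (Abs_ell2 g) = g"
    using f g by (auto intro: Abs_ell2_inverse)
  then have "(\<lambda>x. (cmod (f x + g x))\<^sup>2) summable_on half_integers"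
    using L2_add_finite_le[of _ "Abs_ell2 f" "Abs_ell2 g"] by (intro L2_bound_summable) auto
  with f g show "?P (\<lambda>x. f x + g x)" by auto
qed

lift_definition scaleC_ell2 :: "complex \<Rightarrow> ell2 \<Rightarrow> ell2" is "\<lambda>c f x. c * f x"
  by (auto simp: norm_mult power_mult_distrib intro: summable_on_cmult_right)

definition "r *\<^sub>R f = complex_of_real r *\<^sub>C f" for f :: ell2
definition "- f = (- 1) *\<^sub>C f" for f :: ell2
definition "f - g = f + (- g)" for f g :: ell2
definition "norm f = sqrt (\<Sum>\<^sub>\<infinity>x\<in>half_integers. (cmod (ell2_fun f x))\<^sup>2)" for f :: ell2
definition "dist f g = norm (f - g)" for f g :: ell2
definition "sgn f = inverse (norm f) *\<^sub>R f" for f :: ell2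
definition [code del]:
  "(uniformity :: (ell2 \<times> ell2) filter) = (INF e\<in>{0<..}. principal {(x, y). dist x y < e})"
definition [code del]:
  "open (U :: ell2 set) \<longleftrightarrow> (\<forall>x\<in>U. \<forall>\<^sub>F (x', y) in uniformity. x' = x \<longrightarrow> y \<in> U)"

lemma ell2_fun_simps:
  "ell2_fun 0 x = 0"
  "ell2_fun (f + g) x = ell2_fun f x + ell2_fun g x"
  "ell2_fun (c *\<^sub>C f) x = c * ell2_fun f x"
  "ell2_fun (r *\<^sub>R f) x = complex_of_real r * ell2_fun f x"
  "ell2_fun (- f) x = - ell2_fun f x"
  "ell2_fun (f - g) x = ell2_fun f x - ell2_fun g x"
  by (simp_all add: zero_ell2.rep_eq plus_ell2.rep_eq scaleC_ell2.rep_eq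
      scaleR_ell2_def uminus_ell2_def minus_ell2_def)

lemma ell2_norm_sq: "(norm f)\<^sup>2 = (\<Sum>\<^sub>\<infinity>x\<in>half_integers. (cmod (ell2_fun f x))\<^sup>2)"
  for f :: ell2
  by (simp add: norm_ell2_def infsum_nonneg)

lemma ell2_norm_le:
  fixes f :: ell2
  assumes "0 \<le> C" "\<And>F. finite F \<Longrightarrow> F \<subseteq> half_integers \<Longrightarrow> (\<Sum>x\<in>F. (cmod (ell2_fun f x))\<^sup>2) \<le> C\<^sup>2"
  shows "norm f \<le> C"
proof -
  have "(\<Sum>\<^sub>\<infinity>x\<in>half_integers. (cmod (ell2_fun f x))\<^sup>2) \<le> C\<^sup>2"
    by (rule infsum_le_finite_sums[OF ell2_fun_summable]) (use assms in auto)
  then have "(norm f)\<^sup>2 \<le> C\<^sup>2" by (simp only: ell2_norm_sq)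
  then show ?thesis using assms(1) by (rule power2_le_imp_le)
qed

lemma ell2_finite_le_norm:
  fixes f :: ell2
  assumes "finite F" "F \<subseteq> half_integers"
  shows "(\<Sum>x\<in>F. (cmod (ell2_fun f x))\<^sup>2) \<le> (norm f)\<^sup>2"
  unfolding ell2_norm_sq
  by (rule finite_sum_le_infsum) (use assms ell2_fun_summable in auto)

lemma ell2_coord_le_norm: "cmod (ell2_fun f x) \<le> norm f" for f :: ell2
proof (cases "x \<in> half_integers")
  case True
  then show ?thesis
    using ell2_finite_le_norm[of "{x}" f] by (intro power2_le_imp_le[of "cmod (ell2_fun f x)" "norm f"]) (auto simp: norm_ell2_def infsum_nonneg simp del: real_sqrt_pow2)
qed (simp add: ell2_fun_off norm_ell2_def infsum_nonneg)

instance
proof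
  fix f g h :: ell2 and r s :: real and c d :: complex
  show "f + g + h = f + (g + h)" "f + g = g + f" "0 + f = f" "- f + f = 0" "f - g = f + - g"
    "r *\<^sub>R (f + g) = r *\<^sub>R f + r *\<^sub>R g" "(r + s) *\<^sub>R f = r *\<^sub>R f + s *\<^sub>R f"
    "r *\<^sub>R s *\<^sub>R f = (r * s) *\<^sub>R f" "1 *\<^sub>R f = f"
    "c *\<^sub>C (f + g) = c *\<^sub>C f + c *\<^sub>C g" "(c + d) *\<^sub>C f = c *\<^sub>C f + d *\<^sub>C f"
    "c *\<^sub>C d *\<^sub>C f = (c * d) *\<^sub>C f" "r *\<^sub>R f = complex_of_real r *\<^sub>C f"
    by (rule ell2_eqI, simp add: ell2_fun_simps algebra_simps)+
  show "dist f g = norm (f - g)" "sgn f = inverse (norm f) *\<^sub>R f"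
    by (simp_all add: dist_ell2_def sgn_ell2_def)
  show "(uniformity :: (ell2 \<times> ell2) filter) = (INF e\<in>{0<..}. principal {(x, y). dist x y < e})"
    by (rule uniformity_ell2_def)
  show "open U \<longleftrightarrow> (\<forall>x\<in>U. \<forall>\<^sub>F (x', y) in uniformity. x' = x \<longrightarrow> y \<in> U)" for U :: "ell2 set"
    by (rule open_ell2_def)
  show "norm f = 0 \<longleftrightarrow> f = 0"
  proof
    assume "norm f = 0"
    then show "f = 0"
      using ell2_coord_le_norm[of f] by (auto intro!: ell2_eqI simp: ell2_fun_simps)
  next
    assume "f = 0"
    then show "norm f = 0" by (simp add: norm_ell2_def ell2_fun_simps)
  qed
  show "norm (f + g) \<le> norm f + norm g"
    using L2_add_finite_le[of _ f g]
    by (intro ell2_norm_le) (auto simp: norm_ell2_def infsum_nonneg ell2_fun_simps)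
  have "(norm (r *\<^sub>R f))\<^sup>2 = (\<bar>r\<bar> * norm f)\<^sup>2"
    by (simp add: ell2_norm_sq power_mult_distrib ell2_fun_simps norm_mult infsum_cmult_right')
  then show "norm (r *\<^sub>R f) = \<bar>r\<bar> * norm f"
    by (rule power2_eq_imp_eq) (auto simp: norm_ell2_def infsum_nonneg)
qed

end

lemma ell2_complete:
  fixes X :: "nat \<Rightarrow> ell2"
  assumes X: "\<And>e. 0 < e \<Longrightarrow> \<exists>N. \<forall>m\<ge>N. \<forall>n\<ge>N. norm (X m - X n) < e"
  shows "\<exists>l. \<forall>e>0. \<exists>N. \<forall>n\<ge>N. norm (X n - l) \<le> e"
proof -
  have "\<exists>l. (\<lambda>n. ell2_fun (X n) x) \<longlonglongrightarrow> l" for x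
  proof -
    have "Cauchy (\<lambda>n. ell2_fun (X n) x)"
    proof (rule metric_CauchyI)
      fix e :: real assume "0 < e"
      then obtain N where "\<forall>m\<ge>N. \<forall>n\<ge>N. norm (X m - X n) < e" using X by blast
      then show "\<exists>N. \<forall>m\<ge>N. \<forall>n\<ge>N. dist (ell2_fun (X m) x) (ell2_fun (X n) x) < e"
        using ell2_coord_le_norm[of "X _ - X _" x]
        by (metis dist_norm ell2_fun_simps(6) le_less_trans)
    qed
    then show ?thesis by (simp add: Cauchy_convergent_iff convergent_def)
  qed
  then obtain l where l: "\<And>x. (\<lambda>n. ell2_fun (X n) x) \<longlonglongrightarrow> l x" by metis
  have fin: "(\<Sum>x\<in>F. (cmod (ell2_fun (X n) x - l x))\<^sup>2) \<le> e\<^sup>2"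
    if N: "\<forall>m\<ge>N. \<forall>n\<ge>N. norm (X m - X n) < e" and "n \<ge> N"
      and F: "finite F" "F \<subseteq> half_integers" for e N n F
  proof (rule LIMSEQ_le_const2)
    show "(\<lambda>m. \<Sum>x\<in>F. (cmod (ell2_fun (X n) x - ell2_fun (X m) x))\<^sup>2)
            \<longlonglongrightarrow> (\<Sum>x\<in>F. (cmod (ell2_fun (X n) x - l x))\<^sup>2)"
      by (intro tendsto_intros l)
    have "(\<Sum>x\<in>F. (cmod (ell2_fun (X n) x - ell2_fun (X m) x))\<^sup>2) \<le> e\<^sup>2" if "m \<ge> N" for m
    proof -
      have "(\<Sum>x\<in>F. (cmod (ell2_fun (X n) x - ell2_fun (X m) x))\<^sup>2) \<le> (norm (X n - X m))\<^sup>2"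
        using ell2_finite_le_norm[OF F, of "X n - X m"] by (simp add: ell2_fun_simps)
      also have "\<dots> \<le> e\<^sup>2"
        using N \<open>n \<ge> N\<close> \<open>m \<ge> N\<close>
        by (intro power_mono) (auto simp: less_imp_le norm_ell2_def infsum_nonneg)
      finally show ?thesis .
    qed
    then show "\<exists>M. \<forall>m\<ge>M. (\<Sum>x\<in>F. (cmod (ell2_fun (X n) x - ell2_fun (X m) x))\<^sup>2) \<le> e\<^sup>2"
      by blast
  qed
  obtain N1 where N1: "\<forall>m\<ge>N1. \<forall>n\<ge>N1. norm (X m - X n) < 1" using X[of 1] by auto
  have off: "l x = 0" if "x \<notin> half_integers" for x
    using LIMSEQ_unique[OF l[of x]] that by (auto simp: ell2_fun_off)
  have "(\<lambda>x. (cmod (l x - ell2_fun (X N1) x))\<^sup>2) summable_on half_integers"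
    by (rule L2_bound_summable[of _ _ "1\<^sup>2"]) (use fin[OF N1 order_refl] in \<open>auto simp: norm_minus_commute\<close>)
  then have d: "ell2_fun (Abs_ell2 (\<lambda>x. l x - ell2_fun (X N1) x)) = (\<lambda>x. l x - ell2_fun (X N1) x)"
    using off by (auto intro!: Abs_ell2_inverse simp: ell2_fun_off)
  define L where "L = X N1 + Abs_ell2 (\<lambda>x. l x - ell2_fun (X N1) x)"
  have L: "ell2_fun L x = l x" for x
    by (simp add: L_def ell2_fun_simps d)
  have "\<exists>N. \<forall>n\<ge>N. norm (X n - L) \<le> e" if "e > 0" for e
  proof -
    obtain N where N: "\<forall>m\<ge>N. \<forall>n\<ge>N. norm (X m - X n) < e" using X \<open>e > 0\<close> by blast
    have "norm (X n - L) \<le> e" if "n \<ge> N" for n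
      by (rule ell2_norm_le)
         (use \<open>e > 0\<close> fin[OF N that] in \<open>auto simp: ell2_fun_simps L\<close>)
    then show ?thesis by blast
  qed
  then show ?thesis by blast
qed

instantiation ell2 :: chilbert_space
begin

definition "cinner f g = (\<Sum>\<^sub>\<infinity>x\<in>half_integers. ell2_fun f x * cnj (ell2_fun g x))" for f g :: ell2

instance
proof
  fix f g h :: ell2 and c :: complex
  show "cinner (f + g) h = cinner f h + cinner g h"
    by (simp add: cinner_ell2_def ell2_fun_simps distrib_right infsum_add ell2_mult_summable)
  show "cinner (c *\<^sub>C f) g = c * cinner f g"
    by (simp add: cinner_ell2_def ell2_fun_simps mult.assoc infsum_cmult_right')
  show "cinner f g = cnj (cinner g f)"
    by (simp add: cinner_ell2_def mult.commute flip: infsum_cnj)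
  have "cinner f f = (\<Sum>\<^sub>\<infinity>x\<in>half_integers. complex_of_real ((cmod (ell2_fun f x))\<^sup>2))"
    unfolding cinner_ell2_def by (rule infsum_cong) (rule complex_norm_square[symmetric])
  also have "\<dots> = complex_of_real ((norm f)\<^sup>2)"
    unfolding ell2_norm_sq
    by (rule infsumI, rule has_sum_of_real_iff[THEN iffD2], rule has_sum_infsum, rule ell2_fun_summable)
  finally show "cinner f f = complex_of_real ((norm f)\<^sup>2)" .
next
  fix X :: "nat \<Rightarrow> ell2"
  assume C: "Cauchy X"
  have "\<exists>l. \<forall>e>0. \<exists>N. \<forall>n\<ge>N. norm (X n - l) \<le> e"
    by (rule ell2_complete) (use C in \<open>auto simp: Cauchy_def dist_norm\<close>)
  then obtain l where l: "\<And>e. e > 0 \<Longrightarrow> \<exists>N. \<forall>n\<ge>N. norm (X n - l) \<le> e" by blast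
  have "X \<longlonglongrightarrow> l"
    unfolding lim_sequentially
  proof (intro allI impI)
    fix e :: real assume "e > 0"
    then show "\<exists>N. \<forall>n\<ge>N. dist (X n) l < e"
      using l[of "e / 2"] by (fastforce simp: dist_norm)
  qed
  then show "convergent X" by (auto simp: convergent_def)
qed

end


section \<open>The hypergeometric difference operator\<close>

definition principal_pair :: "complex \<Rightarrow> complex \<Rightarrow> bool" where
  "principal_pair z z' \<longleftrightarrow> z \<notin> \<real> \<and> z' = cnj z"

definition complementary_pair :: "complex \<Rightarrow> complex \<Rightarrow> bool" where
  "complementary_pair z z' \<longleftrightarrow> z \<in> \<real> \<and> z' \<in> \<real> \<and>
     (\<exists>k::int. of_int k < Re z \<and> Re z < of_int k + 1 \<and> of_int k < Re z' \<and> Re z' < of_int k + 1)"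

text \<open>For principal and complementary pairs, the radicands below are positive reals, on which
  \<^const>\<open>csqrt\<close> is the usual square root.\<close>

definition hyp_diff_op_fin :: "complex \<Rightarrow> complex \<Rightarrow> real \<Rightarrow> ell2 operator" where
  "hyp_diff_op_fin z z' \<xi> =
     {(f, g). finite {x. ell2_fun f x \<noteq> 0} \<and>
        (\<forall>x\<in>half_integers. ell2_fun g x =
             csqrt (of_real \<xi> * (z + of_real x + 1/2) * (z' + of_real x + 1/2)) * ell2_fun f (x + 1)
           - (of_real x + of_real \<xi> * (z + z' + of_real x)) * ell2_fun f x
           + csqrt (of_real \<xi> * (z + of_real x - 1/2) * (z' + of_real x - 1/2)) * ell2_fun f (x - 1))}"

definition hyp_diff_op :: "complex \<Rightarrow> complex \<Rightarrow> real \<Rightarrow> ell2 operator" where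
  "hyp_diff_op z z' \<xi> = closure (hyp_diff_op_fin z z' \<xi>)"


section \<open>The operator on the GNS space\<close>

definition excitation_vectors :: "(ell2 \<Rightarrow> 'a::cstar_algebra) \<Rightarrow>
    ('a \<Rightarrow> 'k::chilbert_space \<Rightarrow> 'k) \<Rightarrow> 'k \<Rightarrow> (real \<Rightarrow> ell2) \<Rightarrow> 'k set" where
  "excitation_vectors a \<rho> \<Omega> \<psi> =
     {\<rho> (prod_list (map (\<lambda>\<alpha>. star (a (\<psi> (- \<alpha>)))) \<alpha>s) * prod_list (map (\<lambda>\<beta>. a (\<psi> \<beta>)) \<beta>s)) \<Omega>
       | \<alpha>s \<beta>s. length \<alpha>s = length \<beta>s \<and>
           sorted_wrt (>) \<alpha>s \<and> set \<alpha>s \<subseteq> {x \<in> half_integers. 1/2 \<le> x} \<and>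
           sorted_wrt (>) \<beta>s \<and> set \<beta>s \<subseteq> {x \<in> half_integers. 1/2 \<le> x}}"

text \<open>For \<open>v\<close> in the domain, only finitely many terms of the two sums are nonzero.\<close>

definition excitation_op :: "(ell2 \<Rightarrow> 'a::cstar_algebra) \<Rightarrow>
    ('a \<Rightarrow> 'k::chilbert_space \<Rightarrow> 'k) \<Rightarrow> 'k \<Rightarrow> (real \<Rightarrow> ell2) \<Rightarrow> real \<Rightarrow> 'k operator" where
  "excitation_op a \<rho> \<Omega> \<psi> \<xi> =
     {(v, w). v \<in> cspan (excitation_vectors a \<rho> \<Omega> \<psi>) \<and>
        w = (\<Sum>\<^sub>\<infinity>b\<in>{b \<in> half_integers. b \<le> - 1/2}.
               ((1 - \<xi>) * b) *\<^sub>R \<rho> (star (a (\<psi> b)) * a (\<psi> b)) v)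
          - (\<Sum>\<^sub>\<infinity>b\<in>{b \<in> half_integers. 1/2 \<le> b}.
               ((1 - \<xi>) * b) *\<^sub>R \<rho> (a (\<psi> b) * star (a (\<psi> b))) v)}"

end

theory Submission
  imports Defs
begin

text \<open>The vectors \<open>\<psi>\<close> diagonalize everything. After a particle-hole transformation the algebra is
  generated by operators \<open>c b\<close>, \<open>b\<close> a half-integer, that satisfy the canonical anticommutation
  relations and whose adjoints annihilate the vacuum. Normal ordering writes every word in the
  \<open>c b\<close> and their adjoints as a combination of words in the \<open>c b\<close> alone, of the same degree for any
  grading of the letters, up to the left ideal of elements that annihilate the vacuum. For the
  grading by energy this shows that the state is invariant under the gauge group of the difference
  operator, so that the second quantization exists; for the grading by charge, together with
  averaging over roots of unity, it shows that the excitation vectors are total in the GNS space of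
  the gauge-invariant algebra. They are common eigenvectors of the unitary group and of the operator
  in question, with the same eigenvalues, and the generator of a unitary group is the closure of its
  restriction to the span of a total set of eigenvectors.\<close>

section \<open>Complex vector spaces and inner products\<close>

text \<open>\<open>exp_group\<close>, \<open>gauge_aut\<close>, \<open>second_quant_group\<close>,
  \<open>dGamma\<close> and \<open>ortho_proj\<close> are definite descriptions, so existence and
  uniqueness have to be proved for each of them. Eigenvectors take the place of Stone's theorem: a
  unitary group is built from its phases on a total set, and any group with the same generator has
  the same phases there. The self-adjointness of the difference operator is obtained in the same
  way. It is symmetric, because its coefficients are real and symmetric, and it contains a diagonal
  operator with total eigenvectors, which is essentially self-adjoint and so has no closed symmetric
  extension beyond its closure. No Fock space is constructed. Since \<open>K\<close> projects onto
  part of the eigenbasis, the two-point values of the state on the basis are 0 or 1, and positivity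
  alone then puts the annihilators into the left kernel of the state. Homomorphisms and states are
  defined algebraically, so their continuity has to be derived; its source is a self-adjoint square
  root given by the binomial series.\<close>

interpretation complex_vector: vector_space "scaleC :: complex \<Rightarrow> 'a \<Rightarrow> 'a::complex_vector"
proof
  fix a b :: complex and x y :: 'a
  show "a *\<^sub>C (x + y) = a *\<^sub>C x + a *\<^sub>C y" by (rule scaleC_add_right)
  show "(a + b) *\<^sub>C x = a *\<^sub>C x + b *\<^sub>C x" by (rule scaleC_add_left)
  show "a *\<^sub>C b *\<^sub>C x = (a * b) *\<^sub>C x" by (rule scaleC_scaleC)
  show "1 *\<^sub>C x = x" using scaleR_scaleC[of 1 x] by simp
qed

text \<open>Operators are graphs, so linear spans of operators are formed in the product space,
  which therefore has to be a complex vector space itself.\<close>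

instantiation prod :: (complex_vector, complex_vector) complex_vector
begin
definition scaleC_prod :: "complex \<Rightarrow> 'a \<times> 'b \<Rightarrow> 'a \<times> 'b" where
  "scaleC_prod c p = (c *\<^sub>C fst p, c *\<^sub>C snd p)"
instance
  by standard (auto simp: scaleC_prod_def prod_eq_iff scaleC_add_right scaleC_add_left
      scaleC_scaleC scaleR_scaleC)
end

lemma scaleC_Pair [simp]: "c *\<^sub>C (x, y) = (c *\<^sub>C x, c *\<^sub>C y)"
  by (simp add: scaleC_prod_def)

lemma fst_scaleC [simp]: "fst (c *\<^sub>C p) = c *\<^sub>C fst p"
  and snd_scaleC [simp]: "snd (c *\<^sub>C p) = c *\<^sub>C snd p"
  by (simp_all add: scaleC_prod_def)

abbreviation csubspace :: "'a::complex_vector set \<Rightarrow> bool" where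
  "csubspace \<equiv> complex_vector.subspace"

lemma clinear_add: "clinear T \<Longrightarrow> T (x + y) = T x + T y"
  and clinear_scaleC: "clinear T \<Longrightarrow> T (c *\<^sub>C x) = c *\<^sub>C T x"
  by (simp_all add: clinear_def)

lemma clinear_zero: "clinear T \<Longrightarrow> T 0 = 0"
  using clinear_scaleC[of T 0 0] by simp

lemma clinear_uminus: "clinear T \<Longrightarrow> T (- x) = - T x"
  using clinear_scaleC[of T "-1" x] by simp

lemma clinear_diff: "clinear T \<Longrightarrow> T (x - y) = T x - T y"
  using clinear_add[of T x "- y"] clinear_uminus[of T y] by simp

lemma clinear_scaleR: "clinear T \<Longrightarrow> T (r *\<^sub>R x) = r *\<^sub>R T x"
  by (simp add: scaleR_scaleC clinear_scaleC)

lemma clinear_image_cspan: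
  assumes "clinear T" "x \<in> cspan S"
  shows "T x \<in> cspan (T ` S)"
  using assms(2)
proof (induction rule: complex_vector.span_induct_alt)
  case base
  then show ?case using clinear_zero[OF assms(1)] by (simp add: complex_vector.span_zero)
next
  case (step c x y)
  then show ?case
    using complex_vector.span_add[OF complex_vector.span_scale[OF complex_vector.span_base[OF imageI]]]
    by (simp add: clinear_add[OF assms(1)] clinear_scaleC[OF assms(1)])
qed

text \<open>The class \<open>complex_vector\<close> does not relate \<open>scaleC\<close> to a norm,
  hence the assumption. Hilbert spaces satisfy it through the inner product, C*-algebras by an
  axiom.\<close>

lemma bounded_bilinear_scaleC:
  assumes "\<And>c (x :: 'a::{real_normed_vector, complex_vector}). norm (c *\<^sub>C x) = cmod c * norm x"
  shows "bounded_bilinear (scaleC :: complex \<Rightarrow> 'a \<Rightarrow> 'a)"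
proof
  fix a b :: complex and r :: real and x y :: 'a
  show "(a + b) *\<^sub>C x = a *\<^sub>C x + b *\<^sub>C x" "a *\<^sub>C (x + y) = a *\<^sub>C x + a *\<^sub>C y"
    by (rule scaleC_add_left scaleC_add_right)+
  show "(r *\<^sub>R a) *\<^sub>C x = r *\<^sub>R a *\<^sub>C x" "a *\<^sub>C r *\<^sub>R x = r *\<^sub>R a *\<^sub>C x"
    by (simp_all add: scaleR_scaleC scaleC_scaleC scaleR_conv_of_real mult.commute)
  show "\<exists>K. \<forall>a (x::'a). norm (a *\<^sub>C x) \<le> norm a * norm x * K"
    by (intro exI[of _ 1]) (simp add: assms)
qed

lemma cinner_scaleC_right: "cinner x (c *\<^sub>C y) = cnj c * cinner x y"
  by (metis cinner_commute cinner_scaleC_left complex_cnj_mult)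

lemma cinner_add_right: "cinner x (y + w) = cinner x y + cinner x w"
  by (metis cinner_add_left cinner_commute complex_cnj_add)

lemma cinner_scaleR_left: "cinner (r *\<^sub>R x) y = of_real r * cinner x y"
  and cinner_scaleR_right: "cinner x (r *\<^sub>R y) = of_real r * cinner x y"
  by (simp_all add: scaleR_scaleC cinner_scaleC_left cinner_scaleC_right)

lemma cinner_zero [simp]: "cinner 0 x = 0" "cinner x 0 = 0"
  using cinner_scaleR_left[of 0 0 x] cinner_scaleR_right[of x 0 0] by simp_all

lemma cinner_uminus: "cinner (- x) y = - cinner x y" "cinner x (- y) = - cinner x y"
  using cinner_scaleR_left[of "-1" x y] cinner_scaleR_right[of x "-1" y] by simp_all

lemma cinner_diff: "cinner (x - y) w = cinner x w - cinner y w"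
  "cinner w (x - y) = cinner w x - cinner w y"
  using cinner_add_left[of x "-y" w] cinner_add_right[of w x "-y"] by (simp_all add: cinner_uminus)

lemma cinner_eq_zero: "cinner x x = 0 \<longleftrightarrow> x = 0"
  by (simp add: cinner_same)

lemma norm_eqI_cinner: "cinner x x = cinner y y \<Longrightarrow> norm x = norm y"
  unfolding cinner_same by (metis norm_ge_zero of_real_eq_iff power2_eq_imp_eq)

lemma norm_scaleC_hilbert: "norm (c *\<^sub>C x) = cmod c * norm x" for x :: "'a::chilbert_space"
proof -
  have "complex_of_real ((norm (c *\<^sub>C x))\<^sup>2) = cinner (c *\<^sub>C x) (c *\<^sub>C x)"
    by (rule cinner_same[symmetric])
  also have "\<dots> = (c * cnj c) * cinner x x"
    by (simp add: cinner_scaleC_left cinner_scaleC_right del: complex_mult_cnj)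
  also have "\<dots> = complex_of_real ((cmod c * norm x)\<^sup>2)"
    by (simp only: complex_norm_square[symmetric] cinner_same power_mult_distrib of_real_mult)
  finally have "complex_of_real ((norm (c *\<^sub>C x))\<^sup>2) = complex_of_real ((cmod c * norm x)\<^sup>2)" .
  then have "(norm (c *\<^sub>C x))\<^sup>2 = (cmod c * norm x)\<^sup>2" using of_real_eq_iff by blast
  then show ?thesis by (rule power2_eq_imp_eq) auto
qed

lemma cinner_Cauchy_Schwarz: "cmod (cinner x y) \<le> norm x * norm y"
proof (cases "y = 0")
  case False
  define c where "c = cinner x y"
  define n where "n = (norm y)\<^sup>2"
  have n: "n > 0" using False by (simp add: n_def)
  have xy: "cinner x y = c" "cinner y x = cnj c" "cinner y y = of_real n"
    using cinner_commute[of y x] by (simp_all add: c_def n_def cinner_same)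
  \<comment> \<open>The vector is \<open>n\<close> times the component of \<open>x\<close>
    orthogonal to \<open>y\<close>; multiplying by \<open>n\<close> instead of dividing keeps the
    expansion polynomial.\<close>
  have "cinner (of_real n *\<^sub>C x - c *\<^sub>C y) (of_real n *\<^sub>C x - c *\<^sub>C y)
      = of_real n * (of_real n * cinner x x - c * cnj c)"
    by (simp add: cinner_diff cinner_scaleC_left cinner_scaleC_right xy algebra_simps
        del: complex_mult_cnj)
  also have "\<dots> = of_real (n * (n * (norm x)\<^sup>2 - (cmod c)\<^sup>2))"
    by (simp only: cinner_same complex_norm_square[of c, symmetric] of_real_mult of_real_diff)
  finally have "n * (n * (norm x)\<^sup>2 - (cmod c)\<^sup>2)
      = (norm (of_real n *\<^sub>C x - c *\<^sub>C y))\<^sup>2"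
    unfolding cinner_same using of_real_eq_iff by metis
  then have "0 \<le> n * (n * (norm x)\<^sup>2 - (cmod c)\<^sup>2)" by simp
  then have "(cmod c)\<^sup>2 \<le> (norm x * norm y)\<^sup>2"
    using n by (simp add: zero_le_mult_iff n_def power_mult_distrib mult.commute)
  then show ?thesis unfolding c_def by (rule power2_le_imp_le) auto
qed simp

lemma bounded_bilinear_cinner: "bounded_bilinear (cinner :: 'a \<Rightarrow> 'a::chilbert_space \<Rightarrow> complex)"
proof
  show "\<exists>K. \<forall>x (y::'a). norm (cinner x y) \<le> norm x * norm y * K"
    by (intro exI[of _ 1]) (simp add: cinner_Cauchy_Schwarz)
qed (simp_all add: cinner_add_left cinner_add_right cinner_scaleR_left cinner_scaleR_right
    scaleR_conv_of_real)

lemmas tendsto_cinner = bounded_bilinear.tendsto[OF bounded_bilinear_cinner]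
lemmas bounded_bilinear_scaleC_hilbert = bounded_bilinear_scaleC[OF norm_scaleC_hilbert]
lemmas bounded_bilinear_scaleC_cstar =
  bounded_bilinear_scaleC[where 'a = "'a::cstar_algebra", OF norm_scaleC]

lemma csubspace_closure:
  fixes S :: "'a::{real_normed_vector, complex_vector} set"
  assumes S: "csubspace S" and c: "\<And>c (x::'a). continuous_on UNIV (\<lambda>x::'a. c *\<^sub>C x)"
  shows "csubspace (closure S)"
proof (rule complex_vector.subspaceI)
  show "0 \<in> closure S" using complex_vector.subspace_0[OF S] closure_subset by blast
next
  fix x y assume "x \<in> closure S" "y \<in> closure S"
  then obtain f g where "\<And>n. f n \<in> S" "f \<longlonglongrightarrow> x" "\<And>n. g n \<in> S" "g \<longlonglongrightarrow> y"
    by (auto simp: closure_sequential)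
  then show "x + y \<in> closure S"
    unfolding closure_sequential
    by (intro exI[of _ "\<lambda>n. f n + g n"])
       (auto intro: tendsto_add complex_vector.subspace_add[OF S])
next
  fix a :: complex and x assume "x \<in> closure S"
  then show "a *\<^sub>C x \<in> closure S"
    using image_closure_subset[of S "\<lambda>x. a *\<^sub>C x" "closure S"] c[of a]
      complex_vector.subspace_scale[OF S] closure_subset[of S]
    by (auto intro: continuous_on_subset)
qed

lemma csubspace_closure_hilbert:
  fixes S :: "'a::chilbert_space set"
  assumes "csubspace S" shows "csubspace (closure S)"
  by (rule csubspace_closure[OF assms])
     (auto intro!: bounded_bilinear.continuous_on[OF bounded_bilinear_scaleC_hilbert] continuous_intros)

lemma csubspace_closure_prod:
  fixes S :: "('a::chilbert_space \<times> 'a) set"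
  assumes "csubspace S" shows "csubspace (closure S)"
  by (rule csubspace_closure[OF assms])
     (auto intro!: bounded_bilinear.continuous_on[OF bounded_bilinear_scaleC_hilbert] continuous_intros
       simp: scaleC_prod_def)

lemma dense_mono: "closure S = UNIV \<Longrightarrow> S \<subseteq> T \<Longrightarrow> closure T = UNIV"
  using closure_mono[of S T] by auto

lemma orthogonal_dense_zero:
  assumes "closure S = UNIV" "\<And>y. y \<in> S \<Longrightarrow> cinner y d = 0"
  shows "d = 0"
proof -
  obtain f where f: "\<And>n. f n \<in> S" "f \<longlonglongrightarrow> d"
    using assms(1) closure_sequential[of d S] by auto
  have "(\<lambda>n. cinner (f n) d) \<longlonglongrightarrow> cinner d d" by (intro tendsto_cinner f tendsto_const)
  then have "(\<lambda>n. 0) \<longlonglongrightarrow> cinner d d" using f(1) assms(2) by simp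
  then show ?thesis using LIMSEQ_unique[OF tendsto_const] by (metis cinner_eq_zero)
qed

lemma orthogonal_cspan:
  assumes "\<And>s. s \<in> S \<Longrightarrow> cinner s d = 0" "y \<in> cspan S"
  shows "cinner y d = 0"
  using assms(2)
  by (induction rule: complex_vector.span_induct_alt)
     (auto simp: cinner_add_left cinner_scaleC_left assms(1))

section \<open>Isometries determined on total sets\<close>

lemma clinear_isometry_bounded:
  fixes T :: "'a::chilbert_space \<Rightarrow> 'b::chilbert_space"
  assumes "clinear T" "\<And>x. norm (T x) = norm x"
  shows "bounded_linear T"
  by (rule bounded_linear_intro[where K = 1])
     (simp_all add: clinear_add[OF assms(1)] clinear_scaleR[OF assms(1)] assms(2))

lemma unitary_op_norm: "unitary_op U \<Longrightarrow> norm (U x) = norm x"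
  by (rule norm_eqI_cinner) (simp add: unitary_op_def)

lemma unitary_op_clinear: "unitary_op U \<Longrightarrow> clinear U"
  and unitary_op_cinner: "unitary_op U \<Longrightarrow> cinner (U x) (U y) = cinner x y"
  by (simp_all add: unitary_op_def)

lemma unitary_op_bounded_linear: "unitary_op U \<Longrightarrow> bounded_linear U"
  by (rule clinear_isometry_bounded) (auto simp: unitary_op_clinear unitary_op_norm)

lemma unitary_op_id: "unitary_op id"
  by (simp add: unitary_op_def clinear_def)

lemma unitary_op_comp:
  assumes "unitary_op U" "unitary_op V" shows "unitary_op (U \<circ> V)"
  using assms comp_surj[of V U] by (simp add: unitary_op_def clinear_def)

lemma bounded_linear_eq_on_total:
  fixes S T :: "'a::chilbert_space \<Rightarrow> 'b::chilbert_space"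
  assumes S: "bounded_linear S" "clinear S" and T: "bounded_linear T" "clinear T"
    and dense: "closure (cspan E) = UNIV" and eq: "\<And>e. e \<in> E \<Longrightarrow> S e = T e"
  shows "S = T"
proof -
  have span: "S x = T x" if "x \<in> cspan E" for x
    using that
    by (induction rule: complex_vector.span_induct_alt)
       (simp_all add: clinear_zero clinear_add clinear_scaleC S T eq)
  have "closed {x. S x = T x}"
    by (intro closed_Collect_eq) (use S T in \<open>auto intro: linear_continuous_on\<close>)
  then have "closure (cspan E) \<subseteq> {x. S x = T x}"
    using span by (intro closure_minimal) auto
  then show ?thesis using dense by auto
qed

lemmas unitary_op_eq_on_total =
  bounded_linear_eq_on_total[OF unitary_op_bounded_linear unitary_op_clinear
    unitary_op_bounded_linear unitary_op_clinear]

lemma fst_image_cspan: "fst ` cspan G = cspan (fst ` G)"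
  and snd_image_cspan: "snd ` cspan G = cspan (snd ` G)"
  by (rule module_hom.span_image[symmetric], unfold_locales, simp_all)+

text \<open>Approximating \<open>h\<close> by first components makes the second components Cauchy by
  isometry. The form as a relation allows the use for the converse relation as well, where it gives
  surjectivity.\<close>

lemma dense_isometric_relation_total:
  fixes R :: "('a::chilbert_space \<times> 'a) set"
  assumes R: "csubspace R" and iso: "\<And>u v. (u, v) \<in> R \<Longrightarrow> norm u = norm v"
    and dense: "closure (fst ` R) = UNIV"
  shows "\<exists>v. (h, v) \<in> closure R"
proof -
  have "\<forall>n. \<exists>p\<in>R. dist (fst p) h < inverse (real (Suc n))"
  proof
    fix n
    have "h \<in> closure (fst ` R)" using dense by simp
    then show "\<exists>p\<in>R. dist (fst p) h < inverse (real (Suc n))"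
      unfolding closure_approachable by (metis imageE inverse_positive_iff_positive of_nat_0_less_iff zero_less_Suc)
  qed
  then obtain p where p: "\<And>n. p n \<in> R" "\<And>n. dist (fst (p n)) h < inverse (real (Suc n))" by metis
  have lim: "(\<lambda>n. fst (p n)) \<longlonglongrightarrow> h"
  proof (rule tendsto_dist_iff[THEN iffD2], rule tendsto_sandwich[OF _ _ tendsto_const LIMSEQ_inverse_real_of_nat])
    show "\<forall>\<^sub>F n in sequentially. dist (fst (p n)) h \<le> inverse (real (Suc n))"
      using p(2) by (intro always_eventually allI less_imp_le)
  qed simp
  have "dist (snd (p m)) (snd (p n)) = dist (fst (p m)) (fst (p n))" for m n
    using complex_vector.subspace_diff[OF R p(1)[of m] p(1)[of n]]
      iso[of "fst (p m) - fst (p n)" "snd (p m) - snd (p n)"]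
    by (simp add: dist_norm minus_prod_def)
  then have "Cauchy (\<lambda>n. snd (p n))"
    using LIMSEQ_imp_Cauchy[OF lim] by (simp add: Cauchy_def)
  then obtain v where "(\<lambda>n. snd (p n)) \<longlonglongrightarrow> v" by (auto simp: Cauchy_convergent_iff convergent_def)
  then have "(\<lambda>n. (fst (p n), snd (p n))) \<longlonglongrightarrow> (h, v)" using lim by (intro tendsto_Pair)
  then show ?thesis using p(1) by (auto simp: closure_sequential)
qed

text \<open>The graph of the unitary is the closure of the span of \<open>G\<close>. Equal Gram
  matrices make it isometric, hence single-valued; density of the two projections makes it
  everywhere defined and onto.\<close>

lemma exists_unitary_extension:
  fixes G :: "('a::chilbert_space \<times> 'a) set"
  assumes gram: "\<And>u v u' v'. (u, v) \<in> G \<Longrightarrow> (u', v') \<in> G \<Longrightarrow> cinner u u' = cinner v v'"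
    and dom: "closure (cspan (fst ` G)) = UNIV" and ran: "closure (cspan (snd ` G)) = UNIV"
  shows "\<exists>T. unitary_op T \<and> (\<forall>(u, v)\<in>G. T u = v)"
proof -
  define R where "R = cspan G"
  have R: "csubspace R" by (simp add: R_def)
  have cR: "csubspace (closure R)" by (rule csubspace_closure_prod[OF R])
  have gram1: "cinner (fst p) (fst q) = cinner (snd p) (snd q)" if "p \<in> G" "q \<in> R" for p q
    using that(2) unfolding R_def
    by (induction rule: complex_vector.span_induct_alt)
       (use that(1) gram in \<open>auto simp: cinner_add_right cinner_scaleC_right\<close>)
  have gram2: "cinner (fst p) (fst q) = cinner (snd p) (snd q)" if "p \<in> R" "q \<in> R" for p q
    using that(1) unfolding R_def
    by (induction rule: complex_vector.span_induct_alt)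
       (use that(2) gram1 in \<open>auto simp: cinner_add_left cinner_scaleC_left\<close>)
  have gram3: "cinner (fst p) (fst q) = cinner (snd p) (snd q)"
    if pq: "p \<in> closure R" "q \<in> closure R" for p q
  proof -
    obtain f g where fg: "\<And>n. f n \<in> R" "f \<longlonglongrightarrow> p" "\<And>n. g n \<in> R" "g \<longlonglongrightarrow> q"
      using pq unfolding closure_sequential by blast
    have "(\<lambda>n. cinner (fst (f n)) (fst (g n))) \<longlonglongrightarrow> cinner (fst p) (fst q)"
      "(\<lambda>n. cinner (snd (f n)) (snd (g n))) \<longlonglongrightarrow> cinner (snd p) (snd q)"
      by (intro tendsto_cinner tendsto_fst tendsto_snd fg)+
    then show ?thesis using gram2[OF fg(1) fg(3)] LIMSEQ_unique by simp
  qed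
  have iso: "norm u = norm v" if "(u, v) \<in> closure R" for u v
    using gram3[OF that that] by (intro norm_eqI_cinner) simp
  have tot: "\<exists>v. (h, v) \<in> closure R" for h
    by (rule dense_isometric_relation_total[OF R])
       (use iso closure_subset dom in \<open>auto simp: R_def fst_image_cspan\<close>)
  have unique: "v = v'" if "(h, v) \<in> closure R" "(h, v') \<in> closure R" for h v v'
    using iso[of "h - h" "v - v'"] complex_vector.subspace_diff[OF cR that] by simp
  obtain T where T: "\<And>h. (h, T h) \<in> closure R" using tot by metis
  have eqT: "T h = v" if "(h, v) \<in> closure R" for h v using unique[OF T that] .
  have "clinear T"
    unfolding clinear_def
    using complex_vector.subspace_add[OF cR T T] complex_vector.subspace_scale[OF cR T]
    by (auto intro!: eqT)
  moreover have "surj T"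
  proof (rule surjI)
    fix w
    \<comment> \<open>The converse relation is isometric with dense domain too, so every
      \<open>w\<close> has a preimage.\<close>
    let ?R' = "prod.swap ` R"
    have R': "csubspace ?R'"
      unfolding R_def by (subst module_hom.span_image[symmetric, of _ _ prod.swap])
        (unfold_locales, auto simp: prod_eq_iff)
    have "\<exists>v. (w, v) \<in> closure ?R'"
    proof (rule dense_isometric_relation_total[OF R'])
      show "norm u = norm v" if "(u, v) \<in> ?R'" for u v
        using that iso closure_subset[of R] by (auto simp: prod.swap_def)
      have "fst ` ?R' = snd ` R" by (auto simp: image_image)
      then show "closure (fst ` ?R') = UNIV" using ran by (simp add: R_def snd_image_cspan)
    qed
    then obtain v where "(w, v) \<in> closure ?R'" by blast
    then have "(v, w) \<in> prod.swap ` closure ?R'" by force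
    also have "prod.swap ` closure ?R' \<subseteq> closure R"
      by (rule image_closure_subset)
         (auto intro!: continuous_intros simp: prod.swap_def intro: closure_subset[THEN subsetD])
    finally have "T v = w" by (rule eqT)
    then show "T (SOME v. T v = w) = w" by (rule someI)
  qed
  moreover have "cinner (T x) (T y) = cinner x y" for x y using gram3[OF T T] by simp
  moreover have "\<forall>(u, v)\<in>G. T u = v"
    using complex_vector.span_superset[of G] closure_subset[of R] by (auto simp: R_def intro!: eqT)
  ultimately show ?thesis unfolding unitary_op_def by blast
qed

section \<open>Generators of unitary groups\<close>

lemma unitary_groupD:
  assumes "unitary_group U"
  shows "unitary_op (U t)" "U 0 = id" "U (s + t) h = U s (U t h)" "continuous_on UNIV (\<lambda>t. U t h)"
  using assms by (auto simp: unitary_group_def)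

text \<open>Multiplication by \<open>\<i> * t\<close>, of modulus |t|, turns the difference quotient
  into the remainder of a vector derivative, which opens generators to differential
  calculus.\<close>

lemma group_generator_iff_derivative:
  assumes "U 0 = id"
  shows "(h, g) \<in> group_generator U \<longleftrightarrow> ((\<lambda>t. U t h) has_vector_derivative \<i> *\<^sub>C g) (at 0)"
proof -
  have eq: "norm ((1 / (\<i> * of_real t)) *\<^sub>C (U t h - h) - g)
      = norm (U (0 + t) h - U 0 h - t *\<^sub>R \<i> *\<^sub>C g) / norm t" if "t \<noteq> 0" for t
  proof -
    have "(1 / (\<i> * of_real t)) *\<^sub>C (U t h - h) - g
        = (1 / (\<i> * of_real t)) *\<^sub>C (U t h - h - (\<i> * of_real t) *\<^sub>C g)"
      using that by (simp add: complex_vector.scale_right_diff_distrib)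
    then show ?thesis using assms
      by (simp add: norm_scaleC_hilbert norm_divide norm_mult scaleR_scaleC mult.commute)
  qed
  have "(h, g) \<in> group_generator U \<longleftrightarrow>
      ((\<lambda>t. norm ((1 / (\<i> * of_real t)) *\<^sub>C (U t h - h) - g)) \<longlongrightarrow> 0) (at 0)"
    by (simp add: group_generator_def tendsto_norm_zero_iff LIM_zero_iff)
  also have "\<dots> \<longleftrightarrow> ((\<lambda>t. norm (U (0 + t) h - U 0 h - t *\<^sub>R \<i> *\<^sub>C g) / norm t) \<longlongrightarrow> 0) (at 0)"
    by (rule tendsto_cong) (auto simp: eventually_at_filter eq)
  finally show ?thesis
    by (simp add: has_vector_derivative_def has_derivative_at bounded_linear_scaleR_left)
qed

lemma csubspace_group_generator:
  assumes U: "unitary_group U"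
  shows "csubspace (group_generator U)"
proof -
  note cl = unitary_op_clinear[OF unitary_groupD(1)[OF U]]
  note iff = group_generator_iff_derivative[of U, OF unitary_groupD(2)[OF U]]
  show ?thesis
  proof (rule complex_vector.subspaceI)
    show "0 \<in> group_generator U"
      unfolding zero_prod_def iff by (simp add: clinear_zero[OF cl])
  next
    fix p q assume "p \<in> group_generator U" "q \<in> group_generator U"
    then show "p + q \<in> group_generator U"
      by (cases p; cases q)
         (auto simp: iff clinear_add[OF cl] scaleC_add_right intro: has_vector_derivative_add)
  next
    fix c p assume p: "p \<in> group_generator U"
    have "bounded_linear (\<lambda>x. c *\<^sub>C x :: 'a)"
      by (rule bounded_bilinear.bounded_linear_right[OF bounded_bilinear_scaleC_hilbert])
    from bounded_linear.has_vector_derivative[OF this] p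
    show "c *\<^sub>C p \<in> group_generator U"
      by (cases p) (force simp: iff clinear_scaleC[OF cl] scaleC_scaleC mult.commute)
  qed
qed

text \<open>The derivative at 0 is transported to \<open>t\<close> by
  \<open>U s h = U t (U (s - t) h)\<close>.\<close>

lemma unitary_group_has_derivative:
  assumes U: "unitary_group U" and "(h, g) \<in> group_generator U"
  shows "((\<lambda>s. U s h) has_vector_derivative \<i> *\<^sub>C U t g) (at t within S)"
proof -
  have shift: "((\<lambda>s. s - t) has_vector_derivative 1) (at t)"
    by (rule has_vector_derivative_diff_const[THEN iffD2]) simp
  have "((\<lambda>s. U s h) has_vector_derivative \<i> *\<^sub>C g) (at (t - t))"
    using group_generator_iff_derivative[of U h g] unitary_groupD(2)[OF U] assms(2) by simp
  then have "((\<lambda>s. U (s - t) h) has_vector_derivative \<i> *\<^sub>C g) (at t)"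
    using vector_diff_chain_at[OF shift, of "\<lambda>s. U s h" "\<i> *\<^sub>C g"] by (simp add: o_def)
  then have "((\<lambda>s. U t (U (s - t) h)) has_vector_derivative U t (\<i> *\<^sub>C g)) (at t)"
    by (rule bounded_linear.has_vector_derivative[OF unitary_op_bounded_linear[OF unitary_groupD(1)[OF U]]])
  moreover have "U t (U (s - t) h) = U s h" for s
    using unitary_groupD(3)[OF U, of t "s - t" h] by simp
  moreover have "U t (\<i> *\<^sub>C g) = \<i> *\<^sub>C U t g"
    by (rule clinear_scaleC[OF unitary_op_clinear[OF unitary_groupD(1)[OF U]]])
  ultimately show ?thesis by (auto intro: has_vector_derivative_at_within)
qed

lemma has_vector_derivative_cis:
  "((\<lambda>t. cis (t * m)) has_vector_derivative \<i> * of_real m * cis (t * m)) (at t within S)"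
  unfolding has_vector_derivative_def
  by (auto intro!: derivative_eq_intros simp: fun_eq_iff scaleR_conv_of_real)

text \<open>Multiplied by the opposite phase, \<open>U t e\<close> has derivative zero. This is what
  identifies an unknown unitary group from its generator.\<close>

lemma unitary_group_eigenvector:
  assumes U: "unitary_group U" and gen: "(e, m *\<^sub>R e) \<in> group_generator U"
  shows "U t e = cis (t * m) *\<^sub>C e"
proof -
  have cl: "clinear (U t)" for t by (rule unitary_op_clinear[OF unitary_groupD(1)[OF U]])
  have "((\<lambda>t. cis (t * (- m)) *\<^sub>C U t e) has_vector_derivative 0) (at t within UNIV)" for t
  proof -
    have "((\<lambda>t. cis (t * (- m)) *\<^sub>C U t e) has_vector_derivative
        cis (t * (- m)) *\<^sub>C \<i> *\<^sub>C U t (m *\<^sub>R e) + (\<i> * of_real (- m) * cis (t * (- m))) *\<^sub>C U t e)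
        (at t within UNIV)"
      by (rule bounded_bilinear.has_vector_derivative[OF bounded_bilinear_scaleC_hilbert
            has_vector_derivative_cis unitary_group_has_derivative[OF U gen]])
    moreover have "U t (m *\<^sub>R e) = of_real m *\<^sub>C U t e"
      by (simp only: clinear_scaleC[OF cl] scaleR_scaleC)
    then have "cis (t * (- m)) *\<^sub>C \<i> *\<^sub>C U t (m *\<^sub>R e)
        + (\<i> * of_real (- m) * cis (t * (- m))) *\<^sub>C U t e = 0"
      by (simp add: scaleC_scaleC algebra_simps flip: scaleC_add_left)
    ultimately show ?thesis by simp
  qed
  then obtain c where c: "\<And>t. cis (t * (- m)) *\<^sub>C U t e = c"
    using has_derivative_zero_constant[of UNIV "\<lambda>t. cis (t * (- m)) *\<^sub>C U t e"]
    by (auto simp: has_vector_derivative_def)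
  have "c = e" using c[of 0] unitary_groupD(2)[OF U] by simp
  then have "cis (t * m) *\<^sub>C cis (t * (- m)) *\<^sub>C U t e = cis (t * m) *\<^sub>C e" using c by simp
  then show ?thesis by (simp add: scaleC_scaleC cis_mult)
qed

text \<open>The adjoint of \<open>U t\<close> is \<open>U (- t)\<close>, which moves the difference
  quotient at \<open>t\<close> in one argument to the difference quotient at \<open>- t\<close> in
  the other.\<close>

lemma group_generator_symmetric:
  assumes U: "unitary_group U" and "(x, y) \<in> group_generator U" "(x', y') \<in> group_generator U"
  shows "cinner y x' = cinner x y'"
proof -
  define f where "f = (\<lambda>x t. (1 / (\<i> * of_real t)) *\<^sub>C (U t x - x))"
  have f: "(f x \<longlongrightarrow> y) (at 0)" "(f x' \<longlongrightarrow> y') (at 0)"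
    using assms(2,3) by (simp_all add: group_generator_def f_def)
  have adj: "cinner (U t u) w = cinner u (U (- t) w)" for t u w
    using unitary_op_cinner[OF unitary_groupD(1)[OF U], of t u "U (- t) w"]
      unitary_groupD(3)[OF U, of t "- t" w] unitary_groupD(2)[OF U] by simp
  have "cinner (f x t) x' = cinner x (f x' (- t))" for t
    unfolding f_def
    by (simp add: cinner_scaleC_left cinner_scaleC_right cinner_diff cinner_uminus adj)
  moreover have "((\<lambda>t. f x' (- t)) \<longlongrightarrow> y') (at 0)"
    using f(2) filtermap_at_minus[of "0::real"]
    by (simp add: filterlim_def filtermap_filtermap[symmetric, of _ uminus])
  ultimately have "((\<lambda>t. cinner (f x t) x') \<longlongrightarrow> cinner x y') (at 0)"
    by (simp add: tendsto_cinner)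
  moreover have "((\<lambda>t. cinner (f x t) x') \<longlongrightarrow> cinner y x') (at 0)"
    by (intro tendsto_cinner f tendsto_const)
  ultimately show ?thesis by (intro tendsto_unique[OF trivial_limit_at])
qed

text \<open>In place of an integral formula for \<open>U t h - h\<close>, the mean value inequality
  bounds the remainder by |t| times the oscillation of the derivative, and this bound survives the
  limit along the sequence.\<close>

lemma closed_group_generator:
  assumes U: "unitary_group U"
  shows "closed (group_generator U)"
proof (unfold closed_sequential_limits, intro allI impI)
  fix p :: "nat \<Rightarrow> 'a \<times> 'a" and hg
  assume *: "(\<forall>n. p n \<in> group_generator U) \<and> p \<longlonglongrightarrow> hg"
  obtain h g where hg: "hg = (h, g)" by (cases hg)
  have p: "(fst (p n), snd (p n)) \<in> group_generator U" for n using * by simp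
  have lim: "(\<lambda>n. fst (p n)) \<longlonglongrightarrow> h" "(\<lambda>n. snd (p n)) \<longlonglongrightarrow> g"
    using tendsto_fst[of p hg] tendsto_snd[of p hg] * by (simp_all add: hg)
  note un = unitary_groupD(1)[OF U]
  have "\<exists>d>0. \<forall>t. norm (t - 0) < d \<longrightarrow>
      norm (U t h - U 0 h - (t - 0) *\<^sub>R \<i> *\<^sub>C g) \<le> e * norm (t - 0)" if "e > 0" for e :: real
  proof -
    \<comment> \<open>\<open>d\<close> depends on the limit \<open>g\<close> alone, so one
      neighbourhood of 0 serves all members of the sequence.\<close>
    obtain d where d: "d > 0" "\<And>s. \<bar>s\<bar> < d \<Longrightarrow> norm (U s g - g) \<le> e"
      using unitary_groupD(4)[OF U, of g] unitary_groupD(2)[OF U] \<open>e > 0\<close>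
      unfolding continuous_on_iff dist_norm by simp (metis diff_zero id_apply less_imp_le)
    have "norm (U t h - U 0 h - t *\<^sub>R \<i> *\<^sub>C g) \<le> \<bar>t\<bar> * e" if t: "\<bar>t\<bar> < d" for t
    proof (rule LIMSEQ_le)
      have "bounded_linear (\<lambda>x. \<i> *\<^sub>C x :: 'a)"
        by (rule bounded_bilinear.bounded_linear_right[OF bounded_bilinear_scaleC_hilbert])
      note this[THEN bounded_linear.tendsto, OF lim(2)]
      then show "(\<lambda>n. norm (U t (fst (p n)) - U 0 (fst (p n)) - t *\<^sub>R \<i> *\<^sub>C snd (p n)))
          \<longlonglongrightarrow> norm (U t h - U 0 h - t *\<^sub>R \<i> *\<^sub>C g)"
        by (intro tendsto_norm tendsto_diff tendsto_scaleR tendsto_const lim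
            bounded_linear.tendsto[OF unitary_op_bounded_linear[OF un]])
      show "(\<lambda>n. \<bar>t\<bar> * (e + 2 * norm (snd (p n) - g))) \<longlonglongrightarrow> \<bar>t\<bar> * e"
        using tendsto_mult_left[OF tendsto_add[OF tendsto_const[of e]
            tendsto_mult_left[OF tendsto_norm_zero[OF LIM_zero[OF lim(2)]], of 2]], of "\<bar>t\<bar>"]
        by simp
      have "norm (U t (fst (p n)) - U 0 (fst (p n)) - t *\<^sub>R \<i> *\<^sub>C snd (p n))
          \<le> \<bar>t\<bar> * (e + 2 * norm (snd (p n) - g))" for n
      proof -
        \<comment> \<open>Inserting \<open>g\<close> splits the oscillation into two terms of size
          \<open>norm (snd (p n) - g)\<close> and one of size at most \<open>e\<close>.\<close>
        have B: "norm (\<i> *\<^sub>C U s (snd (p n)) - \<i> *\<^sub>C U 0 (snd (p n))) \<le> e + 2 * norm (snd (p n) - g)"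
          if "s \<in> {-d<..<d}" for s
        proof -
          have "norm (\<i> *\<^sub>C U s (snd (p n)) - \<i> *\<^sub>C U 0 (snd (p n)))
              = norm (U s (snd (p n) - g) + (U s g - g) - (snd (p n) - g))"
            using unitary_groupD(2)[OF U]
            by (simp add: clinear_diff[OF unitary_op_clinear[OF un]] norm_scaleC_hilbert
                flip: complex_vector.scale_right_diff_distrib)
          also have "\<dots> \<le> norm (U s (snd (p n) - g)) + norm (U s g - g) + norm (snd (p n) - g)"
            by (rule order_trans[OF norm_triangle_ineq4 add_right_mono[OF norm_triangle_ineq]])
          also have "\<dots> \<le> norm (snd (p n) - g) + e + norm (snd (p n) - g)"
            using d(2)[of s] that unitary_op_norm[OF un, of s "snd (p n) - g"] by auto
          finally show ?thesis by simp
        qed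
        have "norm (U t (fst (p n)) - U 0 (fst (p n)) - (t - 0) *\<^sub>R \<i> *\<^sub>C U 0 (snd (p n)))
            \<le> norm (t - 0) * (e + 2 * norm (snd (p n) - g))"
          by (rule vector_differentiable_bound_linearization[where S = "{-d<..<d}",
                OF unitary_group_has_derivative[OF U p] _ B])
             (use t d in \<open>auto simp: closed_segment_eq_real_ivl split: if_splits\<close>)
        then show ?thesis using unitary_groupD(2)[OF U] by simp
      qed
      then show "\<exists>N. \<forall>n\<ge>N. norm (U t (fst (p n)) - U 0 (fst (p n)) - t *\<^sub>R \<i> *\<^sub>C snd (p n))
          \<le> \<bar>t\<bar> * (e + 2 * norm (snd (p n) - g))" by blast
    qed
    then show ?thesis using d(1) by (auto simp: mult.commute)
  qed
  then show "hg \<in> group_generator U"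
    unfolding hg group_generator_iff_derivative[of U, OF unitary_groupD(2)[OF U]]
      has_vector_derivative_def has_derivative_at_alt
    by (auto simp: bounded_linear_scaleR_left)
qed

section \<open>Unitary groups with a total set of eigenvectors\<close>

text \<open>Pairs of vector and eigenvalue instead of an indexed family, so that one theory covers
  the basis of \<open>ell2\<close> and the excitation vectors of the GNS space.\<close>

definition eigen_op :: "('a::chilbert_space \<times> real) set \<Rightarrow> 'a operator" where
  "eigen_op T = cspan ((\<lambda>(e, m). (e, m *\<^sub>R e)) ` T)"

lemma csubspace_eigen_op: "csubspace (eigen_op T)"
  by (simp add: eigen_op_def)

lemma eigen_op_base: "(e, m) \<in> T \<Longrightarrow> (e, m *\<^sub>R e) \<in> eigen_op T"
  unfolding eigen_op_def by (intro complex_vector.span_base) force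

lemma Domain_eigen_op: "Domain (eigen_op T) = cspan (fst ` T)"
  by (simp add: eigen_op_def Domain_fst fst_image_cspan image_image case_prod_beta)

text \<open>Group law and strong continuity follow by comparing phases on the total set. This suits
  the constructions, which extend from the total set for each \<open>t\<close> separately.\<close>

locale eigen_group =
  fixes U :: "real \<Rightarrow> 'a::chilbert_space \<Rightarrow> 'a" and T :: "('a \<times> real) set"
  assumes unitary: "unitary_op (U t)"
    and eigenvector: "(e, m) \<in> T \<Longrightarrow> U t e = cis (t * m) *\<^sub>C e"
    and total: "closure (cspan (fst ` T)) = UNIV"
begin

lemma unitary_group: "unitary_group U"
proof -
  have U0: "U 0 = id"
    by (rule unitary_op_eq_on_total[OF unitary unitary unitary_op_id unitary_op_id total])
       (auto simp: eigenvector)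
  have comp: "unitary_op (U s \<circ> U t)" for s t by (rule unitary_op_comp[OF unitary unitary])
  have "U (s + t) = U s \<circ> U t" for s t
    by (rule unitary_op_eq_on_total[OF unitary unitary comp comp total])
       (auto simp: eigenvector clinear_scaleC[OF unitary_op_clinear[OF unitary]] scaleC_scaleC
         cis_mult algebra_simps)
  moreover have "continuous_on UNIV (\<lambda>t. U t h)" for h
  proof -
    have span: "continuous_on UNIV (\<lambda>t. U t x)" if "x \<in> cspan (fst ` T)" for x
      using that
    proof (induction rule: complex_vector.span_induct_alt)
      case base
      then show ?case by (simp add: clinear_zero[OF unitary_op_clinear[OF unitary]])
    next
      case (step c x y)
      obtain m where "(x, m) \<in> T" using step.hyps by auto
      then have "continuous_on UNIV (\<lambda>t. (c * cis (t * m)) *\<^sub>C x + U t y)"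
        by (intro continuous_intros step.IH
            bounded_bilinear.continuous_on[OF bounded_bilinear_scaleC_hilbert])
      then show ?case using \<open>(x, m) \<in> T\<close>
        by (simp add: clinear_add[OF unitary_op_clinear[OF unitary]] scaleC_scaleC eigenvector
            clinear_scaleC[OF unitary_op_clinear[OF unitary]])
    qed
    have "h \<in> closure (cspan (fst ` T))" using total by simp
    then obtain f where f: "\<And>n. f n \<in> cspan (fst ` T)" "f \<longlonglongrightarrow> h"
      unfolding closure_sequential by blast
    have dist: "dist (U t (f n)) (U t h) = dist (f n) h" for t n
      by (simp add: dist_norm unitary_op_norm[OF unitary]
          flip: clinear_diff[OF unitary_op_clinear[OF unitary]])
    \<comment> \<open>By unitarity the approximation error does not depend on \<open>t\<close>, so
      continuity passes to the limit.\<close>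
    have "uniform_limit UNIV (\<lambda>n t. U t (f n)) (\<lambda>t. U t h) sequentially"
      using f(2) unfolding uniform_limit_iff tendsto_iff dist by simp
    then show ?thesis
      by (rule uniform_limit_theorem[rotated]) (auto simp: span f(1))
  qed
  ultimately show ?thesis using U0 unitary by (auto simp: unitary_group_def)
qed

lemma eigen_op_subset_generator: "eigen_op T \<subseteq> group_generator U"
  unfolding eigen_op_def
proof (rule complex_vector.span_minimal[OF _ csubspace_group_generator[OF unitary_group]], clarify)
  fix e m assume e: "(e, m) \<in> T"
  have "((\<lambda>t. cis (t * m) *\<^sub>C e) has_vector_derivative (\<i> * of_real m * cis (0 * m)) *\<^sub>C e) (at 0)"
    by (rule bounded_linear.has_vector_derivative[OF _ has_vector_derivative_cis],
        rule bounded_bilinear.bounded_linear_left[OF bounded_bilinear_scaleC_hilbert])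
  then show "(e, m *\<^sub>R e) \<in> group_generator U"
    using e by (simp add: group_generator_iff_derivative unitary_groupD(2)[OF unitary_group]
        eigenvector scaleR_scaleC scaleC_scaleC)
qed

lemma eigen_op_symmetric:
  "(x, y) \<in> eigen_op T \<Longrightarrow> (x', y') \<in> eigen_op T \<Longrightarrow> cinner y x' = cinner x y'"
  using eigen_op_subset_generator group_generator_symmetric[OF unitary_group] by blast

text \<open>On an eigenvector the shifted operator multiplies by \<open>m + c\<close>, which can be
  divided out. As \<open>m\<close> is real, \<open>\<i>\<close> and \<open>- \<i>\<close> are
  admissible values of \<open>c\<close>.\<close>

lemma shifted_range_dense:
  assumes "\<And>m. of_real m + c \<noteq> (0::complex)"
  shows "closure ((\<lambda>(x, y). y + c *\<^sub>C x) ` eigen_op T) = UNIV"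
proof -
  have "cspan (fst ` T) \<subseteq> (\<lambda>(x, y). y + c *\<^sub>C x) ` eigen_op T"
  proof
    fix w assume "w \<in> cspan (fst ` T)"
    then show "w \<in> (\<lambda>(x, y). y + c *\<^sub>C x) ` eigen_op T"
    proof (induction rule: complex_vector.span_induct_alt)
      case base
      have "(0, 0) \<in> eigen_op T"
        using complex_vector.subspace_0[OF csubspace_eigen_op] by (simp add: zero_prod_def)
      then show ?case by (intro image_eqI[of _ _ "(0, 0)"]) auto
    next
      case (step k e w)
      then obtain m x y where m: "(e, m) \<in> T" and xy: "(x, y) \<in> eigen_op T" "w = y + c *\<^sub>C x"
        by auto
      define r where "r = k / (of_real m + c)"
      have "r *\<^sub>C (e, m *\<^sub>R e) + (x, y) \<in> eigen_op T"
        by (intro complex_vector.subspace_add complex_vector.subspace_scale csubspace_eigen_op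
            eigen_op_base m xy)
      moreover have "k *\<^sub>C e + w = (r *\<^sub>C m *\<^sub>R e + y) + c *\<^sub>C (r *\<^sub>C e + x)"
      proof -
        have "r * (of_real m + c) = k" using assms[of m] by (simp add: r_def)
        then have "k = r * of_real m + c * r" by (simp add: algebra_simps)
        then have "k *\<^sub>C e = r *\<^sub>C m *\<^sub>R e + c *\<^sub>C r *\<^sub>C e"
          by (simp add: scaleR_scaleC scaleC_scaleC scaleC_add_left)
        then show ?thesis by (simp add: xy(2) scaleC_add_right)
      qed
      ultimately show ?case by (force intro!: image_eqI)
    qed
  qed
  then show ?thesis using dense_mono[OF total] by blast
qed

text \<open>Since \<open>A = eigen_op T\<close> is symmetric, \<open>(x, y) \<mapsto> y + \<i> x\<close> preserves the norm of the graph, so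
  that the dense range of \<open>A + \<i>\<close> becomes everything for the closure; density of the range of
  \<open>A - \<i>\<close> then shows that the adjoint is not larger than the closure.\<close>

lemma adjoint_eigen_op_subset: "adjoint_op (eigen_op T) \<subseteq> closure (eigen_op T)"
proof clarify
  fix u v assume uv: "(u, v) \<in> adjoint_op (eigen_op T)"
  have "v + \<i> *\<^sub>C u \<in> closure ((\<lambda>(x, y). y + \<i> *\<^sub>C x) ` eigen_op T)"
    by (subst shifted_range_dense) (auto simp: complex_eq_iff)
  then obtain f where f: "\<And>n. f n \<in> (\<lambda>(x, y). y + \<i> *\<^sub>C x) ` eigen_op T" "f \<longlonglongrightarrow> v + \<i> *\<^sub>C u"
    unfolding closure_sequential by blast
  have "\<forall>n. \<exists>p\<in>eigen_op T. f n = snd p + \<i> *\<^sub>C fst p"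
  proof
    fix n
    obtain x y where "(x, y) \<in> eigen_op T" "f n = y + \<i> *\<^sub>C x" using f(1)[of n] by auto
    then show "\<exists>p\<in>eigen_op T. f n = snd p + \<i> *\<^sub>C fst p" by (intro bexI[of _ "(x, y)"]) auto
  qed
  then obtain p where p: "\<And>n. p n \<in> eigen_op T" "\<And>n. f n = snd (p n) + \<i> *\<^sub>C fst (p n)" by metis
  have pyth: "(norm (y + \<i> *\<^sub>C x))\<^sup>2 = (norm y)\<^sup>2 + (norm x)\<^sup>2" if "(x, y) \<in> eigen_op T" for x y
  proof -
    have "complex_of_real ((norm (y + \<i> *\<^sub>C x))\<^sup>2) = cinner y y + cinner x x + \<i> * (cinner x y - cinner y x)"
      unfolding cinner_same[symmetric]
      by (simp add: cinner_add_left cinner_add_right cinner_scaleC_left cinner_scaleC_right algebra_simps)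
    then have "complex_of_real ((norm (y + \<i> *\<^sub>C x))\<^sup>2) = complex_of_real ((norm y)\<^sup>2 + (norm x)\<^sup>2)"
      using eigen_op_symmetric[OF that that] by (simp add: cinner_same)
    then show ?thesis by (simp only: of_real_eq_iff)
  qed
  have "norm (fst (p m) - fst (p n)) \<le> norm (f m - f n)"
    "norm (snd (p m) - snd (p n)) \<le> norm (f m - f n)" for m n
  proof -
    have "(norm (f m - f n))\<^sup>2 = (norm (snd (p m) - snd (p n)))\<^sup>2 + (norm (fst (p m) - fst (p n)))\<^sup>2"
      using pyth[of "fst (p m) - fst (p n)" "snd (p m) - snd (p n)"]
        complex_vector.subspace_diff[OF csubspace_eigen_op p(1)[of m] p(1)[of n]]
      by (simp add: p(2) complex_vector.scale_right_diff_distrib algebra_simps minus_prod_def)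
    then show "norm (fst (p m) - fst (p n)) \<le> norm (f m - f n)"
      "norm (snd (p m) - snd (p n)) \<le> norm (f m - f n)"
      by (auto intro: power2_le_imp_le[OF _ norm_ge_zero])
  qed
  then have "Cauchy (\<lambda>n. fst (p n))" "Cauchy (\<lambda>n. snd (p n))"
    using LIMSEQ_imp_Cauchy[OF f(2)] unfolding Cauchy_def dist_norm by (meson le_less_trans)+
  then obtain x y where xy: "(\<lambda>n. fst (p n)) \<longlonglongrightarrow> x" "(\<lambda>n. snd (p n)) \<longlonglongrightarrow> y"
    by (auto simp: Cauchy_convergent_iff convergent_def)
  have lim: "p \<longlonglongrightarrow> (x, y)" using tendsto_Pair[OF xy] by simp
  then have cl: "(x, y) \<in> closure (eigen_op T)" using p(1) by (auto simp: closure_sequential)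
  have "(\<lambda>n. \<i> *\<^sub>C fst (p n)) \<longlonglongrightarrow> \<i> *\<^sub>C x"
    by (intro bounded_bilinear.tendsto[OF bounded_bilinear_scaleC_hilbert] tendsto_const xy)
  from tendsto_add[OF xy(2) this] have "f \<longlonglongrightarrow> y + \<i> *\<^sub>C x" by (simp only: p(2)[symmetric])
  then have eq: "y + \<i> *\<^sub>C x = v + \<i> *\<^sub>C u" using f(2) by (rule LIMSEQ_unique)
  have adj: "cinner y' x = cinner x' y" if "(x', y') \<in> eigen_op T" for x' y'
  proof (rule LIMSEQ_unique)
    show "(\<lambda>n. cinner y' (fst (p n))) \<longlonglongrightarrow> cinner y' x" by (intro tendsto_cinner tendsto_const xy)
    have "cinner y' (fst (p n)) = cinner x' (snd (p n))" for n
      using eigen_op_symmetric[OF that] p(1)[of n] by (metis prod.collapse)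
    then show "(\<lambda>n. cinner y' (fst (p n))) \<longlonglongrightarrow> cinner x' y"
      by (simp add: tendsto_cinner xy)
  qed
  have "cinner (y' + (- \<i>) *\<^sub>C x') (u - x) = 0" if "(x', y') \<in> eigen_op T" for x' y'
  proof -
    have "cinner y' u = cinner x' v" using uv that by (auto simp: adjoint_op_def)
    moreover have "v = y + \<i> *\<^sub>C x - \<i> *\<^sub>C u" using eq by simp
    ultimately show ?thesis
      using adj[OF that]
      by (simp add: cinner_add_left cinner_diff cinner_scaleC_left cinner_add_right cinner_scaleC_right
          cinner_uminus algebra_simps)
  qed
  then have "u - x = 0"
    by (intro orthogonal_dense_zero[OF shifted_range_dense[of "- \<i>"]]) (auto simp: complex_eq_iff)
  then show "(u, v) \<in> closure (eigen_op T)" using eq cl by simp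
qed

text \<open>As a closed symmetric extension of the diagonal operator, the generator lies between its
  closure and its adjoint, and the adjoint is contained in the closure.\<close>

lemma generator_eq: "group_generator U = closure (eigen_op T)"
proof
  show "closure (eigen_op T) \<subseteq> group_generator U"
    by (rule closure_minimal[OF eigen_op_subset_generator closed_group_generator[OF unitary_group]])
  have "group_generator U \<subseteq> adjoint_op (eigen_op T)"
    using eigen_op_subset_generator group_generator_symmetric[OF unitary_group]
    by (auto simp: adjoint_op_def)
  then show "group_generator U \<subseteq> closure (eigen_op T)" using adjoint_eigen_op_subset by blast
qed

text \<open>An essentially self-adjoint operator has no closed symmetric extension beyond its
  closure. This recognises the difference operator from its eigenbasis.\<close>

lemma closed_symmetric_extension_eq:
  assumes "closed D" "eigen_op T \<subseteq> D"
    and "\<And>x y x' y'. (x, y) \<in> D \<Longrightarrow> (x', y') \<in> D \<Longrightarrow> cinner y x' = cinner x y'"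
  shows "D = closure (eigen_op T)"
proof
  have "D \<subseteq> adjoint_op (eigen_op T)" using assms(2,3) by (auto simp: adjoint_op_def)
  then show "D \<subseteq> closure (eigen_op T)" using adjoint_eigen_op_subset by blast
  show "closure (eigen_op T) \<subseteq> D" by (rule closure_minimal[OF assms(2,1)])
qed

lemma self_adjoint_generator: "self_adjoint_op (group_generator U)"
  unfolding self_adjoint_op_def
proof
  have "cspan (fst ` T) \<subseteq> Domain (group_generator U)"
    using eigen_op_subset_generator Domain_eigen_op[of T] by blast
  then show "closure (Domain (group_generator U)) = UNIV" using dense_mono[OF total] by blast
  have "adjoint_op (group_generator U) \<subseteq> adjoint_op (eigen_op T)"
    using eigen_op_subset_generator by (auto simp: adjoint_op_def)
  moreover have "group_generator U \<subseteq> adjoint_op (group_generator U)"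
    using group_generator_symmetric[OF unitary_group] by (auto simp: adjoint_op_def)
  ultimately show "adjoint_op (group_generator U) = group_generator U"
    using adjoint_eigen_op_subset generator_eq by blast
qed

text \<open>A competing group has the same generator, hence the same phases on the eigenvectors, and
  agrees with \<open>U\<close> on a total set.\<close>

lemma exp_group_eq: "exp_group (group_generator U) = U"
  unfolding exp_group_def
proof (rule the_equality)
  show "is_exp_group (group_generator U) U" by (simp add: is_exp_group_def unitary_group)
next
  fix W assume W: "is_exp_group (group_generator U) W"
  then have un: "unitary_group W" and gen: "group_generator W = group_generator U"
    by (simp_all add: is_exp_group_def)
  have "W t e = U t e" if "e \<in> fst ` T" for t e
  proof -
    from that obtain m where m: "(e, m) \<in> T" by auto
    have "(e, m *\<^sub>R e) \<in> group_generator W"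
      using eigen_op_base[OF m] eigen_op_subset_generator gen by auto
    from unitary_group_eigenvector[OF un this] eigenvector[OF m] show ?thesis by simp
  qed
  then have "W t = U t" for t
    by (intro unitary_op_eq_on_total[OF _ _ unitary unitary total] unitary_groupD[OF un])
  then show "W = U" by (rule ext)
qed

end

text \<open>Phases preserve norms, and the Gram entries of different pairs vanish, so each diagonal
  map preserves the Gram matrix and extends to a unitary.\<close>

lemma exists_eigen_group:
  fixes T :: "('a::chilbert_space \<times> real) set"
  assumes orth: "\<And>e m e' m'. (e, m) \<in> T \<Longrightarrow> (e', m') \<in> T \<Longrightarrow> (e, m) \<noteq> (e', m') \<Longrightarrow> cinner e e' = 0"
    and total: "closure (cspan (fst ` T)) = UNIV"
  shows "\<exists>U. eigen_group U T"
proof -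
  have "\<exists>V. unitary_op V \<and> (\<forall>(u, v) \<in> (\<lambda>(e, m). (e, cis (t * m) *\<^sub>C e)) ` T. V u = v)" for t
  proof (rule exists_unitary_extension)
    let ?G = "(\<lambda>(e, m). (e, cis (t * m) *\<^sub>C e)) ` T"
    show "cinner u u' = cinner v v'" if "(u, v) \<in> ?G" "(u', v') \<in> ?G" for u v u' v'
    proof -
      from that obtain m m' where m: "(u, m) \<in> T" "v = cis (t * m) *\<^sub>C u"
        "(u', m') \<in> T" "v' = cis (t * m') *\<^sub>C u'" by auto
      show ?thesis
        using orth[OF m(1,3)] m
        by (cases "(u, m) = (u', m')")
           (auto simp: cinner_scaleC_left cinner_scaleC_right cis_cnj cis_mult simp flip: mult.assoc)
    qed
    show "closure (cspan (fst ` ?G)) = UNIV" using total by (simp add: image_image case_prod_beta)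
    have "cspan (fst ` T) \<subseteq> cspan (snd ` ?G)"
    proof (rule complex_vector.span_minimal)
      show "fst ` T \<subseteq> cspan (snd ` ?G)"
      proof clarify
        fix e m assume "(e, m) \<in> T"
        then have "cis (t * m) *\<^sub>C e \<in> cspan (snd ` ?G)"
          by (intro complex_vector.span_base) force
        from complex_vector.span_scale[OF this, of "cis (- (t * m))"]
        show "fst (e, m) \<in> cspan (snd ` ?G)" by (simp add: scaleC_scaleC cis_mult)
      qed
    qed simp
    then show "closure (cspan (snd ` ?G)) = UNIV" using dense_mono[OF total] by blast
  qed
  then have "\<forall>t. \<exists>V. unitary_op V \<and> (\<forall>e m. (e, m) \<in> T \<longrightarrow> V e = cis (t * m) *\<^sub>C e)"
    by fastforce
  then obtain U where "\<And>t. unitary_op (U t)" "\<And>t e m. (e, m) \<in> T \<Longrightarrow> U t e = cis (t * m) *\<^sub>C e"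
    by metis
  then have "eigen_group U T" using total by unfold_locales auto
  then show ?thesis by blast
qed

section \<open>The hypergeometric difference operator\<close>

lemma half_integers_shift: "x + 1 \<in> half_integers \<longleftrightarrow> x \<in> half_integers"
  "x - 1 \<in> half_integers \<longleftrightarrow> x \<in> half_integers"
proof -
  have *: "x + of_int n \<in> half_integers" if "x \<in> half_integers" for x n
  proof -
    from that obtain k where "x = of_int k + 1/2" by (auto simp: half_integers_def)
    then show ?thesis by (auto simp: half_integers_def intro!: exI[of _ "k + n"])
  qed
  from *[of x 1] *[of "x + 1" "-1"] show "x + 1 \<in> half_integers \<longleftrightarrow> x \<in> half_integers" by auto
  from *[of x "-1"] *[of "x - 1" 1] show "x - 1 \<in> half_integers \<longleftrightarrow> x \<in> half_integers" by auto
qed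

lemma half_integers_uminus: "- x \<in> half_integers \<longleftrightarrow> x \<in> half_integers"
proof -
  have *: "- x \<in> half_integers" if x: "x \<in> half_integers" for x
  proof -
    from x obtain k where "x = of_int k + 1/2" by (auto simp: half_integers_def)
    then show ?thesis by (auto simp: half_integers_def intro!: exI[of _ "- k - 1"])
  qed
  from *[of x] *[of "- x"] show ?thesis by auto
qed

lemma half_integers_cases:
  assumes "b \<in> half_integers"
  obtains "b \<le> - 1/2" "b < 0" | "1/2 \<le> b" "b > 0"
proof -
  from assms obtain k where k: "b = of_int k + 1/2" by (auto simp: half_integers_def)
  show thesis
  proof (cases "k \<ge> 0")
    case True then show thesis using k that(2) by simp
  next
    case False
    then have "of_int k \<le> (-1 :: real)" by linarith
    then show thesis using k that(1) by simp
  qed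
qed

lemma half_integers_neg_iff: "b \<in> half_integers \<Longrightarrow> b < 0 \<longleftrightarrow> b \<le> - 1/2"
  and half_integers_pos_iff: "b \<in> half_integers \<Longrightarrow> b > 0 \<longleftrightarrow> 1/2 \<le> b"
  by (auto elim: half_integers_cases)

text \<open>Here \<open>x + 1/2\<close> is an integer \<open>n\<close>. For a principal pair the
  product is \<xi> |z + n|^2; for a complementary pair \<open>z + n\<close> and
  \<open>z' + n\<close> lie between the same consecutive integers and so have the same sign.\<close>

lemma hyp_radicand_nonneg:
  assumes pair: "principal_pair z z' \<or> complementary_pair z z'" and "0 < \<xi>" and x: "x \<in> half_integers"
  shows "\<exists>r\<ge>0. of_real \<xi> * (z + of_real x + 1/2) * (z' + of_real x + 1/2) = complex_of_real r"
proof -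
  obtain k where k: "x = of_int k + 1/2" using x by (auto simp: half_integers_def)
  define n :: real where "n = of_int (k + 1)"
  have n: "z + of_real x + 1/2 = z + of_real n" "z' + of_real x + 1/2 = z' + of_real n"
    by (simp_all add: k n_def)
  from pair show ?thesis
  proof
    assume "principal_pair z z'"
    then have "z' = cnj z" by (simp add: principal_pair_def)
    then have "of_real \<xi> * (z + of_real x + 1/2) * (z' + of_real x + 1/2)
        = of_real \<xi> * ((z + of_real n) * cnj (z + of_real n))" unfolding n by simp
    also have "\<dots> = of_real (\<xi> * (cmod (z + of_real n))\<^sup>2)"
      by (simp only: complex_norm_square of_real_mult)
    finally show ?thesis using \<open>0 < \<xi>\<close> by (intro exI[of _ "\<xi> * (cmod (z + of_real n))\<^sup>2"]) auto
  next
    assume "complementary_pair z z'"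
    then obtain j :: int where z: "z = of_real (Re z)" "z' = of_real (Re z')"
      and j: "of_int j < Re z" "Re z < of_int j + 1" "of_int j < Re z'" "Re z' < of_int j + 1"
      by (auto simp: complementary_pair_def of_real_Re)
    have "0 \<le> (Re z + n) * (Re z' + n)"
    proof (cases "j + (k + 1) \<ge> 0")
      case True
      then have "real_of_int j + n \<ge> 0" unfolding n_def by linarith
      then show ?thesis using j by (intro mult_nonneg_nonneg) auto
    next
      case False
      then have "real_of_int j + n \<le> - 1" unfolding n_def by linarith
      then show ?thesis using j by (intro mult_nonpos_nonpos) auto
    qed
    then have "0 \<le> \<xi> * (Re z + n) * (Re z' + n)" using \<open>0 < \<xi>\<close> by (simp add: mult.assoc)
    moreover have "of_real \<xi> * (z + of_real x + 1/2) * (z' + of_real x + 1/2)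
        = complex_of_real (\<xi> * (Re z + n) * (Re z' + n))"
      unfolding n by (subst z(1), subst z(2)) simp
    ultimately show ?thesis by blast
  qed
qed

lemma ell2_shift_adjoint:
  fixes f g :: ell2 and c :: "real \<Rightarrow> complex"
  shows "(\<Sum>\<^sub>\<infinity>x\<in>half_integers. c x * ell2_fun f (x + 1) * cnj (ell2_fun g x))
    = (\<Sum>\<^sub>\<infinity>x\<in>half_integers. c (x - 1) * ell2_fun f x * cnj (ell2_fun g (x - 1)))"
proof -
  have "bij_betw (\<lambda>x. x - 1) half_integers half_integers"
    by (rule bij_betw_byWitness[where f' = "\<lambda>x. x + 1"]) (auto simp: half_integers_shift)
  from infsum_reindex_bij_betw[OF this, of "\<lambda>x. c x * ell2_fun f (x + 1) * cnj (ell2_fun g x)"]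
  show ?thesis by simp
qed

text \<open>The operator is a real Jacobi matrix: the coefficient of \<open>f (x - 1)\<close> at
  \<open>x\<close> is that of \<open>f (x + 1)\<close> taken at \<open>x - 1\<close>. Shifting the
  summation index exchanges the two off-diagonal sums.\<close>

lemma hyp_diff_op_fin_symmetric:
  assumes pair: "principal_pair z z' \<or> complementary_pair z z'" and xi: "0 < \<xi>"
    and fg: "(f, g) \<in> hyp_diff_op_fin z z' \<xi>" "(f', g') \<in> hyp_diff_op_fin z z' \<xi>"
  shows "cinner g f' = cinner f g'"
proof -
  define c where "c x = csqrt (of_real \<xi> * (z + of_real x + 1/2) * (z' + of_real x + 1/2))" for x :: real
  define d where "d x = - (of_real x + of_real \<xi> * (z + z' + of_real x))" for x :: real
  have c1: "csqrt (of_real \<xi> * (z + of_real x - 1/2) * (z' + of_real x - 1/2)) = c (x - 1)" for x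
    by (simp add: c_def algebra_simps)
  have cnj_c: "cnj (c x) = c x" if "x \<in> half_integers" for x
    using hyp_radicand_nonneg[OF pair xi that] by (auto simp: c_def csqrt_of_real_nonneg)
  have "z + z' \<in> \<real>"
    using pair by (auto simp: principal_pair_def complementary_pair_def complex_is_Real_iff)
  then have cnj_d: "cnj (d x) = d x" for x by (auto simp: d_def Reals_cnj_iff)
  let ?F = "ell2_fun f" and ?F' = "ell2_fun f'"
  have fin: "finite {x. ?F x \<noteq> 0}" "finite {x. ?F' x \<noteq> 0}"
    using fg by (auto simp: hyp_diff_op_fin_def)
  have g: "ell2_fun g x = c x * ?F (x + 1) + d x * ?F x + c (x - 1) * ?F (x - 1)"
    and g': "ell2_fun g' x = c x * ?F' (x + 1) + d x * ?F' x + c (x - 1) * ?F' (x - 1)"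
    if "x \<in> half_integers" for x
    using fg that
    by (auto simp: hyp_diff_op_fin_def c1 c_def[symmetric] d_def) (simp_all add: algebra_simps)
  \<comment> \<open>Each term has a factor of finite support, from \<open>f'\<close> on the
    left-hand side and from \<open>f\<close> on the right-hand side, so all sums may be
    split.\<close>
  have sum1: "(\<lambda>x. h x * cnj (?F' x)) summable_on half_integers" for h :: "real \<Rightarrow> complex"
    by (rule finite_nonzero_values_imp_summable_on, rule finite_subset[OF _ fin(2)]) auto
  have sum2: "(\<lambda>x. h x * ?F x * h' x) summable_on half_integers" for h h' :: "real \<Rightarrow> complex"
    by (rule finite_nonzero_values_imp_summable_on, rule finite_subset[OF _ fin(1)]) auto
  let ?S1 = "\<lambda>x. c x * ?F (x + 1) * cnj (?F' x)" and ?S2 = "\<lambda>x. d x * ?F x * cnj (?F' x)"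
    and ?S3 = "\<lambda>x. c (x - 1) * ?F (x - 1) * cnj (?F' x)"
  let ?T1 = "\<lambda>x. c x * ?F x * cnj (?F' (x + 1))" and ?T3 = "\<lambda>x. c (x - 1) * ?F x * cnj (?F' (x - 1))"
  have "cinner g f' = (\<Sum>\<^sub>\<infinity>x\<in>half_integers. ?S1 x + ?S2 x + ?S3 x)"
    unfolding cinner_ell2_def by (rule infsum_cong) (simp add: g algebra_simps)
  also have "\<dots> = infsum ?S1 half_integers + infsum ?S2 half_integers + infsum ?S3 half_integers"
    by (simp add: infsum_add summable_on_add sum1)
  also have "infsum ?S1 half_integers = infsum ?T3 half_integers"
    by (rule ell2_shift_adjoint)
  also have "infsum ?S3 half_integers = infsum ?T1 half_integers"
  proof -
    \<comment> \<open>The index is shifted in the conjugated sum, where \<open>f\<close> and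
      \<open>f'\<close> have changed places.\<close>
    have "infsum ?T1 half_integers = cnj (infsum (\<lambda>x. cnj (c x) * ?F' (x + 1) * cnj (?F x)) half_integers)"
      by (simp add: mult_ac flip: infsum_cnj)
    also have "\<dots> = infsum (\<lambda>x. c (x - 1) * cnj (?F' x) * ?F (x - 1)) half_integers"
      by (simp add: ell2_shift_adjoint flip: infsum_cnj)
    finally show ?thesis by (simp add: mult_ac)
  qed
  also have "infsum ?T3 half_integers + infsum ?S2 half_integers + infsum ?T1 half_integers
      = (\<Sum>\<^sub>\<infinity>x\<in>half_integers. ?T3 x + ?S2 x + ?T1 x)"
    by (simp add: infsum_add summable_on_add sum2)
  also have "\<dots> = cinner f g'"
    unfolding cinner_ell2_def
    by (rule infsum_cong) (simp add: g' cnj_c cnj_d half_integers_shift algebra_simps)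
  finally show ?thesis .
qed

lemma hyp_diff_op_symmetric:
  assumes "principal_pair z z' \<or> complementary_pair z z'" "0 < \<xi>"
    and "(f, g) \<in> hyp_diff_op z z' \<xi>" "(f', g') \<in> hyp_diff_op z z' \<xi>"
  shows "cinner g f' = cinner f g'"
proof -
  obtain p q where p: "\<And>n. p n \<in> hyp_diff_op_fin z z' \<xi>" "p \<longlonglongrightarrow> (f, g)"
    and q: "\<And>n. q n \<in> hyp_diff_op_fin z z' \<xi>" "q \<longlonglongrightarrow> (f', g')"
    using assms(3,4) unfolding hyp_diff_op_def closure_sequential by blast
  have "cinner (snd (p n)) (fst (q n)) = cinner (fst (p n)) (snd (q n))" for n
    using hyp_diff_op_fin_symmetric[OF assms(1,2)] p(1)[of n] q(1)[of n] by (metis prod.collapse)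
  moreover have "(\<lambda>n. cinner (snd (p n)) (fst (q n))) \<longlonglongrightarrow> cinner g f'"
    "(\<lambda>n. cinner (fst (p n)) (snd (q n))) \<longlonglongrightarrow> cinner f g'"
    using tendsto_cinner[OF tendsto_snd[OF p(2)] tendsto_fst[OF q(2)]]
      tendsto_cinner[OF tendsto_fst[OF p(2)] tendsto_snd[OF q(2)]] by simp_all
  ultimately show ?thesis using LIMSEQ_unique by simp
qed

lemma csubspace_hyp_diff_op: "csubspace (hyp_diff_op z z' \<xi>)"
proof -
  \<comment> \<open>Any coefficients give a subspace; as opaque functions they keep the square roots
    out of the simplification.\<close>
  obtain A B C where eq: "hyp_diff_op_fin z z' \<xi> = {(f, g). finite {x. ell2_fun f x \<noteq> 0} \<and>
      (\<forall>x\<in>half_integers. ell2_fun g x = A x * ell2_fun f (x + 1) - B x * ell2_fun f x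
        + C x * ell2_fun f (x - 1))}"
    by (rule that[OF hyp_diff_op_fin_def])
  let ?S = "{(f, g). finite {x. ell2_fun f x \<noteq> 0} \<and>
      (\<forall>x\<in>half_integers. ell2_fun g x = A x * ell2_fun f (x + 1) - B x * ell2_fun f x
        + C x * ell2_fun f (x - 1))}"
  have "csubspace ?S"
  proof (rule complex_vector.subspaceI)
    show "0 \<in> ?S" by (simp add: zero_prod_def ell2_fun_simps)
  next
    fix p q assume "p \<in> ?S" "q \<in> ?S"
    moreover have "{x. ell2_fun f x + ell2_fun g x \<noteq> 0} \<subseteq> {x. ell2_fun f x \<noteq> 0} \<union> {x. ell2_fun g x \<noteq> 0}"
      for f g by auto
    ultimately show "p + q \<in> ?S"
      by (cases p; cases q) (auto simp: ell2_fun_simps algebra_simps intro: finite_subset)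
  next
    fix c p assume "p \<in> ?S"
    moreover have "{x. c * ell2_fun f x \<noteq> 0} \<subseteq> {x. ell2_fun f x \<noteq> 0}" for f by auto
    ultimately show "c *\<^sub>C p \<in> ?S"
      by (cases p) (auto simp: ell2_fun_simps right_diff_distrib distrib_left mult.left_commute)
  qed
  then show ?thesis unfolding hyp_diff_op_def eq by (rule csubspace_closure_prod)
qed

text \<open>The difference operator is a closed symmetric extension of the diagonal operator on
  \<psi>, hence its closure, and the exponential is read off from the phases.\<close>

lemma exp_group_hyp_diff_op:
  assumes pair: "principal_pair z z' \<or> complementary_pair z z'" "0 < \<xi>"
    and onb: "orthonormal_basis half_integers \<psi>"
    and eig: "\<And>b. b \<in> half_integers \<Longrightarrow> (\<psi> b, ((1 - \<xi>) * b) *\<^sub>R \<psi> b) \<in> hyp_diff_op z z' \<xi>"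
  shows "unitary_op (exp_group (hyp_diff_op z z' \<xi>) t)"
    and "b \<in> half_integers \<Longrightarrow>
      exp_group (hyp_diff_op z z' \<xi>) t (\<psi> b) = cis (t * ((1 - \<xi>) * b)) *\<^sub>C \<psi> b"
proof -
  define T where "T = (\<lambda>b. (\<psi> b, (1 - \<xi>) * b)) ` half_integers"
  have T1: "fst ` T = \<psi> ` half_integers" by (simp add: T_def image_image)
  have "\<exists>U. eigen_group U T"
  proof (rule exists_eigen_group)
    show "cinner e e' = 0" if "(e, m) \<in> T" "(e', m') \<in> T" "(e, m) \<noteq> (e', m')" for e m e' m'
    proof -
      from that obtain b b' where "b \<in> half_integers" "b' \<in> half_integers" "e = \<psi> b" "e' = \<psi> b'" "b \<noteq> b'"
        by (auto simp: T_def)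
      then show ?thesis using onb by (simp add: orthonormal_basis_def)
    qed
    show "closure (cspan (fst ` T)) = UNIV" using onb by (simp add: T1 orthonormal_basis_def)
  qed
  then obtain U where "eigen_group U T" ..
  then interpret eigen_group U T .
  have sub: "eigen_op T \<subseteq> hyp_diff_op z z' \<xi>"
    unfolding eigen_op_def
    by (rule complex_vector.span_minimal[OF _ csubspace_hyp_diff_op]) (auto simp: T_def eig)
  have "hyp_diff_op z z' \<xi> = closure (eigen_op T)"
    by (rule closed_symmetric_extension_eq[OF _ sub hyp_diff_op_symmetric[OF pair]])
       (simp_all add: hyp_diff_op_def)
  then have U: "exp_group (hyp_diff_op z z' \<xi>) = U" using exp_group_eq generator_eq by simp
  show "unitary_op (exp_group (hyp_diff_op z z' \<xi>) t)" by (simp add: U unitary)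
  show "exp_group (hyp_diff_op z z' \<xi>) t (\<psi> b) = cis (t * ((1 - \<xi>) * b)) *\<^sub>C \<psi> b"
    if "b \<in> half_integers"
    unfolding U by (rule eigenvector) (use that in \<open>auto simp: T_def\<close>)
qed

section \<open>Orthogonal projections\<close>

lemma ortho_proj_eqI:
  assumes "csubspace S" "p \<in> S" "\<And>y. y \<in> S \<Longrightarrow> cinner (x - p) y = 0"
  shows "ortho_proj S x = p"
  unfolding ortho_proj_def
proof (rule the_equality)
  show "p \<in> S \<and> (\<forall>y\<in>S. cinner (x - p) y = 0)" using assms by blast
next
  fix q assume q: "q \<in> S \<and> (\<forall>y\<in>S. cinner (x - q) y = 0)"
  then have "q - p \<in> S" using assms(1,2) by (simp add: complex_vector.subspace_diff)
  then have "cinner (x - p) (q - p) - cinner (x - q) (q - p) = 0" using q assms(3) by simp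
  then show "q = p" by (simp add: cinner_eq_zero flip: cinner_diff)
qed

lemma ortho_proj_closure_cspan:
  assumes onb: "orthonormal_basis I e" and "J \<subseteq> I" "i \<in> I"
  shows "ortho_proj (closure (cspan (e ` J))) (e i) = (if i \<in> J then e i else 0)"
proof (rule ortho_proj_eqI)
  let ?S = "closure (cspan (e ` J))"
  show sub: "csubspace ?S" by (rule csubspace_closure_hilbert) simp
  have "e ` J \<subseteq> ?S" by (rule order_trans[OF complex_vector.span_superset closure_subset])
  then show "(if i \<in> J then e i else 0) \<in> ?S"
    using complex_vector.subspace_0[OF sub] by (cases "i \<in> J") auto
  fix y assume y: "y \<in> ?S"
  show "cinner (e i - (if i \<in> J then e i else 0)) y = 0"
  proof (cases "i \<in> J")
    case False
    have "cinner s (e i) = 0" if "s \<in> cspan (e ` J)" for s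
      by (rule orthogonal_cspan[OF _ that]) (use onb assms(2,3) False in \<open>auto simp: orthonormal_basis_def\<close>)
    moreover obtain f where f: "\<And>n. f n \<in> cspan (e ` J)" "f \<longlonglongrightarrow> y"
      using y unfolding closure_sequential by blast
    ultimately have "(\<lambda>n. 0) \<longlonglongrightarrow> cinner y (e i)"
      using tendsto_cinner[OF f(2) tendsto_const[of "e i"]] by simp
    then have "cinner y (e i) = 0" using LIMSEQ_unique[OF tendsto_const] by metis
    then show ?thesis using False cinner_commute[of "e i" y] by (simp only: if_False diff_zero complex_cnj_zero)
  qed simp
qed

section \<open>Automatic continuity in C*-algebras\<close>

lemma star_one [simp]: "star 1 = (1 :: 'a::cstar_algebra)"
  using star_mult[of "star 1 :: 'a" 1] by (simp add: star_star)

lemma star_zero [simp]: "star 0 = (0 :: 'a::cstar_algebra)"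
  using star_scaleC[of 0 "0 :: 'a"] by simp

lemma star_uminus: "star (- x) = - star (x :: 'a::cstar_algebra)"
  using star_scaleC[of "-1" x] by simp

lemma star_diff: "star (x - y) = star x - star (y :: 'a::cstar_algebra)"
  using star_add[of x "- y"] by (simp add: star_uminus)

lemma star_scaleR: "star (r *\<^sub>R x) = r *\<^sub>R star (x :: 'a::cstar_algebra)"
  by (simp add: scaleR_scaleC star_scaleC)

lemma star_power: "star (x ^ n) = star x ^ n" for x :: "'a::cstar_algebra"
  by (induction n) (simp_all add: star_mult power_commutes)

lemma norm_star: "norm (star x) = norm (x :: 'a::cstar_algebra)"
proof -
  have *: "norm y \<le> norm (star y)" for y :: 'a
  proof (cases "y = 0")
    case False
    have "(norm y)\<^sup>2 \<le> norm (star y) * norm y"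
      unfolding cstar_identity[symmetric] by (rule norm_mult_ineq)
    then show ?thesis using False by (simp add: power2_eq_square)
  qed simp
  from *[of x] *[of "star x"] show ?thesis by (simp add: star_star)
qed

lemma bounded_linear_star: "bounded_linear (star :: 'a \<Rightarrow> 'a::cstar_algebra)"
  by (rule bounded_linear_intro[where K = 1]) (simp_all add: star_add star_scaleR norm_star)

text \<open>The binomial series for the root of \<open>1 - y\<close> converges absolutely in the
  open unit ball. By Vandermonde's identity its Cauchy square has the binomial coefficients of
  exponent 1, so it stops after the linear term. Limits of real polynomials in \<open>y\<close>
  inherit self-adjointness and commutation.\<close>

lemma exists_selfadjoint_sqrt:
  fixes y :: "'a::cstar_algebra"
  assumes "star y = y" "norm y < 1"
  shows "\<exists>w. star w = w \<and> w * w = 1 - y \<and> (\<forall>x. x * y = y * x \<longrightarrow> x * w = w * x)"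
proof -
  define c :: "nat \<Rightarrow> real" where "c n = (1/2 gchoose n) * (- 1) ^ n" for n
  define f where "f n = c n *\<^sub>R y ^ n" for n
  have "(1/2 :: real) \<notin> \<nat>"
    by (auto simp: Nats_def field_simps)
       (metis numeral_One of_nat_1 of_nat_eq_iff of_nat_mult of_nat_numeral mult.commute odd_one dvd_triv_left)
  then have "summable (\<lambda>n. norm ((1/2 gchoose n) * norm y ^ n :: real))"
    using assms(2) by (intro abs_summable_in_conv_radius) (simp add: conv_radius_gchoose)
  then have sn: "summable (\<lambda>n. norm (f n))"
    by (rule summable_comparison_test[rotated])
       (auto simp: f_def c_def abs_mult power_abs norm_power_ineq intro!: exI[of _ 0] mult_left_mono)
  then have s: "summable f" by (rule summable_norm_cancel)
  define w where "w = suminf f"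
  have conv: "(\<Sum>i\<le>k. f i * f (k - i)) = ((1 gchoose k) * (- 1) ^ k) *\<^sub>R y ^ k" for k
  proof -
    have "(\<Sum>i\<le>k. f i * f (k - i)) = (\<Sum>i\<le>k. (c i * c (k - i)) *\<^sub>R y ^ k)"
      by (rule sum.cong) (auto simp: f_def simp flip: power_add)
    also have "\<dots> = (\<Sum>i\<le>k. (1/2 gchoose i) * (1/2 gchoose (k - i)) * (- 1) ^ k) *\<^sub>R y ^ k"
      unfolding scaleR_sum_left[symmetric]
      by (intro arg_cong2[where f = scaleR] sum.cong refl)
         (auto simp: c_def mult_ac simp flip: power_add)
    also have "\<dots> = ((1 gchoose k) * (- 1) ^ k) *\<^sub>R y ^ k"
      using gbinomial_Vandermonde[of "1/2 :: real" "1/2" k]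
      by (simp add: sum_distrib_right[symmetric] atLeast0AtMost)
    finally show ?thesis .
  qed
  have "(\<lambda>k. ((1 gchoose k) * (- 1) ^ k) *\<^sub>R y ^ k) sums (w * w)"
    using Cauchy_product_sums[OF sn sn] unfolding conv w_def .
  moreover have "(\<lambda>k. ((1 gchoose k) * (- 1) ^ k) *\<^sub>R y ^ k) sums
      (\<Sum>k\<in>{0, 1}. ((1 gchoose k) * (- 1) ^ k) *\<^sub>R y ^ k)"
  proof (rule sums_finite)
    fix k :: nat assume "k \<notin> {0, 1}"
    then have "(1 choose k) = 0" by (intro binomial_eq_0) auto
    then have "(1 gchoose k :: real) = 0"
      using binomial_gbinomial[of 1 k, where 'a = real] by (simp only: of_nat_0 of_nat_1)
    then show "((1 gchoose k :: real) * (- 1) ^ k) *\<^sub>R y ^ k = 0" by simp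
  qed simp
  ultimately have "w * w = 1 - y" using sums_unique2 by fastforce
  moreover have "star w = w"
    unfolding w_def bounded_linear.suminf[OF bounded_linear_star s]
    by (rule suminf_cong) (simp add: f_def star_scaleR star_power assms(1))
  moreover have "x * w = w * x" if "x * y = y * x" for x
  proof -
    have "x * y ^ n = y ^ n * x" for n by (rule power_commuting_commutes[OF that[symmetric], symmetric])
    then show ?thesis
      unfolding w_def by (subst suminf_mult[OF s, symmetric], subst suminf_mult2[OF s])
        (simp add: f_def)
  qed
  ultimately show ?thesis by blast
qed

definition star_hom :: "('a::cstar_algebra \<Rightarrow> 'b::cstar_algebra) \<Rightarrow> bool" where
  "star_hom g \<longleftrightarrow> clinear g \<and> g 1 = 1 \<and>
     (\<forall>x y. g (x * y) = g x * g y) \<and> (\<forall>x. g (star x) = star (g x))"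

lemma star_homD:
  assumes "star_hom g"
  shows "clinear g" "g 1 = 1" "g (x * y) = g x * g y" "g (star x) = star (g x)"
  using assms by (simp_all add: star_hom_def)

text \<open>With \<open>w\<close> a self-adjoint root of \<open>1 - y\<^sup>2\<close> commuting with \<open>y\<close>, the image of \<open>y + \<i> w\<close> is unitary
  and has real part \<open>g y\<close>; this avoids spectral theory.\<close>

lemma star_hom_selfadjoint_unit_ball:
  fixes g :: "'a::cstar_algebra \<Rightarrow> 'b::cstar_algebra"
  assumes g: "star_hom g" and y: "star y = y" "norm y < 1"
  shows "norm (g y) \<le> 1"
proof -
  have "norm (y * y) < 1"
    using cstar_identity[of y] y abs_square_less_1[of "norm y"] by simp
  then obtain w where w: "star w = w" "w * w = 1 - y * y" "y * w = w * y"
    using exists_selfadjoint_sqrt[of "y * y"] y by (auto simp: star_mult mult.assoc)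
  have b: "star (g y) = g y" "star (g w) = g w" "g y * g w = g w * g y"
    using star_homD[OF g] y w by metis+
  have "g y * g y + g w * g w = g (y * y + w * w)"
    by (simp add: star_homD[OF g] clinear_add)
  also have "\<dots> = 1" using w star_homD[OF g] by simp
  finally have bc: "g y * g y + g w * g w = 1" .
  define u where "u = g y + \<i> *\<^sub>C g w"
  have su: "star u = g y - \<i> *\<^sub>C g w" by (simp add: u_def star_add star_scaleC b)
  have "star u * u = 1"
    unfolding su unfolding u_def using bc
    by (simp add: algebra_simps scaleC_mult_left scaleC_mult_right scaleC_scaleC b)
  then have "(norm u)\<^sup>2 = 1\<^sup>2" using cstar_identity[of u] by simp
  then have "norm u = 1" by (rule power2_eq_imp_eq) simp_all
  moreover have "2 *\<^sub>R g y = u + star u" unfolding su by (simp add: u_def scaleR_2)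
  then have "2 * norm (g y) \<le> norm u + norm (star u)"
    using norm_triangle_ineq[of u "star u"] by (metis abs_numeral norm_scaleR)
  ultimately show ?thesis by (simp add: norm_star)
qed

text \<open>The square root exists only in norm below 1, so homomorphisms and states are bounded on
  the open unit ball first; homogeneity does the rest.\<close>

lemma norm_le_of_unit_ball:
  fixes y :: "'a::real_normed_vector" and p :: "'a \<Rightarrow> real"
  assumes "\<And>r. norm (r *\<^sub>R y) < 1 \<Longrightarrow> p (r *\<^sub>R y) \<le> 1"
    and hom: "\<And>r. r > 0 \<Longrightarrow> p (r *\<^sub>R y) = r * p y"
  shows "p y \<le> norm y"
proof (rule dense_ge)
  fix r assume r: "norm y < r"
  then have "r > 0" using norm_ge_zero[of y] by linarith
  then have "p ((1 / r) *\<^sub>R y) \<le> 1" using r by (intro assms(1)) simp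
  then show "p y \<le> r" using hom[of "1 / r"] \<open>r > 0\<close> by (simp add: field_simps)
qed

text \<open>The C*-identity reduces the estimate to the self-adjoint element
  \<open>star x * x\<close>.\<close>

lemma star_hom_contractive:
  fixes g :: "'a::cstar_algebra \<Rightarrow> 'b::cstar_algebra"
  assumes g: "star_hom g"
  shows "norm (g x) \<le> norm x"
proof -
  have selfadj: "norm (g y) \<le> norm y" if "star y = y" for y
  proof (rule norm_le_of_unit_ball[where p = "\<lambda>y. norm (g y)"])
    show "norm (g (r *\<^sub>R y)) \<le> 1" if "norm (r *\<^sub>R y) < 1" for r
      by (rule star_hom_selfadjoint_unit_ball[OF g _ that]) (simp add: star_scaleR \<open>star y = y\<close>)
  qed (simp add: clinear_scaleR[OF star_homD(1)[OF g]])
  have "(norm (g x))\<^sup>2 = norm (g (star x * x))" by (simp add: star_homD[OF g] cstar_identity)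
  also have "\<dots> \<le> norm (star x * x)" by (rule selfadj) (simp add: star_mult star_star)
  also have "\<dots> = (norm x)\<^sup>2" by (rule cstar_identity)
  finally show ?thesis by (rule power2_le_imp_le) simp
qed

lemma star_hom_bounded_linear: "star_hom g \<Longrightarrow> bounded_linear g"
  by (rule bounded_linear_intro[where K = 1])
     (simp_all add: star_homD clinear_add clinear_scaleR star_hom_contractive)

lemma star_hom_eqI:
  assumes "star_hom g" "star_hom g'" "generated_cstar G = UNIV" "\<And>x. x \<in> G \<Longrightarrow> g x = g' x"
  shows "g = g'"
proof -
  let ?E = "{x. g x = g' x}"
  have "star_subalgebra ?E"
    using assms(1,2) by (auto simp: star_subalgebra_def star_hom_def clinear_def)
  moreover have "closed ?E"
    by (intro closed_Collect_eq linear_continuous_on star_hom_bounded_linear assms)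
  ultimately have "generated_cstar G \<subseteq> ?E"
    unfolding generated_cstar_def using assms(4) by blast
  then show ?thesis using assms(3) by auto
qed

section \<open>States\<close>

locale cstar_state_on =
  fixes \<phi> :: "'a::cstar_algebra \<Rightarrow> complex"
  assumes state: "cstar_state \<phi>"
begin

lemma add: "\<phi> (x + y) = \<phi> x + \<phi> y" and scaleC: "\<phi> (c *\<^sub>C x) = c * \<phi> x"
  and positive_real: "\<phi> (star x * x) \<in> \<real>" and positive: "0 \<le> Re (\<phi> (star x * x))"
  and one: "\<phi> 1 = 1"
  using state by (auto simp: cstar_state_def)

lemma uminus: "\<phi> (- x) = - \<phi> x"
  using scaleC[of "-1" x] by simp

lemma diff: "\<phi> (x - y) = \<phi> x - \<phi> y"
  using add[of x "- y"] by (simp add: uminus)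

lemma zero: "\<phi> 0 = 0"
  using scaleC[of 0 0] by simp

lemma scaleR: "\<phi> (r *\<^sub>R x) = of_real r * \<phi> x"
  by (simp add: scaleR_scaleC scaleC)

text \<open>\<open>1 - y\<close> is the square of a self-adjoint element, so positivity applies to
  it.\<close>

lemma selfadjoint_unit_ball:
  assumes "star y = y" "norm y < 1"
  shows "\<phi> y \<in> \<real>" "Re (\<phi> y) \<le> 1"
proof -
  obtain w where "star w = w" "w * w = 1 - y" using exists_selfadjoint_sqrt[OF assms] by blast
  then have "\<phi> (star w * w) = 1 - \<phi> y" by (simp add: diff one)
  then show "\<phi> y \<in> \<real>" "Re (\<phi> y) \<le> 1"
    using positive_real[of w] positive[of w] by (auto simp: complex_is_Real_iff)
qed

lemma selfadjoint_real:
  assumes "star y = y" shows "\<phi> y \<in> \<real>"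
proof -
  define r where "r = 1 / (norm y + 1)"
  have "norm y + 1 > 0" using norm_ge_zero[of y] by linarith
  then have r: "r > 0" "norm (r *\<^sub>R y) < 1" by (simp_all add: r_def)
  have "\<phi> (r *\<^sub>R y) \<in> \<real>"
    by (rule selfadjoint_unit_ball) (use r assms in \<open>simp_all add: star_scaleR\<close>)
  then show ?thesis using r(1) by (simp add: scaleR complex_is_Real_iff)
qed

lemma selfadjoint_bound:
  assumes "star y = y" shows "cmod (\<phi> y) \<le> norm y"
proof -
  have *: "Re (\<phi> y) \<le> norm y" if "star y = y" for y
  proof (rule norm_le_of_unit_ball[where p = "\<lambda>y. Re (\<phi> y)"])
    show "Re (\<phi> (r *\<^sub>R y)) \<le> 1" if "norm (r *\<^sub>R y) < 1" for r
      by (rule selfadjoint_unit_ball(2)[OF _ that]) (simp add: star_scaleR \<open>star y = y\<close>)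
  qed (simp add: scaleR)
  have "\<bar>Re (\<phi> y)\<bar> \<le> norm y" using *[of y] *[of "- y"] assms by (simp add: star_uminus uminus)
  moreover have "\<phi> y = of_real (Re (\<phi> y))" using selfadjoint_real[OF assms] by simp
  ultimately show ?thesis by (metis norm_of_real)
qed

lemma decomposition:
  obtains h k where "star h = h" "star k = k" "x = h + \<i> *\<^sub>C k" "norm h \<le> norm x" "norm k \<le> norm x"
proof (rule that)
  let ?h = "(1/2) *\<^sub>R (x + star x)" and ?k = "(- \<i> / 2) *\<^sub>C (x - star x)"
  show "star ?h = ?h" by (simp add: star_scaleR star_add star_star add.commute)
  show "star ?k = ?k"
    by (simp add: star_scaleC star_diff star_star complex_vector.scale_right_diff_distrib)
  show "x = ?h + \<i> *\<^sub>C ?k"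
    by (simp add: scaleR_scaleC scaleC_scaleC complex_vector.scale_right_diff_distrib scaleC_add_right
        flip: scaleC_add_left)
  show "norm ?h \<le> norm x"
    using norm_triangle_ineq[of x "star x"] by (simp add: norm_star)
  show "norm ?k \<le> norm x"
    using norm_triangle_ineq4[of x "star x"] by (simp add: norm_star norm_scaleC norm_divide)
qed

text \<open>The factor 2 comes from splitting into two self-adjoint parts; the aim is continuity,
  not the sharp constant.\<close>

lemma bound: "cmod (\<phi> x) \<le> 2 * norm x"
proof -
  obtain h k where hk: "star h = h" "star k = k" "x = h + \<i> *\<^sub>C k" "norm h \<le> norm x" "norm k \<le> norm x"
    by (rule decomposition)
  have "cmod (\<phi> x) \<le> cmod (\<phi> h) + cmod (\<i> * \<phi> k)"
    unfolding hk(3) add scaleC by (rule norm_triangle_ineq)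
  then show ?thesis
    using selfadjoint_bound[OF hk(1)] selfadjoint_bound[OF hk(2)] hk(4,5) by (simp add: norm_mult)
qed

lemma bounded_linear: "bounded_linear \<phi>"
  by (rule bounded_linear_intro[where K = 2])
     (use bound in \<open>simp_all add: add scaleR mult.commute scaleR_conv_of_real[of _ "\<phi> _"]\<close>)

lemma star: "\<phi> (star x) = cnj (\<phi> x)"
proof -
  obtain h k where hk: "star h = h" "star k = k" "x = h + \<i> *\<^sub>C k"
    by (rule decomposition)
  then show ?thesis
    using selfadjoint_real[OF hk(1)] selfadjoint_real[OF hk(2)]
    by (simp add: star_add star_scaleC add scaleC Reals_cnj_iff diff)
qed

text \<open>The degenerate case of the Cauchy-Schwarz inequality: positivity at
  \<open>c *\<^sub>C x + star y\<close> leaves an expression affine in the real parameter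
  \<open>s\<close>, which can stay nonnegative only if its slope vanishes.\<close>

lemma null_vector:
  assumes "\<phi> (star x * x) = 0"
  shows "\<phi> (y * x) = 0"
proof -
  define p q where "p = \<phi> (y * x)" and "q = Re (\<phi> (y * star y))"
  have "0 \<le> 2 * s * (cmod p)\<^sup>2 + q" for s :: real
  proof -
    define c where "c = of_real s * cnj p"
    have yx: "\<phi> (star x * star y) = cnj p"
      using star[of "y * x"] by (simp add: star_mult p_def)
    have "star (c *\<^sub>C x + star y) * (c *\<^sub>C x + star y) = (cnj c * c) *\<^sub>C (star x * x)
        + cnj c *\<^sub>C (star x * star y) + c *\<^sub>C (y * x) + y * star y"
      by (simp add: star_add star_scaleC star_star distrib_left distrib_right scaleC_mult_left
          scaleC_mult_right scaleC_scaleC scaleC_add_right add.assoc mult.commute[of c])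
    then have "\<phi> (star (c *\<^sub>C x + star y) * (c *\<^sub>C x + star y)) = cnj c * cnj p + c * p + \<phi> (y * star y)"
      by (simp add: add scaleC assms yx p_def)
    then have "0 \<le> Re (cnj c * cnj p + c * p) + q"
      using positive[of "c *\<^sub>C x + star y"] by (simp add: q_def)
    also have "cnj c * cnj p + c * p = of_real (2 * s * (cmod p)\<^sup>2)"
      by (simp add: c_def complex_norm_square[symmetric] mult_ac complex_norm_square
          del: complex_mult_cnj)
    finally show ?thesis by simp
  qed
  \<comment> \<open>For nonzero \<open>p\<close> this choice of \<open>s\<close> makes the
    nonnegative expression equal to -1.\<close>
  from this[of "- (q + 1) / (2 * (cmod p)\<^sup>2)"] have "p = 0"
    by (cases "p = 0") (auto simp: field_simps)
  then show ?thesis by (simp add: p_def)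
qed

end

section \<open>The CAR algebra and its gauge automorphisms\<close>

text \<open>The universal property speaks of algebras given as records. With the type itself
  packaged as a record, it yields endomorphisms of the algebra.\<close>

definition whole_type_cstar :: "'a::cstar_algebra cstar_struct" where
  "whole_type_cstar = \<lparr>carrier = UNIV, mult = (*), one = 1, zero = 0, add = (+), smult = (*\<^sub>C),
     adj = star, nrm = norm\<rparr>"

lemma whole_type_cstar_sel:
  "carrier whole_type_cstar = UNIV" "mult whole_type_cstar x y = x * y" "one whole_type_cstar = 1"
  "zero whole_type_cstar = 0" "add whole_type_cstar x y = x + y" "smult whole_type_cstar c x = c *\<^sub>C x"
  "adj whole_type_cstar x = star x" "nrm whole_type_cstar x = norm x"
  by (simp_all add: whole_type_cstar_def)

lemma cring_complex_ring: "cring complex_ring"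
proof (rule cringI)
  show "abelian_group complex_ring"
    by (rule abelian_groupI) (auto simp: complex_ring_def intro: exI[of _ "- _"])
  show "comm_monoid complex_ring"
    by (rule comm_monoidI) (auto simp: complex_ring_def)
qed (auto simp: complex_ring_def algebra_simps)

lemma unital_cstar_struct_whole_type: "unital_cstar_struct (whole_type_cstar :: 'a::cstar_algebra cstar_struct)"
proof -
  let ?B = "whole_type_cstar :: 'a cstar_struct"
  have ab: "abelian_group ?B"
    by (rule abelian_groupI) (auto simp: whole_type_cstar_sel add.assoc add.commute intro: exI[of _ "- _"])
  have "monoid ?B" by (rule monoidI) (auto simp: whole_type_cstar_sel mult.assoc)
  with ab have ring: "ring ?B"
    by (rule ringI) (auto simp: whole_type_cstar_sel algebra_simps)
  have mod: "Module.module complex_ring ?B"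
    by (rule moduleI[OF cring_complex_ring ab])
       (auto simp: whole_type_cstar_sel complex_ring_def scaleC_add_left scaleC_add_right scaleC_scaleC)
  have "a_inv ?B y = - y" for y
    by (rule abelian_group.minus_equality[OF ab]) (auto simp: whole_type_cstar_sel)
  then have "(\<lambda>x y. nrm ?B (x \<ominus>\<^bsub>?B\<^esub> y)) = dist"
    by (auto simp: a_minus_def whole_type_cstar_sel dist_norm fun_eq_iff)
  then have complete: "Metric_space.mcomplete (carrier ?B) (\<lambda>x y. nrm ?B (x \<ominus>\<^bsub>?B\<^esub> y))"
    using mcomplete_iff_complete[where 'a = 'a] complete_UNIV by (simp add: whole_type_cstar_sel)
  show ?thesis
    unfolding unital_cstar_struct_def using ring mod complete
    by (simp add: whole_type_cstar_sel scaleC_mult_left scaleC_mult_right star_star star_add star_mult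
        star_scaleC norm_scaleC norm_triangle_ineq norm_mult_ineq cstar_identity)
qed

lemma unitary_op_bij:
  assumes "unitary_op U" shows "bij U"
proof -
  have "inj U"
  proof (rule injI)
    fix x y assume "U x = U y"
    then have "norm (U (x - y)) = 0" by (simp add: clinear_diff[OF unitary_op_clinear[OF assms]])
    then show "x = y" by (simp add: unitary_op_norm[OF assms])
  qed
  then show ?thesis using assms by (simp add: bij_def unitary_op_def)
qed

lemma unitary_op_inv:
  assumes U: "unitary_op U" shows "unitary_op (inv_into UNIV U)"
proof -
  have U_inv: "U (inv_into UNIV U x) = x" and inv_U: "inv_into UNIV U (U x) = x" for x
    using unitary_op_bij[OF U] by (simp_all add: surj_f_inv_f bij_is_surj bij_is_inj)
  have "inv_into UNIV U (x + y) = inv_into UNIV U (U (inv_into UNIV U x + inv_into UNIV U y))"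
    "inv_into UNIV U (c *\<^sub>C x) = inv_into UNIV U (U (c *\<^sub>C inv_into UNIV U x))" for x y c
    by (simp_all only: clinear_add[OF unitary_op_clinear[OF U]]
        clinear_scaleC[OF unitary_op_clinear[OF U]] U_inv)
  then have "clinear (inv_into UNIV U)" by (simp add: clinear_def inv_U)
  moreover have "surj (inv_into UNIV U)" using unitary_op_bij[OF U] bij_imp_bij_inv bij_is_surj by blast
  moreover have "cinner (inv_into UNIV U x) (inv_into UNIV U y) = cinner x y" for x y
    using unitary_op_cinner[OF U, of "inv_into UNIV U x" "inv_into UNIV U y"] by (simp add: U_inv)
  ultimately show ?thesis by (simp add: unitary_op_def)
qed

lemma unitary_op_scalar:
  assumes "cmod l = 1" shows "unitary_op (\<lambda>h. l *\<^sub>C h)"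
proof -
  have l: "l * cnj l = 1" "cnj l * l = 1"
    using assms complex_norm_square[of l] by (simp_all add: mult.commute)
  show ?thesis
    unfolding unitary_op_def clinear_def
    by (auto simp: scaleC_add_right scaleC_scaleC mult.commute cinner_scaleC_left cinner_scaleC_right
        l simp flip: mult.assoc intro!: surjI[where f = "\<lambda>h. cnj l *\<^sub>C h"])
qed

locale CAR =
  fixes a :: "'h::chilbert_space \<Rightarrow> 'a::cstar_algebra"
  assumes CAR_algebra: "CAR_algebra a"
begin

lemma CAR_map: "CAR_map a" and generated: "generated_cstar (range a) = UNIV"
  using CAR_algebra by (simp_all add: CAR_algebra_def)

lemma anticommute: "a h * a k = - (a k * a h)"
  using CAR_map by (simp add: CAR_map_def eq_neg_iff_add_eq_0)

lemma star_anticommute: "star (a h) * a k = cinner h k *\<^sub>C 1 - a k * star (a h)"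
  using CAR_map by (simp add: CAR_map_def eq_diff_eq)

lemma star_a_clinear: "clinear (\<lambda>h. star (a h))"
  using CAR_map by (simp add: CAR_map_def)

lemma a_square: "a h * a h = 0"
proof -
  have "2 *\<^sub>R (a h * a h) = 0"
    using CAR_map by (simp only: CAR_map_def scaleR_2)
  then show ?thesis by simp
qed

text \<open>For \<open>p = star (a h) * a h\<close> the relations give that \<open>p * p\<close> is
  \<open>p\<close> scaled by the square of \<open>norm h\<close>, and the C*-identity turns this
  into a bound on \<open>p\<close>. Continuity of \<open>a\<close> is what makes the basis vectors
  \<psi> sufficient to generate the algebra.\<close>

lemma norm_a: "norm (a h) \<le> norm h"
proof -
  define p where "p = star (a h) * a h"
  have sp: "star p = p" by (simp add: p_def star_mult star_star)
  have "star (a h) * a h * (star (a h) * a h) = star (a h) * (a h * star (a h)) * a h"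
    by (simp add: mult.assoc)
  also have "a h * star (a h) = of_real ((norm h)\<^sup>2) *\<^sub>C 1 - star (a h) * a h"
    by (simp add: star_anticommute cinner_same)
  also have "star (a h) * (of_real ((norm h)\<^sup>2) *\<^sub>C 1 - star (a h) * a h) * a h
      = of_real ((norm h)\<^sup>2) *\<^sub>C p - star (a h) * star (a h) * (a h * a h)"
    by (simp add: p_def algebra_simps scaleC_mult_left scaleC_mult_right)
  finally have "p * p = (norm h)\<^sup>2 *\<^sub>R p" by (simp add: a_square p_def scaleR_scaleC)
  then have "(norm p)\<^sup>2 = (norm h)\<^sup>2 * norm p" using cstar_identity[of p] by (simp add: sp)
  then have "norm p \<le> (norm h)\<^sup>2" by (cases "norm p = 0") (simp_all add: power2_eq_square)
  then have "(norm (a h))\<^sup>2 \<le> (norm h)\<^sup>2" by (simp add: p_def cstar_identity)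
  then show ?thesis by (rule power2_le_imp_le) simp
qed

section \<open>Gauge automorphisms and the gauge-invariant subalgebra\<close>

lemma exists_gauge_hom:
  assumes U: "unitary_op U"
  shows "\<exists>g. star_hom g \<and> (\<forall>h. g (a h) = a (U h))"
proof -
  have "CAR_map_to whole_type_cstar (\<lambda>h. a (U h))"
    using CAR_map unfolding CAR_map_to_def CAR_map_def
    by (simp add: whole_type_cstar_sel clinear_add clinear_scaleC unitary_op_clinear[OF U]
        unitary_op_cinner[OF U] clinear_add[OF star_a_clinear] clinear_scaleC[OF star_a_clinear])
  then obtain g where "star_hom_to whole_type_cstar g" "\<forall>h. g (a h) = a (U h)"
    using CAR_algebra unital_cstar_struct_whole_type unfolding CAR_algebra_def by blast
  moreover have "star_hom g"
    using \<open>star_hom_to _ g\<close> by (simp add: star_hom_to_def star_hom_def whole_type_cstar_sel clinear_def)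
  ultimately show ?thesis by blast
qed

lemma star_hom_comp: "star_hom g \<Longrightarrow> star_hom g' \<Longrightarrow> star_hom (g \<circ> g')"
  by (simp add: star_hom_def clinear_def)

lemma star_hom_id: "star_hom (\<lambda>x. x)"
  by (simp add: star_hom_def clinear_def)

lemma hom_eqI: "star_hom g \<Longrightarrow> star_hom g' \<Longrightarrow> (\<And>h. g (a h) = g' (a h)) \<Longrightarrow> g x = g' x"
  using star_hom_eqI[OF _ _ generated, of g g'] by auto

text \<open>\<open>star_automorphism\<close> does not mention the unit; it is preserved because some
  \<open>y\<close> has \<open>g y = 1\<close>, and then
  \<open>g 1 = g 1 * g y = g y\<close>.\<close>

lemma star_automorphism_imp_hom:
  assumes "star_automorphism g" shows "star_hom g"
proof -
  obtain y where "g y = 1" using assms by (metis star_automorphism_def bij_pointE)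
  moreover have "g 1 * g y = g y" using assms unfolding star_automorphism_def by (metis mult_1)
  ultimately show ?thesis using assms by (simp add: star_automorphism_def star_hom_def)
qed

text \<open>The universal property gives homomorphisms for \<open>U\<close> and for its inverse;
  they are mutually inverse since they are so on generators. Agreement on generators also gives
  uniqueness.\<close>

lemma
  assumes U: "unitary_op U"
  shows gauge_aut_hom: "star_hom (gauge_aut a U)" and gauge_aut_a: "gauge_aut a U (a h) = a (U h)"
proof -
  obtain g where g: "star_hom g" "\<And>h. g (a h) = a (U h)" using exists_gauge_hom[OF U] by blast
  obtain g' where g': "star_hom g'" "\<And>h. g' (a h) = a (inv_into UNIV U h)"
    using exists_gauge_hom[OF unitary_op_inv[OF U]] by blast
  have "(g \<circ> g') x = x" "(g' \<circ> g) x = x" for x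
    by (rule hom_eqI[OF star_hom_comp star_hom_id];
        simp add: g g' bij_is_surj bij_is_inj surj_f_inv_f unitary_op_bij[OF U])+
  then have "bij g" by (intro bij_betw_byWitness[where f' = g']) auto
  then have aut: "star_automorphism g" using g(1) by (simp add: star_automorphism_def star_hom_def)
  have "gauge_aut a U = g"
    unfolding gauge_aut_def
  proof (rule the_equality)
    show "star_automorphism g \<and> (\<forall>h. g (a h) = a (U h))" using aut g(2) by blast
  next
    fix f assume "star_automorphism f \<and> (\<forall>h. f (a h) = a (U h))"
    then show "f = g" using hom_eqI[OF star_automorphism_imp_hom g(1), of f] g(2) by auto
  qed
  then show "star_hom (gauge_aut a U)" "gauge_aut a U (a h) = a (U h)" using g by simp_all
qed

lemma gauge_aut_comp:
  assumes "unitary_op U" "unitary_op W"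
  shows "gauge_aut a U (gauge_aut a W x) = gauge_aut a (U \<circ> W) x"
proof -
  have "(gauge_aut a U \<circ> gauge_aut a W) x = gauge_aut a (U \<circ> W) x"
    by (rule hom_eqI[OF star_hom_comp[OF gauge_aut_hom gauge_aut_hom] gauge_aut_hom])
       (simp_all add: gauge_aut_a unitary_op_comp assms)
  then show ?thesis by simp
qed

lemma gauge_aut_id: "gauge_aut a id x = x"
  by (rule hom_eqI[OF gauge_aut_hom star_hom_id]) (simp_all add: unitary_op_id gauge_aut_a)

lemma star_subalgebra_GICAR: "star_subalgebra (GICAR a)"
proof -
  have "star_hom (gauge_aut a (\<lambda>h. l *\<^sub>C h))" if "cmod l = 1" for l
    by (rule gauge_aut_hom[OF unitary_op_scalar[OF that]])
  then show ?thesis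
    by (auto simp: star_subalgebra_def GICAR_def star_homD clinear_add clinear_scaleC)
qed

lemma gauge_aut_GICAR:
  assumes U: "unitary_op U" and x: "x \<in> GICAR a"
  shows "gauge_aut a U x \<in> GICAR a"
  unfolding GICAR_def
proof clarify
  fix l :: complex assume l: "cmod l = 1"
  have "(\<lambda>h. l *\<^sub>C h) \<circ> U = U \<circ> (\<lambda>h. l *\<^sub>C h)"
    using clinear_scaleC[OF unitary_op_clinear[OF U]] by auto
  then have "gauge_aut a (\<lambda>h. l *\<^sub>C h) (gauge_aut a U x) = gauge_aut a U (gauge_aut a (\<lambda>h. l *\<^sub>C h) x)"
    by (simp add: gauge_aut_comp U unitary_op_scalar[OF l])
  also have "gauge_aut a (\<lambda>h. l *\<^sub>C h) x = x" using x l by (simp add: GICAR_def)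
  finally show "gauge_aut a (\<lambda>h. l *\<^sub>C h) (gauge_aut a U x) = gauge_aut a U x" .
qed

lemma gauge_aut_GICAR_surj:
  assumes U: "unitary_op U" and x: "x \<in> GICAR a"
  shows "\<exists>y\<in>GICAR a. gauge_aut a U y = x"
proof
  show "gauge_aut a (inv_into UNIV U) x \<in> GICAR a" by (rule gauge_aut_GICAR[OF unitary_op_inv[OF U] x])
  have "U \<circ> inv_into UNIV U = id" using unitary_op_bij[OF U] by (metis bij_is_surj surj_iff)
  then show "gauge_aut a U (gauge_aut a (inv_into UNIV U) x) = x"
    by (simp add: gauge_aut_comp U unitary_op_inv[OF U] gauge_aut_id)
qed

end

section \<open>Normal ordering\<close>

lemma clinear_mult_left: "clinear (\<lambda>x. u * x :: 'a::cstar_algebra)"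
  by (simp add: clinear_def distrib_left scaleC_mult_right)

lemma span_mult_closed:
  fixes W :: "'a::cstar_algebra set"
  assumes "\<And>x y. x \<in> W \<Longrightarrow> y \<in> W \<Longrightarrow> x * y \<in> W" "x \<in> cspan W" "y \<in> cspan W"
  shows "x * y \<in> cspan W"
  using assms(2)
proof (induction rule: complex_vector.span_induct_alt)
  case base
  then show ?case by (simp add: complex_vector.span_zero)
next
  case (step c w x)
  have "w * y \<in> cspan ((*) w ` W)" by (rule clinear_image_cspan[OF clinear_mult_left assms(3)])
  also have "\<dots> \<subseteq> cspan W" by (rule complex_vector.span_mono) (use assms(1) step.hyps in auto)
  finally show ?case
    using step.IH
    by (simp add: distrib_right scaleC_mult_left complex_vector.span_add complex_vector.span_scale)
qed

lemma star_subalgebra_span: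
  fixes W :: "'a::cstar_algebra set"
  assumes "1 \<in> W" "\<And>x y. x \<in> W \<Longrightarrow> y \<in> W \<Longrightarrow> x * y \<in> W" "\<And>x. x \<in> W \<Longrightarrow> star x \<in> W"
  shows "star_subalgebra (cspan W)"
proof -
  have "star x \<in> cspan W" if "x \<in> cspan W" for x
    using that
  proof (induction rule: complex_vector.span_induct_alt)
    case base
    then show ?case by (simp add: complex_vector.span_zero)
  next
    case (step c w x)
    then show ?case using complex_vector.span_base[OF assms(3)[of w]]
      by (simp add: star_add star_scaleC complex_vector.span_add complex_vector.span_scale)
  qed
  then show ?thesis
    unfolding star_subalgebra_def
    by (auto intro: complex_vector.span_base assms complex_vector.span_add complex_vector.span_scale
        span_mult_closed[OF assms(2)])
qed

lemma star_subalgebra_closure: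
  assumes S: "star_subalgebra S"
  shows "star_subalgebra (closure S)"
  unfolding star_subalgebra_def
proof (intro conjI ballI allI)
  show "1 \<in> closure S" using S closure_subset by (auto simp: star_subalgebra_def)
next
  fix x y assume "x \<in> closure S" "y \<in> closure S"
  then obtain f g where fg: "\<And>n. f n \<in> S" "f \<longlonglongrightarrow> x" "\<And>n. g n \<in> S" "g \<longlonglongrightarrow> y"
    unfolding closure_sequential by blast
  have "\<forall>n. f n + g n \<in> S" "\<forall>n. f n * g n \<in> S" using S fg by (auto simp: star_subalgebra_def)
  then show "x + y \<in> closure S" and "x * y \<in> closure S"
    using tendsto_add[OF fg(2,4)] tendsto_mult[OF fg(2,4)]
    by (auto simp: closure_sequential)
next
  fix c x assume "x \<in> closure S"
  then obtain f where f: "\<And>n. f n \<in> S" "f \<longlonglongrightarrow> x" unfolding closure_sequential by blast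
  then have "\<forall>n. c *\<^sub>C f n \<in> S" using S by (auto simp: star_subalgebra_def)
  then show "c *\<^sub>C x \<in> closure S"
    using bounded_linear.tendsto[OF bounded_bilinear.bounded_linear_right[OF bounded_bilinear_scaleC_cstar, of c] f(2)]
    unfolding closure_sequential by (intro exI[of _ "\<lambda>n. c *\<^sub>C f n"]) simp
next
  fix x assume "x \<in> closure S"
  then obtain f where f: "\<And>n. f n \<in> S" "f \<longlonglongrightarrow> x" unfolding closure_sequential by blast
  then have "\<forall>n. star (f n) \<in> S" using S by (auto simp: star_subalgebra_def)
  then show "star x \<in> closure S"
    using bounded_linear.tendsto[OF bounded_linear_star f(2)]
    unfolding closure_sequential by (intro exI[of _ "\<lambda>n. star (f n)"]) simp
qed

text \<open>Through the assumptions on \<open>\<phi>\<close>, the levels \<open>b < 0\<close> are empty and the levels \<open>b > 0\<close> are filled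
  in the vacuum; \<open>c b\<close> creates the particle or the hole at level \<open>b\<close>.\<close>

locale particle_hole = CAR a + cstar_state_on \<phi>
  for a :: "'h::chilbert_space \<Rightarrow> 'a::cstar_algebra" and \<phi> :: "'a \<Rightarrow> complex" +
  fixes \<psi> :: "real \<Rightarrow> 'h"
  assumes onb: "orthonormal_basis half_integers \<psi>"
    and vacuum_neg: "b \<in> half_integers \<Longrightarrow> b < 0 \<Longrightarrow> \<phi> (star (a (\<psi> b)) * a (\<psi> b)) = 0"
    and vacuum_pos: "b \<in> half_integers \<Longrightarrow> b > 0 \<Longrightarrow> \<phi> (a (\<psi> b) * star (a (\<psi> b))) = 0"
begin

definition c :: "real \<Rightarrow> 'a" where
  "c b = (if b < 0 then star (a (\<psi> b)) else a (\<psi> b))"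

lemma cinner_psi:
  "b \<in> half_integers \<Longrightarrow> b' \<in> half_integers \<Longrightarrow> cinner (\<psi> b) (\<psi> b') = (if b = b' then 1 else 0)"
  using onb by (simp add: orthonormal_basis_def)

lemma star_star_anticommute: "star (a h) * star (a k) = - (star (a k) * star (a h))"
  using anticommute[of k h] by (metis star_mult star_uminus)

lemma c_anticommute:
  assumes "b \<in> half_integers" "b' \<in> half_integers"
  shows "c b * c b' = - (c b' * c b)"
  using star_anticommute[of "\<psi> b" "\<psi> b'"] star_anticommute[of "\<psi> b'" "\<psi> b"]
  by (auto simp: c_def cinner_psi assms intro: anticommute star_star_anticommute)

lemma c_star_anticommute:
  assumes "b \<in> half_integers" "b' \<in> half_integers"
  shows "star (c b) * c b' = (if b = b' then 1 else 0) - c b' * star (c b)"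
  using star_anticommute[of "\<psi> b" "\<psi> b'"] star_anticommute[of "\<psi> b'" "\<psi> b"]
    anticommute[of "\<psi> b" "\<psi> b'"] star_star_anticommute[of "\<psi> b" "\<psi> b'"]
  by (auto simp: c_def cinner_psi assms star_star)

text \<open>The left kernel of the state. By \<open>null_vector\<close> it is the set of
  \<open>x\<close> with \<open>\<phi> (star x * x) = 0\<close>, but in this form it is visibly a
  subspace and a left ideal.\<close>

definition null_ideal :: "'a set" where
  "null_ideal = {x. \<forall>y. \<phi> (y * x) = 0}"

lemma null_ideal_mult: "x \<in> null_ideal \<Longrightarrow> y * x \<in> null_ideal"
  by (auto simp: null_ideal_def simp flip: mult.assoc)

lemma null_ideal_phi: "x \<in> null_ideal \<Longrightarrow> \<phi> x = 0"
  by (metis (mono_tags, lifting) mem_Collect_eq mult_1 null_ideal_def)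

lemma csubspace_null_ideal: "csubspace null_ideal"
  by (rule complex_vector.subspaceI)
     (auto simp: null_ideal_def zero add scaleC distrib_left scaleC_mult_right)

lemma star_c_null:
  assumes "b \<in> half_integers" shows "star (c b) \<in> null_ideal"
proof -
  have "\<phi> (star (star (c b)) * star (c b)) = 0"
    by (rule half_integers_cases[OF assms])
       (simp_all add: c_def star_star vacuum_neg vacuum_pos assms)
  then show ?thesis using null_vector by (simp add: null_ideal_def)
qed

section \<open>Words in the creators and annihilators\<close>

definition cword :: "real list \<Rightarrow> 'a" where
  "cword bs = prod_list (map c bs)"

definition word :: "(bool \<times> real) list \<Rightarrow> 'a" where
  "word ws = prod_list (map (\<lambda>(s, b). if s then c b else star (c b)) ws)"

text \<open>Annihilators count negatively: under an automorphism that multiplies each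
  \<open>c b\<close> by \<open>cis (d b)\<close>, the word is multiplied by \<open>cis\<close> of
  its degree. The weights in use come from charge and energy.\<close>

definition deg :: "(real \<Rightarrow> real) \<Rightarrow> (bool \<times> real) list \<Rightarrow> real" where
  "deg d ws = sum_list (map (\<lambda>(s, b). if s then d b else - d b) ws)"

lemma cword_simps [simp]: "cword [] = 1" "cword (b # bs) = c b * cword bs"
  "cword (bs @ bs') = cword bs * cword bs'"
  by (simp_all add: cword_def)

lemma word_simps [simp]: "word [] = 1" "word ((True, b) # ws) = c b * word ws"
  "word ((False, b) # ws) = star (c b) * word ws" "word (ws @ ws') = word ws * word ws'"
  by (simp_all add: word_def)

lemma deg_simps [simp]: "deg d [] = 0" "deg d ((True, b) # ws) = d b + deg d ws"
  "deg d ((False, b) # ws) = - d b + deg d ws"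
  by (simp_all add: deg_def)

definition cwords :: "(real \<Rightarrow> real) \<Rightarrow> real \<Rightarrow> 'a set" where
  "cwords d r = {cword bs | bs. set bs \<subseteq> half_integers \<and> sum_list (map d bs) = r}"

text \<open>The summand from \<open>null_ideal\<close> is subject to no degree condition, as neither
  the state nor the vacuum vector sees it.\<close>

definition normal_ordered :: "(real \<Rightarrow> real) \<Rightarrow> real \<Rightarrow> 'a set" where
  "normal_ordered d r = {y + l | y l. y \<in> cspan (cwords d r) \<and> l \<in> null_ideal}"

lemma csubspace_normal_ordered: "csubspace (normal_ordered d r)"
  unfolding normal_ordered_def
  by (rule complex_vector.subspace_sums) (auto intro: csubspace_null_ideal)

lemma cword_normal_ordered:
  assumes "set bs \<subseteq> half_integers" "sum_list (map d bs) = r"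
  shows "cword bs \<in> normal_ordered d r"
  unfolding normal_ordered_def
  using complex_vector.span_base[of "cword bs" "cwords d r"] complex_vector.subspace_0[OF csubspace_null_ideal] assms
  by (force simp: cwords_def)

lemma null_normal_ordered: "l \<in> null_ideal \<Longrightarrow> l \<in> normal_ordered d r"
  unfolding normal_ordered_def using complex_vector.span_zero by force

text \<open>\<open>null_ideal\<close> is a left ideal, so normal ordering can build up a word from
  its right end by multiplication from the left.\<close>

lemma mult_normal_ordered:
  assumes "\<And>bs. set bs \<subseteq> half_integers \<Longrightarrow> sum_list (map d bs) = r \<Longrightarrow> u * cword bs \<in> normal_ordered d s"
    and "x \<in> normal_ordered d r"
  shows "u * x \<in> normal_ordered d s"
proof -
  obtain y l where x: "x = y + l" "y \<in> cspan (cwords d r)" "l \<in> null_ideal"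
    using assms(2) by (auto simp: normal_ordered_def)
  have "u * y \<in> cspan ((*) u ` cwords d r)" by (rule clinear_image_cspan[OF clinear_mult_left x(2)])
  also have "\<dots> \<subseteq> normal_ordered d s"
    by (rule complex_vector.span_minimal[OF _ csubspace_normal_ordered])
       (use assms(1) in \<open>auto simp: cwords_def\<close>)
  finally show ?thesis
    using null_normal_ordered[OF null_ideal_mult[OF x(3)]]
    by (simp add: x(1) distrib_left complex_vector.subspace_add[OF csubspace_normal_ordered])
qed

lemma c_mult_normal_ordered:
  assumes "b \<in> half_integers" "x \<in> normal_ordered d r"
  shows "c b * x \<in> normal_ordered d (d b + r)"
proof (rule mult_normal_ordered[OF _ assms(2)])
  fix bs assume "set bs \<subseteq> half_integers" "sum_list (map d bs) = r"
  then have "cword (b # bs) \<in> normal_ordered d (d b + r)"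
    using assms(1) by (intro cword_normal_ordered) auto
  then show "c b * cword bs \<in> normal_ordered d (d b + r)" by simp
qed

text \<open>The annihilator moves to the right. Meeting a creator of its own level it leaves a term
  in which both are gone, which accounts for the change of degree; at the end of the word it falls
  into \<open>null_ideal\<close>.\<close>

lemma star_c_mult_cword:
  assumes "b \<in> half_integers" "set bs \<subseteq> half_integers"
  shows "star (c b) * cword bs \<in> normal_ordered d (sum_list (map d bs) - d b)"
  using assms(2)
proof (induction bs)
  case Nil
  then show ?case by (simp add: null_normal_ordered star_c_null assms(1))
next
  case (Cons b' bs)
  have "star (c b) * cword (b' # bs)
      = (if b = b' then 1 else 0) * cword bs - c b' * (star (c b) * cword bs)"
    using Cons.prems by (simp add: c_star_anticommute assms(1) left_diff_distrib flip: mult.assoc)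
  moreover have "(if b = b' then 1 else 0) * cword bs
      \<in> normal_ordered d (sum_list (map d (b' # bs)) - d b)"
    using Cons.prems complex_vector.subspace_0[OF csubspace_normal_ordered]
    by (auto intro: cword_normal_ordered)
  moreover have "c b' * (star (c b) * cword bs) \<in> normal_ordered d (sum_list (map d (b' # bs)) - d b)"
    using c_mult_normal_ordered[of b', OF _ Cons.IH] Cons.prems by (simp add: algebra_simps)
  ultimately show ?case by (simp add: complex_vector.subspace_diff[OF csubspace_normal_ordered])
qed

lemma word_normal_ordered:
  "snd ` set ws \<subseteq> half_integers \<Longrightarrow> word ws \<in> normal_ordered d (deg d ws)"
proof (induction ws)
  case Nil
  then show ?case using cword_normal_ordered[of "[]"] by simp
next
  case (Cons w ws)
  obtain s b where w: "w = (s, b)" by (cases w)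
  have b: "b \<in> half_integers" and IH: "word ws \<in> normal_ordered d (deg d ws)" using Cons w by auto
  show ?case
  proof (cases s)
    case True
    then show ?thesis using c_mult_normal_ordered[OF b IH] by (simp add: w)
  next
    case False
    have "star (c b) * word ws \<in> normal_ordered d (- d b + deg d ws)"
    proof (rule mult_normal_ordered[OF _ IH])
      fix bs assume "set bs \<subseteq> half_integers" "sum_list (map d bs) = deg d ws"
      then show "star (c b) * cword bs \<in> normal_ordered d (- d b + deg d ws)"
        using star_c_mult_cword[OF b, of bs d] by simp
    qed
    then show ?thesis using False by (simp add: w)
  qed
qed

text \<open>The adjoint of a nonempty word of creators has an annihilator at its right end, and the
  state respects adjoints.\<close>

lemma phi_cword:
  assumes "set bs \<subseteq> half_integers" "bs \<noteq> []" shows "\<phi> (cword bs) = 0"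
proof -
  obtain b bs' where bs: "bs = b # bs'" using assms(2) by (cases bs) auto
  have "\<phi> (star (cword bs') * star (c b)) = 0"
    using assms(1) by (intro null_ideal_phi null_ideal_mult star_c_null) (simp add: bs)
  then show ?thesis using star[of "cword bs"] by (simp add: bs star_mult)
qed

text \<open>In nonzero degree the empty word, the only one with nonzero expectation, cannot
  occur.\<close>

lemma phi_normal_ordered:
  assumes "x \<in> normal_ordered d r" "r \<noteq> 0"
  shows "\<phi> x = 0"
proof -
  obtain y l where x: "x = y + l" "y \<in> cspan (cwords d r)" "l \<in> null_ideal"
    using assms(1) by (auto simp: normal_ordered_def)
  have "\<phi> y = 0"
    using x(2)
    by (induction rule: complex_vector.span_induct_alt)
       (use assms(2) in \<open>auto simp: zero add scaleC cwords_def intro!: phi_cword\<close>)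
  then show ?thesis by (simp add: x add null_ideal_phi)
qed

section \<open>Gauge invariance\<close>

definition words :: "'a set" where
  "words = {word ws | ws. snd ` set ws \<subseteq> half_integers}"

lemma star_word: "star (word ws) = word (rev (map (\<lambda>(s, b). (\<not> s, b)) ws))"
proof (induction ws)
  case (Cons w ws)
  then show ?case by (cases w; cases "fst w") (auto simp: star_mult star_star)
qed simp

lemma star_subalgebra_words: "star_subalgebra (cspan words)"
proof (rule star_subalgebra_span)
  show "1 \<in> words" by (auto simp: words_def intro: exI[of _ "[]"])
next
  fix x y assume "x \<in> words" "y \<in> words"
  then obtain ws ws' where "x = word ws" "y = word ws'" "snd ` set ws \<subseteq> half_integers" "snd ` set ws' \<subseteq> half_integers"
    by (auto simp: words_def)
  then have "x * y = word (ws @ ws')" "snd ` set (ws @ ws') \<subseteq> half_integers"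
    by (simp_all add: image_Un)
  then show "x * y \<in> words" unfolding words_def by blast
next
  fix x assume "x \<in> words"
  then obtain ws where "x = word ws" "snd ` set ws \<subseteq> half_integers" by (auto simp: words_def)
  then have "star x = word (rev (map (\<lambda>(s, b). (\<not> s, b)) ws))"
    "snd ` set (rev (map (\<lambda>(s, b). (\<not> s, b)) ws)) \<subseteq> half_integers"
    by (auto simp: star_word)
  then show "star x \<in> words" unfolding words_def by blast
qed

lemma a_add: "a (h + k) = a h + a k" and a_scaleC: "a (l *\<^sub>C h) = cnj l *\<^sub>C a h"
proof -
  have "star (star (a (h + k))) = star (star (a h) + star (a k))"
    "star (star (a (l *\<^sub>C h))) = star (l *\<^sub>C star (a h))"
    using star_a_clinear by (simp_all add: clinear_def)
  then show "a (h + k) = a h + a k" "a (l *\<^sub>C h) = cnj l *\<^sub>C a h"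
    by (simp_all add: star_star star_add star_scaleC)
qed

lemma bounded_linear_a: "bounded_linear a"
  by (rule bounded_linear_intro[where K = 1]) (simp_all add: a_add a_scaleC scaleR_scaleC norm_a)

text \<open>By continuity of \<open>a\<close> and totality of the basis, the closed span of the
  words contains all generators, and it is a closed star-subalgebra.\<close>

lemma words_total: "closure (cspan words) = UNIV"
proof -
  have psi: "star (a (\<psi> b)) \<in> words" if "b \<in> half_integers" for b
    using that
    by (auto simp: words_def c_def star_star
        intro!: exI[of _ "[(b < 0, b)]"])
       (cases "b < 0"; simp add: c_def)
  have "a h \<in> cspan words" if "h \<in> cspan (\<psi> ` half_integers)" for h
  proof -
    have "star (a h) \<in> cspan ((\<lambda>h. star (a h)) ` \<psi> ` half_integers)"
      by (rule clinear_image_cspan[OF star_a_clinear that])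
    also have "\<dots> \<subseteq> cspan words" by (rule complex_vector.span_mono) (use psi in auto)
    finally have "star (star (a h)) \<in> cspan words"
      using star_subalgebra_words by (simp add: star_subalgebra_def)
    then show ?thesis by (simp add: star_star)
  qed
  then have "a ` closure (cspan (\<psi> ` half_integers)) \<subseteq> closure (cspan words)"
    by (intro image_closure_subset linear_continuous_on bounded_linear_a)
       (use closure_subset in auto)
  then have "range a \<subseteq> closure (cspan words)" using onb by (simp add: orthonormal_basis_def)
  then have "generated_cstar (range a) \<subseteq> closure (cspan words)"
    unfolding generated_cstar_def
    by (intro Inter_lower) (simp add: star_subalgebra_closure star_subalgebra_words)
  then show ?thesis using generated by auto
qed

lemma diagonal_hom_word:
  assumes g: "star_hom g" "\<And>b. b \<in> half_integers \<Longrightarrow> g (c b) = cis (d b) *\<^sub>C c b"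
  shows "snd ` set ws \<subseteq> half_integers \<Longrightarrow> g (word ws) = cis (deg d ws) *\<^sub>C word ws"
proof (induction ws)
  case Nil
  then show ?case by (simp add: star_homD[OF g(1)])
next
  case (Cons w ws)
  obtain s b where w: "w = (s, b)" by (cases w)
  have b: "g (c b) = cis (d b) *\<^sub>C c b" using Cons.prems w by (auto intro: g)
  then have "g (star (c b)) = cis (- d b) *\<^sub>C star (c b)"
    by (simp add: star_homD[OF g(1)] star_scaleC cis_cnj)
  with b Cons show ?case
    by (cases s) (auto simp: w star_homD[OF g(1)] scaleC_mult_left scaleC_mult_right scaleC_scaleC
        cis_mult mult.commute add.commute)
qed

text \<open>A word of degree 0 is fixed; on a word of any other degree, and on its multiples, the
  state vanishes.\<close>

lemma phi_diagonal_hom: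
  assumes g: "star_hom g" "\<And>b. b \<in> half_integers \<Longrightarrow> g (c b) = cis (d b) *\<^sub>C c b"
  shows "\<phi> (g x) = \<phi> x"
proof -
  let ?E = "{x. \<phi> (g x) = \<phi> x}"
  have "closed ?E"
    by (intro closed_Collect_eq linear_continuous_on bounded_linear
        bounded_linear_compose[OF bounded_linear star_hom_bounded_linear[OF g(1)]])
  moreover have "cspan words \<subseteq> ?E"
  proof (rule complex_vector.span_minimal)
    show "csubspace ?E"
      by (rule complex_vector.subspaceI)
         (auto simp: clinear_zero clinear_add clinear_scaleC star_homD[OF g(1)] add scaleC)
    show "words \<subseteq> ?E"
    proof clarsimp
      fix x assume "x \<in> words"
      then obtain ws where ws: "x = word ws" "snd ` set ws \<subseteq> half_integers" by (auto simp: words_def)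
      have "\<phi> x = 0 \<or> deg d ws = 0"
        using phi_normal_ordered[OF word_normal_ordered[OF ws(2)], of d] ws(1) by blast
      then show "\<phi> (g x) = \<phi> x"
        by (auto simp: ws(1) diagonal_hom_word[OF g ws(2)] scaleC)
    qed
  qed
  ultimately have "closure (cspan words) \<subseteq> ?E" by (intro closure_minimal)
  then show ?thesis using words_total by auto
qed

text \<open>Positive levels receive the opposite phase, because there \<open>c b\<close> is
  \<open>a (\<psi> b)\<close> and \<open>a\<close> is conjugate-linear.\<close>

lemma gauge_aut_c:
  assumes U: "unitary_op U" and "\<And>b. b \<in> half_integers \<Longrightarrow> U (\<psi> b) = cis (e b) *\<^sub>C \<psi> b"
    and "b \<in> half_integers"
  shows "gauge_aut a U (c b) = cis (if b < 0 then e b else - e b) *\<^sub>C c b"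
  by (simp add: c_def star_homD[OF gauge_aut_hom[OF U]] gauge_aut_a[OF U] assms a_scaleC
      star_scaleC cis_cnj)

text \<open>\<open>c b\<close> adds a particle at negative levels and removes one at positive
  levels.\<close>

definition charge :: "real \<Rightarrow> real" where
  "charge b = (if b < 0 then 1 else - 1)"

lemma deg_mult: "deg (\<lambda>b. t * d b) ws = t * deg d ws"
  by (induction ws) (auto simp: deg_def algebra_simps split: prod.splits)

lemma scalar_gauge_word:
  assumes "snd ` set ws \<subseteq> half_integers"
  shows "gauge_aut a (\<lambda>h. cis t *\<^sub>C h) (word ws) = cis (t * deg charge ws) *\<^sub>C word ws"
proof -
  have un: "unitary_op (\<lambda>h. cis t *\<^sub>C h :: 'h)" by (rule unitary_op_scalar) simp
  have "gauge_aut a (\<lambda>h. cis t *\<^sub>C h) (c b) = cis (t * charge b) *\<^sub>C c b" if "b \<in> half_integers" for b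
    using gauge_aut_c[OF un, of "\<lambda>_. t" b] that by (auto simp: charge_def)
  from diagonal_hom_word[OF gauge_aut_hom[OF un] this assms] show ?thesis by (simp add: deg_mult)
qed

definition neutral_words :: "'a set" where
  "neutral_words = {word ws | ws. snd ` set ws \<subseteq> half_integers \<and> deg charge ws = 0}"

lemma neutral_words_GICAR: "cspan neutral_words \<subseteq> GICAR a"
proof (rule complex_vector.span_minimal)
  show "neutral_words \<subseteq> GICAR a"
  proof
    fix x assume "x \<in> neutral_words"
    then obtain ws where ws: "x = word ws" "snd ` set ws \<subseteq> half_integers" "deg charge ws = 0"
      by (auto simp: neutral_words_def)
    show "x \<in> GICAR a"
      unfolding GICAR_def
    proof clarify
      fix l :: complex assume "cmod l = 1"
      then have "cis (Arg l) = l" using cis_Arg[of l] by (cases "l = 0") (auto simp: sgn_div_norm)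
      then show "gauge_aut a (\<lambda>h. l *\<^sub>C h) x = x"
        using scalar_gauge_word[OF ws(2), of "Arg l"] ws(1,3) by simp
    qed
  qed
  have "0 *\<^sub>C 1 \<in> GICAR a" using star_subalgebra_GICAR unfolding star_subalgebra_def by blast
  then show "csubspace (GICAR a)"
    using star_subalgebra_GICAR
    by (intro complex_vector.subspaceI) (auto simp: star_subalgebra_def)
qed

text \<open>A discrete substitute for the integral over the circle. On words whose charge is below
  \<open>n\<close> in modulus it is the exact projection to charge 0, and a combination of words has
  bounded charge. For \<open>n = 0\<close>, division by zero makes it 0.\<close>

definition average :: "nat \<Rightarrow> 'a \<Rightarrow> 'a" where
  "average n x = (1 / real n) *\<^sub>R (\<Sum>k<n. gauge_aut a (\<lambda>h. cis (2 * pi * real k / real n) *\<^sub>C h) x)"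

lemma scalar_gauge_hom: "star_hom (gauge_aut a (\<lambda>h. cis t *\<^sub>C h))"
  by (rule gauge_aut_hom, rule unitary_op_scalar) simp

lemma average_clinear: "clinear (average n)"
  unfolding clinear_def average_def
  by (simp add: star_homD(1)[OF scalar_gauge_hom] clinear_add clinear_scaleC sum.distrib scaleR_add_right
      scaleR_scaleC scaleC_scaleC scaleC_add_right complex_vector.scale_sum_right mult.commute)

lemma average_contractive: "norm (average n x) \<le> norm x"
proof -
  have "norm (\<Sum>k<n. gauge_aut a (\<lambda>h. cis (2 * pi * real k / real n) *\<^sub>C h) x) \<le> (\<Sum>k<n. norm x)"
    by (intro sum_norm_le star_hom_contractive scalar_gauge_hom)
  then show ?thesis by (cases "n = 0") (simp_all add: average_def field_simps)
qed

lemma average_GICAR: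
  assumes "x \<in> GICAR a" "n > 0" shows "average n x = x"
proof -
  have "gauge_aut a (\<lambda>h. cis t *\<^sub>C h) x = x" for t
    using assms(1) by (simp add: GICAR_def)
  then show ?thesis
    using assms(2) by (simp add: average_def sum_constant_scaleR del: sum_constant)
qed

text \<open>\<open>n\<close> does not divide \<open>q\<close>, so the terms form a geometric sum
  over the powers of a root of unity other than 1.\<close>

lemma sum_roots_of_unity_power:
  assumes "q \<noteq> 0" "\<bar>q\<bar> < int n"
  shows "(\<Sum>k<n. cis (2 * pi * real k / real n * of_int q)) = 0"
proof -
  define w where "w = cis (2 * pi * of_int q / real n)"
  have n: "n > 0" using assms by auto
  have "w \<noteq> 1"
  proof
    assume "w = 1"
    then obtain m :: int where "2 * pi * of_int q / real n = of_int (2 * m) * pi"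
      by (auto simp: w_def cis_conv_exp exp_eq_1)
    then have "real_of_int q = of_int (m * int n)" using n by (simp add: field_simps)
    then have "q = m * int n" by (simp only: of_int_eq_iff)
    then show False using assms by (auto simp: abs_mult)
  qed
  have pw: "cis (2 * pi * real k / real n * of_int q) = w ^ k" for k
    unfolding w_def Complex.DeMoivre by (simp add: algebra_simps)
  have "w ^ n = cis (2 * pi * of_int q)" unfolding w_def Complex.DeMoivre using n by simp
  also have "\<dots> = 1" by (rule cis_multiple_2pi) simp
  finally have "w ^ n = 1" .
  then show ?thesis unfolding pw using geometric_sum[OF \<open>w \<noteq> 1\<close>, of n] by simp
qed

lemma deg_charge_int: "deg charge ws \<in> \<int>"
  by (induction ws) (auto simp: deg_def charge_def split: prod.splits)

lemma average_word:
  assumes ws: "snd ` set ws \<subseteq> half_integers" and n: "\<bar>deg charge ws\<bar> < real n"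
  shows "average n (word ws) = (if deg charge ws = 0 then word ws else 0)"
proof -
  obtain q where q: "deg charge ws = of_int q" using deg_charge_int by (auto elim: Ints_cases)
  have "average n (word ws)
      = (1 / real n) *\<^sub>R (\<Sum>k<n. cis (2 * pi * real k / real n * of_int q)) *\<^sub>C word ws"
    by (simp add: average_def scalar_gauge_word[OF ws] q complex_vector.scale_sum_left)
  also have "\<dots> = (if q = 0 then word ws else 0)"
  proof (cases "q = 0")
    case True
    have "n > 0" using n by (cases n) auto
    then show ?thesis using True by (simp add: scaleR_scaleC scaleC_scaleC)
  next
    case False
    have "\<bar>q\<bar> < int n" using n q by linarith
    then show ?thesis using False sum_roots_of_unity_power[of q n] by simp
  qed
  finally show ?thesis by (simp add: q)
qed

lemma average_eventually_neutral:
  assumes "x \<in> cspan words"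
  shows "\<forall>\<^sub>F n in sequentially. average n x \<in> cspan neutral_words"
  using assms
proof (induction rule: complex_vector.span_induct_alt)
  case base
  then show ?case by (simp add: clinear_zero[OF average_clinear] complex_vector.span_zero)
next
  case (step k w x)
  then obtain ws where ws: "w = word ws" "snd ` set ws \<subseteq> half_integers" by (auto simp: words_def)
  have "\<forall>\<^sub>F n in sequentially. \<bar>deg charge ws\<bar> < real n"
    using filterlim_real_sequentially by (simp add: filterlim_at_top_dense)
  then show ?case
    using step.IH
  proof eventually_elim
    case (elim n)
    have "average n w \<in> cspan neutral_words"
      using average_word[OF ws(2) elim(1)] ws
      by (auto simp: neutral_words_def intro: complex_vector.span_base complex_vector.span_zero)
    then show ?case using elim(2)
      by (simp add: clinear_add[OF average_clinear] clinear_scaleC[OF average_clinear]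
          complex_vector.span_add complex_vector.span_scale)
  qed
qed

text \<open>Averaging fixes a gauge-invariant \<open>x\<close>, does not increase distances, and
  makes a nearby combination of words neutral.\<close>

lemma GICAR_subset_closure: "GICAR a \<subseteq> closure (cspan neutral_words)"
proof
  fix x assume x: "x \<in> GICAR a"
  show "x \<in> closure (cspan neutral_words)"
    unfolding closure_approachable
  proof (intro allI impI)
    fix e :: real assume "e > 0"
    moreover have "x \<in> closure (cspan words)" using words_total by simp
    ultimately obtain p where p: "p \<in> cspan words" "dist p x < e"
      unfolding closure_approachable by blast
    have "\<forall>\<^sub>F n in sequentially. average n p \<in> cspan neutral_words \<and> n > 0"
      by (intro eventually_conj average_eventually_neutral p eventually_gt_at_top)
    then obtain n where n: "average n p \<in> cspan neutral_words" "n > 0"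
      by (auto simp: eventually_sequentially)
    have "average n p - x = average n (p - x)"
      by (simp add: clinear_diff[OF average_clinear] average_GICAR[OF x n(2)])
    then have "dist (average n p) x < e"
      using p(2) average_contractive[of n "p - x"] by (simp add: dist_norm)
    then show "\<exists>y\<in>cspan neutral_words. dist y x < e" using n(1) by blast
  qed
qed

section \<open>Excitation words\<close>

lemma c_past_cword:
  assumes "b \<in> half_integers" "set xs \<subseteq> half_integers"
  shows "cword xs * c b = c b * cword xs \<or> cword xs * c b = - (c b * cword xs)"
  using assms(2)
proof (induction xs)
  case (Cons x xs)
  then have x: "c x * c b = - (c b * c x)" and IH:
    "cword xs * c b = c b * cword xs \<or> cword xs * c b = - (c b * cword xs)"
    by (auto intro: c_anticommute assms(1))
  have "c x * (cword xs * c b) = c x * c b * cword xs \<or> c x * (cword xs * c b) = - (c x * c b * cword xs)"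
    using IH by (auto simp: mult.assoc)
  then show ?case by (auto simp: x mult.assoc)
qed simp

text \<open>The sign of the permutation is left open, since only spans are at stake.\<close>

lemma cword_mset_eq:
  assumes "mset bs = mset bs'" "set bs \<subseteq> half_integers"
  shows "cword bs = cword bs' \<or> cword bs = - cword bs'"
  using assms
proof (induction bs arbitrary: bs')
  case (Cons b bs)
  have "b \<in> set bs'" using Cons.prems(1) by (metis list.set_intros(1) set_mset_mset)
  then obtain xs ys where bs': "bs' = xs @ b # ys" by (auto dest: split_list)
  have sub: "set bs' \<subseteq> half_integers" using Cons.prems by (metis set_mset_mset)
  have "mset bs = mset (xs @ ys)" using Cons.prems(1) by (simp add: bs')
  from Cons.IH[OF this] have "cword bs = cword (xs @ ys) \<or> cword bs = - cword (xs @ ys)"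
    using Cons.prems(2) by auto
  moreover have "cword bs' = c b * cword (xs @ ys) \<or> cword bs' = - (c b * cword (xs @ ys))"
    using c_past_cword[of b xs] sub by (auto simp: bs' simp flip: mult.assoc)
  ultimately show ?case by auto
qed simp

text \<open>The Pauli principle: two equal letters can be made adjacent up to sign, and
  \<open>c b\<close> squares to zero.\<close>

lemma cword_not_distinct:
  assumes "\<not> distinct bs" "set bs \<subseteq> half_integers" shows "cword bs = 0"
proof -
  obtain xs b ys zs where bs: "bs = xs @ [b] @ ys @ [b] @ zs"
    using not_distinct_decomp[OF assms(1)] by blast
  have b: "b \<in> half_integers" "set ys \<subseteq> half_integers" using assms(2) by (auto simp: bs)
  have "2 *\<^sub>R (c b * c b) = 0"
    using c_anticommute[OF b(1) b(1)] by (simp add: scaleR_2 eq_neg_iff_add_eq_0)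
  then have cc: "c b * c b = 0" by simp
  have "c b * (cword ys * c b) = c b * c b * cword ys \<or> c b * (cword ys * c b) = - (c b * c b * cword ys)"
    using c_past_cword[OF b] by (auto simp: mult.assoc)
  then have "c b * (cword ys * c b) = 0" by (simp add: cc)
  then have "cword xs * (c b * (cword ys * c b)) * cword zs = 0" by simp
  then show ?thesis by (simp add: bs mult.assoc)
qed

text \<open>Levels as indices of \<open>c\<close>: particles sit at negative levels, whence the sign
  in front of the \<alpha>. Strict decrease selects one order for each pair of sets of
  levels.\<close>

definition excitations :: "real list set" where
  "excitations = {map uminus \<alpha>s @ \<beta>s | \<alpha>s \<beta>s. length \<alpha>s = length \<beta>s \<and>
     sorted_wrt (>) \<alpha>s \<and> set \<alpha>s \<subseteq> {x \<in> half_integers. 1/2 \<le> x} \<and>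
     sorted_wrt (>) \<beta>s \<and> set \<beta>s \<subseteq> {x \<in> half_integers. 1/2 \<le> x}}"

lemma excitations_half_integers: "bs \<in> excitations \<Longrightarrow> set bs \<subseteq> half_integers"
  by (auto simp: excitations_def half_integers_uminus subset_eq)

lemma excitations_charge: "bs \<in> excitations \<Longrightarrow> sum_list (map charge bs) = 0"
proof -
  have "sum_list (map charge xs) = r * length xs" if "\<And>x. x \<in> set xs \<Longrightarrow> charge x = r" for xs r
    using that by (induction xs) (auto simp: algebra_simps)
  from this[of "map uminus _" 1] this[of _ "-1"]
  show "bs \<in> excitations \<Longrightarrow> sum_list (map charge bs) = 0"
    by (fastforce simp: excitations_def charge_def)
qed

text \<open>Neutrality means as many negative as positive levels, so sorting the two groups yields
  an excitation up to sign.\<close>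

lemma neutral_cword_in_span_excitations:
  assumes H: "set bs \<subseteq> half_integers" and neutral: "sum_list (map charge bs) = 0"
  shows "cword bs \<in> cspan (cword ` excitations)"
proof (cases "distinct bs")
  case False
  then show ?thesis using cword_not_distinct[OF _ H] by (simp add: complex_vector.span_zero)
next
  case True
  define \<alpha>s where "\<alpha>s = rev (sort (map uminus (filter (\<lambda>b. b < 0) bs)))"
  define \<beta>s where "\<beta>s = rev (sort (filter (\<lambda>b. \<not> b < 0) bs))"
  have "sum_list (map charge bs) = real (length (filter (\<lambda>b. b < 0) bs)) - real (length (filter (\<lambda>b. \<not> b < 0) bs))"
    for bs by (induction bs) (auto simp: charge_def)
  then have len: "length \<alpha>s = length \<beta>s" using neutral by (simp add: \<alpha>s_def \<beta>s_def)
  have "sorted_wrt (>) \<alpha>s"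
    using True unfolding \<alpha>s_def sorted_wrt_rev
    by (simp add: strict_sorted_iff distinct_map)
  moreover have "sorted_wrt (>) \<beta>s"
    using True unfolding \<beta>s_def sorted_wrt_rev by (simp add: strict_sorted_iff)
  moreover have "set \<alpha>s \<subseteq> {x \<in> half_integers. 1/2 \<le> x}"
    using H half_integers_neg_iff by (fastforce simp: \<alpha>s_def half_integers_uminus)
  moreover have "set \<beta>s \<subseteq> {x \<in> half_integers. 1/2 \<le> x}"
  proof -
    have "1/2 \<le> x" if "x \<in> set bs" "\<not> x < 0" for x
      using H that half_integers_cases[of x "1/2 \<le> x"] by auto
    then show ?thesis using H by (auto simp: \<beta>s_def)
  qed
  ultimately have "map uminus \<alpha>s @ \<beta>s \<in> excitations" unfolding excitations_def using len by blast
  then have "cword (map uminus \<alpha>s @ \<beta>s) \<in> cspan (cword ` excitations)"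
    by (intro complex_vector.span_base imageI)
  moreover have "mset bs = mset (map uminus \<alpha>s @ \<beta>s)"
    by (simp add: \<alpha>s_def \<beta>s_def multiset.map_comp o_def)
  then have "cword bs = cword (map uminus \<alpha>s @ \<beta>s) \<or> cword bs = - cword (map uminus \<alpha>s @ \<beta>s)"
    by (rule cword_mset_eq[OF _ H])
  ultimately show ?thesis using complex_vector.span_neg by fastforce
qed

lemma neutral_word_decomposition:
  assumes "x \<in> neutral_words"
  obtains y l where "x = y + l" "y \<in> cspan (cword ` excitations)" "l \<in> null_ideal"
proof -
  obtain ws where ws: "x = word ws" "snd ` set ws \<subseteq> half_integers" "deg charge ws = 0"
    using assms by (auto simp: neutral_words_def)
  obtain y l where "x = y + l" "y \<in> cspan (cwords charge 0)" "l \<in> null_ideal"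
    using word_normal_ordered[OF ws(2), of charge] ws by (auto simp: normal_ordered_def)
  moreover have "cspan (cwords charge 0) \<subseteq> cspan (cword ` excitations)"
    by (rule complex_vector.span_minimal) (auto simp: cwords_def neutral_cword_in_span_excitations)
  ultimately show ?thesis using that by blast
qed

text \<open>\<open>c b * star (c b)\<close> is the number operator of level \<open>b\<close>: its
  commutator with a creator is that creator at level \<open>b\<close> and 0 at every other level, so
  passing through a word counts occurrences.\<close>

lemma number_operator_cword:
  assumes b: "b \<in> half_integers" and bs: "set bs \<subseteq> half_integers"
  shows "c b * star (c b) * cword bs
    = cword bs * (c b * star (c b)) + of_nat (count_list bs b) * cword bs"
  using bs
proof (induction bs)
  case (Cons b' bs)
  let ?n = "c b * star (c b)"
  have "?n * c b' = c b * (star (c b) * c b')" by (simp add: mult.assoc)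
  also have "\<dots> = (if b = b' then c b else 0) - c b * c b' * star (c b)"
    using Cons.prems by (auto simp: c_star_anticommute b right_diff_distrib mult.assoc)
  also have "c b * c b' = - (c b' * c b)" using Cons.prems by (intro c_anticommute b) auto
  finally have n: "?n * c b' = (if b = b' then c b' else 0) + c b' * ?n" by (simp add: mult.assoc)
  have "?n * cword (b' # bs) = (if b = b' then c b' else 0) * cword bs + c b' * (?n * cword bs)"
  proof -
    have "?n * cword (b' # bs) = (?n * c b') * cword bs" by (simp add: mult.assoc)
    then show ?thesis unfolding n by (simp only: distrib_right mult.assoc)
  qed
  also have "?n * cword bs = cword bs * ?n + of_nat (count_list bs b) * cword bs"
    using Cons by simp
  finally show ?case
    by (auto simp: algebra_simps mult_of_nat_commute)
qed simp

end

section \<open>The GNS space\<close>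

locale particle_hole_GNS = particle_hole a \<phi> \<psi>
  for a :: "ell2 \<Rightarrow> 'a::cstar_algebra" and \<phi> :: "'a \<Rightarrow> complex" and \<psi> :: "real \<Rightarrow> ell2" +
  fixes \<rho> :: "'a \<Rightarrow> 'k::chilbert_space \<Rightarrow> 'k" and \<Omega> :: 'k
  assumes gns: "GNS_triple (GICAR a) \<phi> \<rho> \<Omega>"
begin

lemma GICAR_one: "1 \<in> GICAR a"
  and GICAR_add: "x \<in> GICAR a \<Longrightarrow> y \<in> GICAR a \<Longrightarrow> x + y \<in> GICAR a"
  and GICAR_mult: "x \<in> GICAR a \<Longrightarrow> y \<in> GICAR a \<Longrightarrow> x * y \<in> GICAR a"
  and GICAR_scaleC: "x \<in> GICAR a \<Longrightarrow> l *\<^sub>C x \<in> GICAR a"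
  and GICAR_star: "x \<in> GICAR a \<Longrightarrow> star x \<in> GICAR a"
  using star_subalgebra_GICAR by (auto simp: star_subalgebra_def)

lemma GICAR_diff: "x \<in> GICAR a \<Longrightarrow> y \<in> GICAR a \<Longrightarrow> x - y \<in> GICAR a"
  using GICAR_add[of x "(- 1) *\<^sub>C y"] GICAR_scaleC[of y "- 1"] by simp

lemma rho_add: "x \<in> GICAR a \<Longrightarrow> y \<in> GICAR a \<Longrightarrow> \<rho> (x + y) v = \<rho> x v + \<rho> y v"
  and rho_mult: "x \<in> GICAR a \<Longrightarrow> y \<in> GICAR a \<Longrightarrow> \<rho> (x * y) v = \<rho> x (\<rho> y v)"
  and rho_scaleC: "x \<in> GICAR a \<Longrightarrow> \<rho> (l *\<^sub>C x) v = l *\<^sub>C \<rho> x v"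
  and rho_adjoint: "x \<in> GICAR a \<Longrightarrow> cinner (\<rho> (star x) v) w = cinner v (\<rho> x w)"
  and rho_clinear: "x \<in> GICAR a \<Longrightarrow> clinear (\<rho> x)"
  using gns by (auto simp: GNS_triple_def star_representation_def bounded_clinear_def)

lemma rho_diff: "x \<in> GICAR a \<Longrightarrow> y \<in> GICAR a \<Longrightarrow> \<rho> (x - y) v = \<rho> x v - \<rho> y v"
  using rho_add[of x "(- 1) *\<^sub>C y" v] GICAR_scaleC[of y "- 1"] rho_scaleC[of y "- 1" v] by simp

lemma rho_gram:
  assumes "x \<in> GICAR a" "y \<in> GICAR a"
  shows "cinner (\<rho> x \<Omega>) (\<rho> y \<Omega>) = \<phi> (star y * x)"
proof -
  have "cinner (\<rho> x \<Omega>) (\<rho> y \<Omega>) = cinner (\<rho> (star y * x) \<Omega>) \<Omega>"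
    using rho_adjoint[OF assms(2)] rho_mult[OF GICAR_star[OF assms(2)] assms(1)] by simp
  then show ?thesis
    using gns GICAR_mult[OF GICAR_star[OF assms(2)] assms(1)] by (simp add: GNS_triple_def)
qed

lemma rho_null: "x \<in> GICAR a \<Longrightarrow> x \<in> null_ideal \<Longrightarrow> \<rho> x \<Omega> = 0"
  using rho_gram[of x x] by (simp add: null_ideal_def cinner_eq_zero)

lemma rho_vacuum_bound: "x \<in> GICAR a \<Longrightarrow> (norm (\<rho> x \<Omega>))\<^sup>2 \<le> 2 * (norm x)\<^sup>2"
proof -
  assume x: "x \<in> GICAR a"
  have "(norm (\<rho> x \<Omega>))\<^sup>2 = cmod (cinner (\<rho> x \<Omega>) (\<rho> x \<Omega>))"
    by (simp add: cinner_same norm_power)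
  also have "\<dots> \<le> 2 * norm (star x * x)" unfolding rho_gram[OF x x] by (rule bound)
  finally show ?thesis by (simp add: cstar_identity)
qed

lemma cword_eq_word: "cword bs = word (map (Pair True) bs)"
  by (induction bs) auto

lemma deg_eq_sum_list: "deg d (map (Pair True) bs) = sum_list (map d bs)"
  by (induction bs) auto

lemma excitation_word_GICAR: "bs \<in> excitations \<Longrightarrow> cword bs \<in> GICAR a"
  using excitations_half_integers[of bs] excitations_charge[of bs] complex_vector.span_base
  by (intro subsetD[OF neutral_words_GICAR] complex_vector.span_base)
     (force simp: neutral_words_def cword_eq_word deg_eq_sum_list)

lemma number_operator_GICAR: "b \<in> half_integers \<Longrightarrow> c b * star (c b) \<in> GICAR a"
  by (intro subsetD[OF neutral_words_GICAR] complex_vector.span_base)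
     (auto simp: neutral_words_def intro!: exI[of _ "[(True, b), (False, b)]"])

lemma excitation_vectors_eq: "excitation_vectors a \<rho> \<Omega> \<psi> = (\<lambda>bs. \<rho> (cword bs) \<Omega>) ` excitations"
proof -
  have "prod_list (map (\<lambda>\<alpha>. star (a (\<psi> (- \<alpha>)))) \<alpha>s) * prod_list (map (\<lambda>\<beta>. a (\<psi> \<beta>)) \<beta>s)
      = cword (map uminus \<alpha>s @ \<beta>s)"
    if "set \<alpha>s \<subseteq> {x \<in> half_integers. 1/2 \<le> x}" "set \<beta>s \<subseteq> {x \<in> half_integers. 1/2 \<le> x}" for \<alpha>s \<beta>s
  proof -
    have "map (\<lambda>\<alpha>. star (a (\<psi> (- \<alpha>)))) \<alpha>s = map c (map uminus \<alpha>s)"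
      "map (\<lambda>\<beta>. a (\<psi> \<beta>)) \<beta>s = map c \<beta>s"
      using that by (auto simp: c_def)
    then show ?thesis by (simp only: cword_def map_append prod_list.append)
  qed
  note word = this
  let ?D = "{(\<alpha>s, \<beta>s). length \<alpha>s = length \<beta>s \<and>
    sorted_wrt (>) \<alpha>s \<and> set \<alpha>s \<subseteq> {x \<in> half_integers. 1/2 \<le> x} \<and>
    sorted_wrt (>) \<beta>s \<and> set \<beta>s \<subseteq> {x \<in> half_integers. 1/2 \<le> x}}"
  let ?f = "\<lambda>(\<alpha>s, \<beta>s). \<rho> (prod_list (map (\<lambda>\<alpha>. star (a (\<psi> (- \<alpha>)))) \<alpha>s) * prod_list (map (\<lambda>\<beta>. a (\<psi> \<beta>)) \<beta>s)) \<Omega>"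
  have exc: "excitation_vectors a \<rho> \<Omega> \<psi> = ?f ` ?D"
    unfolding excitation_vectors_def by (rule Set.set_eqI) (simp add: image_iff Bex_def; blast)
  have lists: "excitations = (\<lambda>(\<alpha>s, \<beta>s). map uminus \<alpha>s @ \<beta>s) ` ?D"
    unfolding excitations_def by (rule Set.set_eqI) (simp add: image_iff Bex_def; blast)
  show ?thesis
    unfolding exc lists image_image by (rule image_cong[OF refl]) (use word in auto)
qed

lemma rho_neutral_in_span:
  assumes "x \<in> cspan neutral_words"
  shows "\<rho> x \<Omega> \<in> cspan (excitation_vectors a \<rho> \<Omega> \<psi>)"
proof -
  \<comment> \<open>Membership in \<open>GICAR a\<close> is carried through the induction, because
    linearity of \<open>\<rho>\<close> in the algebra element is available only there.\<close>
  have exc: "y \<in> GICAR a \<and> \<rho> y \<Omega> \<in> cspan (excitation_vectors a \<rho> \<Omega> \<psi>)"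
    if "y \<in> cspan (cword ` excitations)" for y
    using that
  proof (induction rule: complex_vector.span_induct_alt)
    case base
    show ?case using GICAR_scaleC[OF GICAR_one, of 0] rho_scaleC[OF GICAR_one, of 0 \<Omega>]
      by (simp add: complex_vector.span_zero)
  next
    case (step k w y)
    then obtain bs where bs: "bs \<in> excitations" "w = cword bs" by blast
    then have "\<rho> w \<Omega> \<in> cspan (excitation_vectors a \<rho> \<Omega> \<psi>)"
      unfolding excitation_vectors_eq by (intro complex_vector.span_base) blast
    then show ?case
      using step.IH excitation_word_GICAR[OF bs(1)] bs(2)
      by (simp add: rho_add rho_scaleC GICAR_add GICAR_scaleC complex_vector.span_add
          complex_vector.span_scale)
  qed
  have neutral: "\<rho> w \<Omega> \<in> cspan (excitation_vectors a \<rho> \<Omega> \<psi>)" if w: "w \<in> neutral_words" for w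
  proof -
    obtain y l where yl: "w = y + l" "y \<in> cspan (cword ` excitations)" "l \<in> null_ideal"
      by (rule neutral_word_decomposition[OF w])
    have "w \<in> GICAR a" using neutral_words_GICAR complex_vector.span_base[OF w] by blast
    \<comment> \<open>As a difference of gauge-invariant elements the remainder is gauge-invariant,
      so \<open>\<rho>\<close> may be applied to it separately.\<close>
    then have l: "l \<in> GICAR a" using exc[OF yl(2)] GICAR_diff[of w y] by (simp add: yl(1))
    then show ?thesis using exc[OF yl(2)] rho_null[OF l yl(3)] by (simp add: yl(1) rho_add)
  qed
  have "x \<in> GICAR a \<and> \<rho> x \<Omega> \<in> cspan (excitation_vectors a \<rho> \<Omega> \<psi>)"
    using assms
  proof (induction rule: complex_vector.span_induct_alt)
    case base
    show ?case using GICAR_scaleC[OF GICAR_one, of 0] rho_scaleC[OF GICAR_one, of 0 \<Omega>]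
      by (simp add: complex_vector.span_zero)
  next
    case (step k w y)
    then have "w \<in> GICAR a"
      using neutral_words_GICAR complex_vector.span_base[of w neutral_words] by auto
    then show ?case using step.IH neutral[OF step.hyps]
      by (simp add: rho_add rho_scaleC GICAR_add GICAR_scaleC complex_vector.span_add
          complex_vector.span_scale)
  qed
  then show ?thesis ..
qed

lemma excitation_vectors_total: "closure (cspan (excitation_vectors a \<rho> \<Omega> \<psi>)) = UNIV"
proof -
  let ?S = "closure (cspan (excitation_vectors a \<rho> \<Omega> \<psi>))"
  have "\<rho> x \<Omega> \<in> ?S" if x: "x \<in> GICAR a" for x
    unfolding closure_approachable
  proof (intro allI impI)
    fix e :: real assume "e > 0"
    moreover have "x \<in> closure (cspan neutral_words)" using x GICAR_subset_closure by blast
    ultimately obtain p where p: "p \<in> cspan neutral_words" "dist p x < e / 2"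
      unfolding closure_approachable by (meson half_gt_zero)
    have pG: "p \<in> GICAR a" using p(1) neutral_words_GICAR by blast
    have "(norm (\<rho> (p - x) \<Omega>))\<^sup>2 \<le> 2 * (norm (p - x))\<^sup>2"
      by (rule rho_vacuum_bound[OF GICAR_diff[OF pG x]])
    \<comment> \<open>The square root of 2 is rounded up to 2, which matches the distance
      \<open>e / 2\<close>.\<close>
    also have "\<dots> \<le> (2 * norm (p - x))\<^sup>2" by (simp add: power_mult_distrib)
    finally have "norm (\<rho> (p - x) \<Omega>) \<le> 2 * norm (p - x)" by (rule power2_le_imp_le) simp
    then have "dist (\<rho> p \<Omega>) (\<rho> x \<Omega>) < e" using p(2) by (simp add: dist_norm rho_diff[OF pG x])
    then show "\<exists>y\<in>cspan (excitation_vectors a \<rho> \<Omega> \<psi>). dist y (\<rho> x \<Omega>) < e"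
      using rho_neutral_in_span[OF p(1)] by blast
  qed
  then have "closure ((\<lambda>x. \<rho> x \<Omega>) ` GICAR a) \<subseteq> ?S" by (intro closure_minimal) auto
  then show ?thesis using gns by (auto simp: GNS_triple_def)
qed

text \<open>The phase rate of \<open>c b\<close>: a positive level is emptied, which reverses the
  sign. In both cases the value is -k|b|, so for positive \<open>k\<close> each excitation lowers
  the energy.\<close>

definition energy :: "real \<Rightarrow> real \<Rightarrow> real" where
  "energy k b = (if b < 0 then k * b else - (k * b))"

definition excitation_spectrum :: "real \<Rightarrow> ('k \<times> real) set" where
  "excitation_spectrum k = (\<lambda>bs. (\<rho> (cword bs) \<Omega>, sum_list (map (energy k) bs))) ` excitations"

lemma fst_excitation_spectrum: "fst ` excitation_spectrum k = excitation_vectors a \<rho> \<Omega> \<psi>"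
  by (simp add: excitation_spectrum_def excitation_vectors_eq image_image)

section \<open>The second quantization\<close>

text \<open>Invariance of the state equates the Gram matrices before and after the automorphism,
  which gives a unitary for each \<open>t\<close>. Its phases on the excitation vectors then supply
  the group law and the continuity that the definite description demands.\<close>

lemma second_quant_group_eigen:
  assumes U: "\<And>t. unitary_op (U t)"
    "\<And>t b. b \<in> half_integers \<Longrightarrow> U t (\<psi> b) = cis (t * (k * b)) *\<^sub>C \<psi> b"
  shows "eigen_group (second_quant_group a \<rho> \<Omega> U) (excitation_spectrum k)"
proof -
  note hom = gauge_aut_hom[OF U(1)] and inG = gauge_aut_GICAR[OF U(1)]
  have gc: "gauge_aut a (U t) (c b) = cis (t * energy k b) *\<^sub>C c b" if "b \<in> half_integers" for t b
    using gauge_aut_c[of "U t" "\<lambda>b. t * (k * b)" b, OF U(1) U(2) that] that by (simp add: energy_def)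
  have dense: "closure (cspan ((\<lambda>x. \<rho> x \<Omega>) ` GICAR a)) = UNIV"
    by (rule dense_mono[OF _ complex_vector.span_superset]) (use gns in \<open>simp add: GNS_triple_def\<close>)
  have "\<exists>T. unitary_op T \<and> (\<forall>x\<in>GICAR a. T (\<rho> x \<Omega>) = \<rho> (gauge_aut a (U t) x) \<Omega>)" for t
  proof -
    let ?G = "(\<lambda>x. (\<rho> x \<Omega>, \<rho> (gauge_aut a (U t) x) \<Omega>)) ` GICAR a"
    have "\<exists>T. unitary_op T \<and> (\<forall>(u, v)\<in>?G. T u = v)"
    proof (rule exists_unitary_extension)
      fix u v u' v' assume "(u, v) \<in> ?G" "(u', v') \<in> ?G"
      then obtain x y where xy: "x \<in> GICAR a" "y \<in> GICAR a"
        "u = \<rho> x \<Omega>" "v = \<rho> (gauge_aut a (U t) x) \<Omega>" "u' = \<rho> y \<Omega>" "v' = \<rho> (gauge_aut a (U t) y) \<Omega>"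
        by auto
      have "cinner v v' = \<phi> (gauge_aut a (U t) (star y * x))"
        by (simp add: xy rho_gram inG star_homD[OF hom])
      also have "\<dots> = \<phi> (star y * x)" by (rule phi_diagonal_hom[OF hom gc])
      finally show "cinner u u' = cinner v v'" by (simp add: xy rho_gram)
    next
      show "closure (cspan (fst ` ?G)) = UNIV" using dense by (simp add: image_image)
      \<comment> \<open>The automorphism maps \<open>GICAR a\<close> onto itself, so the second
        components form the same dense set as the first.\<close>
      have "gauge_aut a (U t) ` GICAR a = GICAR a"
        using gauge_aut_GICAR_surj[OF U(1), of _ t] inG[of _ t] by (auto simp: image_iff)
      moreover have "snd ` ?G = (\<lambda>x. \<rho> x \<Omega>) ` gauge_aut a (U t) ` GICAR a"
        by (simp add: image_image)
      ultimately have "snd ` ?G = (\<lambda>x. \<rho> x \<Omega>) ` GICAR a" by simp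
      then show "closure (cspan (snd ` ?G)) = UNIV" using dense by simp
    qed
    then show ?thesis by auto
  qed
  then obtain V where V: "\<And>t. unitary_op (V t)"
    "\<And>t x. x \<in> GICAR a \<Longrightarrow> V t (\<rho> x \<Omega>) = \<rho> (gauge_aut a (U t) x) \<Omega>" by metis
  have eig: "eigen_group V (excitation_spectrum k)"
  proof
    show "closure (cspan (fst ` excitation_spectrum k)) = UNIV"
      by (simp add: fst_excitation_spectrum excitation_vectors_total)
    fix t e m assume "(e, m) \<in> excitation_spectrum k"
    then obtain bs where bs: "bs \<in> excitations" "e = \<rho> (cword bs) \<Omega>" "m = sum_list (map (energy k) bs)"
      by (auto simp: excitation_spectrum_def)
    have "gauge_aut a (U t) (word (map (Pair True) bs))
        = cis (deg (\<lambda>b. t * energy k b) (map (Pair True) bs)) *\<^sub>C word (map (Pair True) bs)"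
      by (rule diagonal_hom_word[OF hom gc]) (use excitations_half_integers[OF bs(1)] in auto)
    then have "gauge_aut a (U t) (cword bs) = cis (t * m) *\<^sub>C cword bs"
      by (simp add: bs(3) deg_mult deg_eq_sum_list flip: cword_eq_word)
    then show "V t e = cis (t * m) *\<^sub>C e"
      using V(2)[OF excitation_word_GICAR[OF bs(1)]]
      by (simp add: bs(2) rho_scaleC excitation_word_GICAR[OF bs(1)])
  qed (rule V)
  have "second_quant_group a \<rho> \<Omega> U = V"
    unfolding second_quant_group_def
  proof (rule the_equality)
    show "unitary_group V \<and> (\<forall>t. \<forall>x\<in>GICAR a. V t (\<rho> x \<Omega>) = \<rho> (gauge_aut a (U t) x) \<Omega>)"
      using eigen_group.unitary_group[OF eig] V(2) by blast
  next
    fix W assume W: "unitary_group W \<and> (\<forall>t. \<forall>x\<in>GICAR a. W t (\<rho> x \<Omega>) = \<rho> (gauge_aut a (U t) x) \<Omega>)"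
    have "W t = V t" for t
      by (rule unitary_op_eq_on_total[OF _ _ V(1) V(1) dense])
         (use W V(2) unitary_groupD(1)[of W] in auto)
    then show "W = V" by (rule ext)
  qed
  then show ?thesis using eig by simp
qed

text \<open>\<open>is_exp_group\<close> forces \<open>B\<close> to be the generator of the group, so
  uniqueness is immediate and self-adjointness of the generator is the content.\<close>

lemma dGamma_eq:
  assumes "\<And>t. unitary_op (exp_group D t)"
    "\<And>t b. b \<in> half_integers \<Longrightarrow> exp_group D t (\<psi> b) = cis (t * (k * b)) *\<^sub>C \<psi> b"
  shows "dGamma a \<rho> \<Omega> D = closure (eigen_op (excitation_spectrum k))"
proof -
  interpret E: eigen_group "second_quant_group a \<rho> \<Omega> (exp_group D)" "excitation_spectrum k"
    by (rule second_quant_group_eigen[OF assms])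
  show ?thesis
    unfolding dGamma_def E.generator_eq[symmetric]
    by (rule the_equality)
       (auto simp: is_exp_group_def E.unitary_group E.self_adjoint_generator)
qed

section \<open>The excitation operator\<close>

text \<open>Once the number operator stands at the right end of the word, its annihilator puts that
  term into \<open>null_ideal\<close>, and the count remains.\<close>

lemma number_operator_eigenvector:
  assumes b: "b \<in> half_integers" and bs: "bs \<in> excitations"
  shows "\<rho> (c b * star (c b)) (\<rho> (cword bs) \<Omega>) = real (count_list bs b) *\<^sub>R \<rho> (cword bs) \<Omega>"
proof -
  let ?N = "c b * star (c b)" and ?w = "cword bs"
  note G = number_operator_GICAR[OF b] excitation_word_GICAR[OF bs]
  have null: "?w * ?N \<in> null_ideal"
    unfolding mult.assoc[symmetric] by (intro null_ideal_mult star_c_null b)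
  define l where "l = complex_of_real (real (count_list bs b))"
  have "?N * ?w = ?w * ?N + real (count_list bs b) *\<^sub>R ?w"
    unfolding number_operator_cword[OF b excitations_half_integers[OF bs]]
    by (simp add: scaleR_conv_of_real)
  also have "\<dots> = ?w * ?N + l *\<^sub>C ?w" unfolding l_def scaleR_scaleC ..
  finally have "\<rho> ?N (\<rho> ?w \<Omega>) = \<rho> (?w * ?N) \<Omega> + l *\<^sub>C \<rho> ?w \<Omega>"
    using G by (simp add: rho_add rho_scaleC GICAR_mult GICAR_scaleC flip: rho_mult)
  then show ?thesis
    using rho_null[OF GICAR_mult[OF G(2,1)] null] unfolding l_def scaleR_scaleC by simp
qed

text \<open>Trades a sum over the possibly infinite set \<open>J\<close> of levels for one over list
  entries; each entry contributes a sum with at most one nonzero term.\<close>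

lemma has_sum_count_list:
  fixes v :: 'k
  shows "((\<lambda>b. (f b * real (count_list bs b)) *\<^sub>R v) has_sum sum_list (map f (filter (\<lambda>b. b \<in> J) bs)) *\<^sub>R v) J"
proof (induction bs)
  case Nil
  then show ?case by simp
next
  case (Cons b bs)
  have "((\<lambda>x. (if x = b then f b else 0) *\<^sub>R v) has_sum (if b \<in> J then f b else 0) *\<^sub>R v) J"
  proof -
    have "((\<lambda>x. (if x = b then f b else 0) *\<^sub>R v) has_sum (\<Sum>x\<in>J \<inter> {b}. (if x = b then f b else 0) *\<^sub>R v)) (J \<inter> {b})"
      by (rule has_sum_finite) simp
    then have "((\<lambda>x. (if x = b then f b else 0) *\<^sub>R v) has_sum (\<Sum>x\<in>J \<inter> {b}. (if x = b then f b else 0) *\<^sub>R v)) J"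
      by (rule has_sum_cong_neutral[THEN iffD1, rotated -1]) auto
    moreover have "(\<Sum>x\<in>J \<inter> {b}. (if x = b then f b else 0) *\<^sub>R v) = (if b \<in> J then f b else 0) *\<^sub>R v"
      by (cases "b \<in> J") auto
    ultimately show ?thesis by simp
  qed
  from has_sum_add[OF this Cons.IH] show ?case
    by (rule has_sum_cong[THEN iffD1, rotated, THEN subst[where P = "\<lambda>s. (_ has_sum s) J", rotated]])
       (auto simp: algebra_simps)
qed

text \<open>In terms of \<open>c\<close> both sums run over number operators, whose weighted
  eigenvalues on an excitation vector add up to its energy.\<close>

lemma excitation_op_eq: "excitation_op a \<rho> \<Omega> \<psi> \<xi> = eigen_op (excitation_spectrum (1 - \<xi>))"
proof -
  let ?k = "1 - \<xi>" and ?E = "excitation_vectors a \<rho> \<Omega> \<psi>"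
  let ?Jn = "{b \<in> half_integers. b \<le> - 1/2}" and ?Jp = "{b \<in> half_integers. 1/2 \<le> b}"
  let ?fn = "\<lambda>v b. (?k * b) *\<^sub>R \<rho> (star (a (\<psi> b)) * a (\<psi> b)) v"
  let ?fp = "\<lambda>v b. (?k * b) *\<^sub>R \<rho> (a (\<psi> b) * star (a (\<psi> b))) v"
  let ?g = "\<lambda>v b. (?k * b) *\<^sub>R \<rho> (c b * star (c b)) v"
  have fn: "?fn v b = ?g v b" if "b \<in> ?Jn" for v b using that by (simp add: c_def star_star)
  have fp: "?fp v b = ?g v b" if "b \<in> ?Jp" for v b using that by (simp add: c_def)
  \<comment> \<open>\<open>has_sum\<close> rather than \<open>infsum\<close>, because convergence
    has to be carried along linear combinations.\<close>
  have has_sum: "\<exists>s t. (?g v has_sum s) ?Jn \<and> (?g v has_sum t) ?Jp \<and> w = s - t"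
    if "(v, w) \<in> eigen_op (excitation_spectrum ?k)" for v w
  proof -
    let ?P = "\<lambda>p. \<exists>s t. (?g (fst p) has_sum s) ?Jn \<and> (?g (fst p) has_sum t) ?Jp \<and> snd p = s - t"
    have lin: "?g (l *\<^sub>C u + v) b = l *\<^sub>C ?g u b + ?g v b" if "b \<in> half_integers" for l u v b
      using rho_clinear[OF number_operator_GICAR[OF that]]
      by (simp add: clinear_add clinear_scaleC scaleR_scaleC scaleC_scaleC scaleC_add_right mult.commute)
    have bl: "bounded_linear (\<lambda>x :: 'k. l *\<^sub>C x)" for l
      by (rule bounded_bilinear.bounded_linear_right[OF bounded_bilinear_scaleC_hilbert])
    have zero: "?g 0 b = 0" if "b \<in> half_integers" for b
      using clinear_zero[OF rho_clinear[OF number_operator_GICAR[OF that]]] by simp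
    have "?P (v, w)"
      using that unfolding eigen_op_def
    proof (induction rule: complex_vector.span_induct_alt)
      case base
      have "(?g 0 has_sum 0) ?Jn" "(?g 0 has_sum 0) ?Jp" by (rule has_sum_0, simp add: zero)+
      then show ?case by (auto intro!: exI[of _ 0])
    next
      case (step l p q)
      then obtain bs where bs: "bs \<in> excitations" and p: "p = (\<rho> (cword bs) \<Omega>,
          sum_list (map (energy ?k) bs) *\<^sub>R \<rho> (cword bs) \<Omega>)"
        by (auto simp: excitation_spectrum_def)
      let ?e = "\<rho> (cword bs) \<Omega>"
      obtain s t where st: "(?g (fst q) has_sum s) ?Jn" "(?g (fst q) has_sum t) ?Jp"
        "snd q = s - t" using step.IH by blast
      define s' t' where "s' = sum_list (map ((*) ?k) (filter (\<lambda>b. b \<in> ?Jn) bs)) *\<^sub>R ?e"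
        and "t' = sum_list (map ((*) ?k) (filter (\<lambda>b. b \<in> ?Jp) bs)) *\<^sub>R ?e"
      have e: "?g ?e b = (?k * b * real (count_list bs b)) *\<^sub>R ?e" if "b \<in> half_integers" for b
        by (simp add: number_operator_eigenvector[OF that bs])
      have g': "(?g ?e has_sum s') ?Jn" "(?g ?e has_sum t') ?Jp"
        unfolding s'_def t'_def
        by (rule has_sum_cong[THEN iffD2, OF _ has_sum_count_list], simp add: e)+
      have sum_n: "(?g (l *\<^sub>C ?e + fst q) has_sum (l *\<^sub>C s' + s)) ?Jn"
        by (rule iffD2[OF has_sum_cong has_sum_add[OF has_sum_bounded_linear[OF bl g'(1)] st(1)]])
           (rule lin, simp)
      have sum_p: "(?g (l *\<^sub>C ?e + fst q) has_sum (l *\<^sub>C t' + t)) ?Jp"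
        by (rule iffD2[OF has_sum_cong has_sum_add[OF has_sum_bounded_linear[OF bl g'(2)] st(2)]])
           (rule lin, simp)
      \<comment> \<open>The minus sign before the second sum of the operator is the sign of
        \<open>energy\<close> at positive levels.\<close>
      have "sum_list (map (energy ?k) xs) = sum_list (map ((*) ?k) (filter (\<lambda>b. b \<in> ?Jn) xs))
          - sum_list (map ((*) ?k) (filter (\<lambda>b. b \<in> ?Jp) xs))" if "set xs \<subseteq> half_integers" for xs
        using that
        by (induction xs)
           (auto simp: distrib_left energy_def half_integers_neg_iff half_integers_pos_iff
             elim: half_integers_cases)
      from this[OF excitations_half_integers[OF bs]]
      have "sum_list (map (energy ?k) bs) *\<^sub>R ?e = s' - t'"
        by (simp add: s'_def t'_def scaleR_diff_left)

      have fst: "fst (l *\<^sub>C p + q) = l *\<^sub>C ?e + fst q" by (simp add: p)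
      have snd: "snd (l *\<^sub>C p + q) = (l *\<^sub>C s' + s) - (l *\<^sub>C t' + t)"
        using \<open>sum_list (map (energy ?k) bs) *\<^sub>R ?e = s' - t'\<close>
        by (simp add: p st(3) complex_vector.scale_right_diff_distrib)
      show ?case
        unfolding fst snd
        by (intro conjI exI[of _ "l *\<^sub>C s' + s"] exI[of _ "l *\<^sub>C t' + t"] sum_n sum_p refl)
    qed
    then show ?thesis by simp
  qed
  have sums: "infsum (?fn v) ?Jn - infsum (?fp v) ?Jp = w"
    if vw: "(v, w) \<in> eigen_op (excitation_spectrum ?k)" for v w
  proof -
    obtain s t where "(?g v has_sum s) ?Jn" "(?g v has_sum t) ?Jp" "w = s - t"
      using has_sum[OF vw] by blast
    moreover have "infsum (?fn v) ?Jn = infsum (?g v) ?Jn" "infsum (?fp v) ?Jp = infsum (?g v) ?Jp"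
      by (rule infsum_cong, rule fn fp, assumption)+
    ultimately show ?thesis by (simp add: infsumI)
  qed
  \<comment> \<open>The domains agree, and by \<open>sums\<close> each \<open>v\<close> determines
    its \<open>w\<close>; hence the graphs agree.\<close>
  have dom: "v \<in> cspan ?E \<longleftrightarrow> (\<exists>w. (v, w) \<in> eigen_op (excitation_spectrum ?k))" for v
    using Domain_eigen_op[of "excitation_spectrum ?k"] by (auto simp: fst_excitation_spectrum)
  show ?thesis
    unfolding excitation_op_def using sums dom by (auto; metis)
qed

end

theorem corollary4p2:
  fixes z z' :: complex and \<xi> :: real
    and \<psi> :: "real \<Rightarrow> ell2"
    and K :: "ell2 \<Rightarrow> ell2"
    and a :: "ell2 \<Rightarrow> 'a::cstar_algebra"
    and \<phi> :: "'a \<Rightarrow> complex"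
    and \<rho> :: "'a \<Rightarrow> 'k::chilbert_space \<Rightarrow> 'k"
    and \<Omega> :: 'k
  assumes "principal_pair z z' \<or> complementary_pair z z'"
    and "0 < \<xi>" "\<xi> < 1"
    and "orthonormal_basis half_integers \<psi>"
    and "\<And>b. b \<in> half_integers \<Longrightarrow>
           (\<psi> b, ((1 - \<xi>) * b) *\<^sub>R \<psi> b) \<in> hyp_diff_op z z' \<xi>"
    and "K = ortho_proj (closure (cspan (\<psi> ` {b \<in> half_integers. 1/2 \<le> b})))"
    and "CAR_algebra a"
    and "quasi_free_state a K \<phi>"
    and "GNS_triple (GICAR a) \<phi> \<rho> \<Omega>"
  shows "closure (excitation_op a \<rho> \<Omega> \<psi> \<xi>) = dGamma a \<rho> \<Omega> (hyp_diff_op z z' \<xi>)"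
proof -
  interpret CAR a by unfold_locales (rule assms(7))
  interpret cstar_state_on \<phi> using assms(8) by unfold_locales (simp add: quasi_free_state_def)
  have K: "K (\<psi> b) = (if b < 0 then 0 else \<psi> b)" if b: "b \<in> half_integers" for b
    using ortho_proj_closure_cspan[OF assms(4) _ b, of "{b \<in> half_integers. 1/2 \<le> b}"] b
    by (auto simp: assms(6) elim: half_integers_cases)
  have two_point: "\<phi> (star (a (\<psi> b)) * a (\<psi> b)) = (if b < 0 then 0 else 1)"
    if b: "b \<in> half_integers" for b
  proof -
    have "\<forall>hs ks. \<phi> (prod_list (map (\<lambda>h. star (a h)) (rev hs)) * prod_list (map a ks)) =
        (if length hs = length ks
         then Determinant.det (Matrix.mat (length hs) (length hs)
                (\<lambda>(i, j). cinner (K (hs ! i)) (ks ! j)))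
         else 0)"
      using assms(8) by (simp add: quasi_free_state_def)
    \<comment> \<open>With one vector on each side the determinant is its single entry.\<close>
    from this[rule_format, of "[\<psi> b]" "[\<psi> b]"]
    have "\<phi> (star (a (\<psi> b)) * a (\<psi> b)) = cinner (K (\<psi> b)) (\<psi> b)"
      by (simp add: det_single)
    also have "\<dots> = (if b < 0 then 0 else 1)"
      using assms(4) b by (simp add: K orthonormal_basis_def)
    finally show ?thesis .
  qed
  interpret particle_hole_GNS a \<phi> \<psi> \<rho> \<Omega>
  proof
    fix b assume b: "b \<in> half_integers"
    show "\<phi> (star (a (\<psi> b)) * a (\<psi> b)) = 0" if "b < 0" using two_point[OF b] that by simp
    show "\<phi> (a (\<psi> b) * star (a (\<psi> b))) = 0" if "b > 0"
    proof -
      \<comment> \<open>For a unit vector the two products add up to 1, so a filled level, with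
        two-point value 1, leaves 0.\<close>
      have "a (\<psi> b) * star (a (\<psi> b)) = 1 - star (a (\<psi> b)) * a (\<psi> b)"
        using star_anticommute[of "\<psi> b" "\<psi> b"] assms(4) b by (simp add: orthonormal_basis_def)
      then show ?thesis using two_point[OF b] that by (simp add: diff one)
    qed
  qed (use assms in auto)
  show ?thesis
    unfolding excitation_op_eq
    by (rule dGamma_eq[symmetric]; rule exp_group_hyp_diff_op[OF assms(1,2,4,5)])
qed

end
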